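(* Let $n\ge 3$ and $r\ge 1$ be integers and let $\mathcal{R}=\{j\in\mathbb{Z}: 1\le j\le n/2,\ (j,n)=1\}$. Then for all $s,t\in\mathcal{R}$, $$\sum_{l\in\mathcal{R}}\mathrm{ct}^{(r)}_{sl^*}\,\widehat{\mathrm{ct}}^{(r)}_{lt^*}=\delta_{s,t},$$ where $\delta$ is the Kronecker delta.
   Context: For $j\in\mathbb{Z}$ with $(j,n)=1$, $j^*$ denotes the inverse of $j$ mod $n$, i.e. $jj^*\equiv 1 \pmod n$, $1\le j^*\le n$. Cotangent numbers: for $j\in\mathbb{Z}$, $(j,n)=1$, $\mathrm{ct}^{(r)}_j=i^r\cot^{(r-1)}(\pi j/n)$, where $\cot^{(r-1)}$ is the $(r-1)$th derivative of the cotangent function ($\cot^{(0)}=\cot$). Hecke's numbers: for $j\in\mathbb{Z}$, $(j,n)=1$, $$d^{(r)}_j=\sum_{m\in\mathbb{Z},\ m\equiv j\ (\mathrm{mod}\ n)}\frac{\mu(|m|)}{m^r},$$ where $\mu$ is the Möbius function; for $r=1$ the series is understood as $\lim_{k\to\infty}\sum_{|m|\le k}$. Inverse cotangent numbers: $\widehat{\mathrm{ct}}^{(r)}_j=\dfrac{-i^r\pi^r}{(r-1)!\,n^r}\,d^{(r)}_j$ for $(j,n)=1$. *)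

theory Defs
  imports
    "HOL-Analysis.Analysis"
    "HOL-Computational_Algebra.Squarefree"
    "HOL-Number_Theory.Modular_Inverse"
begin

definition moebius_mu :: "nat \<Rightarrow> int" where
  "moebius_mu m = (if squarefree m then (-1) ^ card (prime_factors m) else 0)"

definition cotangent_number :: "nat \<Rightarrow> int \<Rightarrow> int \<Rightarrow> complex" where
  "cotangent_number r n j =
     \<i> ^ r * complex_of_real ((deriv ^^ (r - 1)) cot (pi * real_of_int j / real_of_int n))"

(* For r = 1 the series converges only conditionally, so it is summed symmetrically; for r \<ge> 2
   it is absolutely convergent and taken as an unordered sum. In both cases the term for m = 0
   (irrelevant if j is coprime to n > 1) would vanish, as moebius_mu 0 = 0. *)
definition hecke_number :: "nat \<Rightarrow> int \<Rightarrow> int \<Rightarrow> real" where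
  "hecke_number r n j =
     (let f = (\<lambda>m::int. real_of_int (moebius_mu (nat \<bar>m\<bar>)) / real_of_int m ^ r)
      in if r = 1
         then lim (\<lambda>k::nat. \<Sum>m | \<bar>m\<bar> \<le> int k \<and> [m = j] (mod n). f m)
         else (\<Sum>\<^sub>\<infinity>m\<in>{m. [m = j] (mod n)}. f m))"

definition inverse_cotangent_number :: "nat \<Rightarrow> int \<Rightarrow> int \<Rightarrow> complex" where
  "inverse_cotangent_number r n j =
     - (\<i> ^ r * of_real pi ^ r) / (fact (r - 1) * of_int n ^ r) * of_real (hecke_number r n j)"

definition half_residues :: "int \<Rightarrow> int set" where
  "half_residues n = {j. 1 \<le> j \<and> real_of_int j \<le> real_of_int n / 2 \<and> coprime j n}"

end

theory Submission
  imports Defs "HOL-Complex_Analysis.Complex_Analysis"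
begin

text \<open>Write \<open>e\<^sub>j(m) = [m \<equiv> j] + (-1)\<^sup>r [m \<equiv> -j]\<close> (congruences modulo \<open>n\<close>), the function called
\<open>parity_class\<close> below. Differentiating the partial fraction expansion of the cotangent
\<open>r - 1\<close> times shows that \<open>cot\<^sup>(\<^sup>r\<^sup>-\<^sup>1\<^sup>)(\<pi>j/n)\<close> is an elementary constant times
\<open>Z(j) = \<Sum> e\<^sub>j(m) / m\<^sup>r\<close>, summed over \<open>m \<ge> 1\<close> (\<open>cot_dirichlet_series\<close>). Folding negative integers onto
positive ones turns Hecke's number into \<open>d(j) = \<Sum> \<mu>(m) e\<^sub>j(m) / m\<^sup>r\<close>. The constants and powers
of \<open>i\<close> cancel, and the claim becomes
\<open>\<Sum> Z(s l\<^sup>*) d(l t\<^sup>*) = e\<^sub>a(1)\<close> with \<open>a = s t\<^sup>*\<close>, summed over \<open>l \<in> R\<close>; its right-hand side is the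
Kronecker delta because distinct elements of \<open>R\<close> are not congruent up to sign and \<open>n \<ge> 3\<close>.

Replace the exponent \<open>r\<close> by a complex \<open>w\<close> with \<open>Re w > 1\<close>, keeping the parity. Everything converges
absolutely and may be multiplied out. Given \<open>m\<close> coprime to \<open>n\<close>, exactly one \<open>l \<in> R\<close> contributes,
and the sum over \<open>l\<close> of \<open>e(m) e(k)\<close>, with the classes \<open>l t\<^sup>*\<close> and \<open>s l\<^sup>*\<close> as indices, is \<open>e\<^sub>a(mk)\<close>; Moebius inversion then
leaves only \<open>mk = 1\<close> (\<open>half_residues_dirichlet_identity\<close>). For \<open>r \<ge> 2\<close> one takes \<open>w = r\<close>.

For \<open>r = 1\<close> one lets \<open>w\<close> decrease to \<open>1\<close>. The series for \<open>Z\<close> causes no trouble: \<open>e\<^sub>j\<close> is odd and periodic, so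
it has bounded partial sums and its series is holomorphic for \<open>Re w > 0\<close>. That the series defining \<open>d\<close>
converges at all lies as deep as the prime number theorem for arithmetic progressions.
Newman's contour argument (\<open>newman_tauberian\<close>) reduces it to an analytic continuation of
\<open>\<Sum> \<mu>(m) e\<^sub>j(m) m\<^sup>-\<^sup>w\<close> to \<open>Re w \<ge> 1\<close>, and also says that the sum at \<open>1\<close> is the value of the continuation.
Decomposing into eigenvectors of the dilations \<open>f(x) \<mapsto> f(gx)\<close>, the function \<open>e\<^sub>j\<close> is a
linear combination of odd Dirichlet characters \<open>\<psi>\<close> (\<open>character_induct\<close>), for which the series is
\<open>1/L(w,\<psi>)\<close>. So everything comes down to \<open>L(w,\<psi>) \<noteq> 0\<close> for \<open>Re w \<ge> 1\<close> (\<open>odd_character_L_nonzero\<close>).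

Non-vanishing at \<open>1 + i\<tau>\<close> is shown by Ingham's method, uniformly in \<open>\<psi>\<close> and \<open>\<tau>\<close>. Put \<open>g(m) = \<psi>(m) m\<^sup>-\<^sup>i\<^sup>\<tau>\<close>,
let \<open>Z\<^sub>n\<close> be the series of the principal character, and let \<open>D\<close> be the series over \<open>m\<close> coprime to \<open>n\<close>
whose coefficients are the squared moduli of \<open>\<Sum> g(d)\<close>, \<open>d\<close> dividing \<open>m\<close>. Then \<open>Z\<^sub>n(2w) D(w)\<close> is
\<open>Z\<^sub>n(w)\<^sup>2\<close> times the product of the series of \<open>g\<close> and of its conjugate
(\<open>square_divisor_sum_identity\<close>). If \<open>L(1 + i\<tau>,\<psi>) = 0\<close>, the zeros of the last two factors cancel the
double pole of \<open>Z\<^sub>n\<^sup>2\<close>, so \<open>F(w) = Z\<^sub>n(2w) D(w)\<close> continues to a neighbourhood of \<open>[1/2, 2]\<close> and \<open>D\<close> continues to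
the disc of radius \<open>3/2\<close> about \<open>2\<close>. The coefficients of \<open>D\<close> are nonnegative, so by Landau's argument \<open>D(x) \<ge> 1\<close>
for \<open>1/2 < x < 2\<close>, whence \<open>F(x) \<ge> Z\<^sub>n(2x)\<close>. As \<open>x\<close> decreases to \<open>1/2\<close> the right-hand side tends to
infinity while \<open>F\<close> stays bounded.\<close>

section \<open>Dirichlet series with bounded partial sums\<close>

text \<open>Since \<open>0 powr z = 0\<close>, the term at \<open>m = 0\<close> vanishes and series may be indexed by all natural numbers.\<close>
abbreviation dirichlet_term :: "(nat \<Rightarrow> complex) \<Rightarrow> complex \<Rightarrow> nat \<Rightarrow> complex" where
  "dirichlet_term f s m \<equiv> f m * of_nat m powr (- s)"

lemma norm_nat_powr: "m > 0 \<Longrightarrow> norm (of_nat m powr s :: complex) = real m powr Re s"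
  by (subst norm_powr_real_powr) auto

lemma summable_dirichlet_term:
  assumes "\<And>m. m > 0 \<Longrightarrow> norm (f m) \<le> C" "Re s > 1"
  shows "(\<lambda>m. norm (dirichlet_term f s m)) summable_on UNIV"
proof -
  have "summable (\<lambda>m. C * real m powr (- Re s))"
    using assms(2) by (intro summable_mult) (simp add: summable_real_powr_iff)
  then have *: "summable (\<lambda>m. norm (dirichlet_term f s m))"
  proof (rule summable_comparison_test')
    fix m :: nat assume "m \<ge> 0"
    show "norm (norm (dirichlet_term f s m)) \<le> C * real m powr (- Re s)"
    proof (cases "m = 0")
      case False
      then show ?thesis using assms(1)[of m] by (simp add: norm_mult norm_nat_powr mult_right_mono)
    qed simp
  qed
  show ?thesis
    by (rule norm_summable_imp_summable_on) (use * in simp)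
qed

text \<open>The derivative of \<open>x\<^sup>-\<^sup>s\<close> is bounded by \<open>|s| m\<^sup>-\<^sup>\<sigma>\<^sup>-\<^sup>1\<close> on \<open>[m, m+1]\<close>. The gain of one power of \<open>m\<close>
is what makes summation by parts effective.\<close>
lemma norm_powr_diff_le:
  assumes "m > 0" "Re s > 0"
  shows "norm (of_nat m powr (-s) - of_nat (Suc m) powr (-s) :: complex) \<le> norm s * real m powr (- Re s - 1)"
proof -
  let ?S = "closed_segment (of_nat m :: complex) (of_nat (Suc m))"
  have *: "\<exists>x. z = of_real x \<and> x \<ge> real m" if "z \<in> ?S" for z
  proof -
    have "?S = of_real ` closed_segment (real m) (real (Suc m))"
      using closed_segment_of_real[of "real m" "real (Suc m)", where 'a = complex] by simp
    with that show ?thesis by (auto simp: closed_segment_eq_real_ivl)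
  qed
  have "norm (of_nat m powr (-s) - of_nat (Suc m) powr (-s) :: complex)
          \<le> (norm s * real m powr (- Re s - 1)) * norm (of_nat m - of_nat (Suc m) :: complex)"
  proof (rule field_differentiable_bound)
    fix z assume "z \<in> ?S"
    then obtain x where x: "z = of_real x" "x \<ge> real m" using * by blast
    then have "x > 0" using assms by simp
    then have "z \<notin> \<real>\<^sub>\<le>\<^sub>0" using x by (simp add: complex_nonpos_Reals_iff)
    then show "((\<lambda>w. w powr (-s)) has_field_derivative ((-s) * z powr (-s - 1))) (at z within ?S)"
      by (auto intro!: derivative_eq_intros simp: has_field_derivative_at_within)
    have "norm (z powr (-s - 1)) = x powr (- Re s - 1)"
      using x \<open>x > 0\<close> by (simp add: norm_powr_real_powr)
    also have "\<dots> \<le> real m powr (- Re s - 1)"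
      using x assms by (intro powr_mono2') auto
    finally show "norm (- s * z powr (- s - 1)) \<le> norm s * real m powr (- Re s - 1)"
      by (simp add: norm_mult mult_left_mono)
  qed auto
  then show ?thesis by simp
qed

text \<open>Summation by parts replaces the series by one that converges absolutely and uniformly near every point
of the half-plane, so the limit is holomorphic by Weierstrass.\<close>
lemma dirichlet_series_bounded_partial_sums:
  assumes B: "\<And>M. norm (\<Sum>m=1..M. f m) \<le> B"
  obtains L where "L holomorphic_on {s. Re s > 0}"
    "\<And>s. Re s > 0 \<Longrightarrow> dirichlet_term f s sums L s"
proof -
  define S where "S M = (\<Sum>m=1..M. f m)" for M
  define g where "g m s = S m * (of_nat m powr (-s) - of_nat (Suc m) powr (-s))" for m :: nat and s :: complex
  define L where "L s = (\<Sum>m. g m s)" for s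
  have S0: "S 0 = 0" by (simp add: S_def)
  have B0: "B \<ge> 0" using B[of 0] by simp
  have SB: "norm (S m) \<le> B" for m unfolding S_def by (rule B)
  have parts: "(\<Sum>m\<le>M. dirichlet_term f s m) = (\<Sum>m<M. g m s) + S M * of_nat M powr (-s)" for M s
  proof (induction M)
    case (Suc M)
    have "S (Suc M) = S M + f (Suc M)" by (simp add: S_def)
    with Suc show ?case by (simp add: g_def algebra_simps del: of_nat_Suc)
  qed (simp add: S0)
  have g_bound: "norm (g m s) \<le> (B * R) * real m powr (- e - 1)"
    if "Re s \<ge> e" "norm s \<le> R" "e > 0" for m s R e
  proof (cases "m = 0")
    case False
    have "norm (g m s) \<le> B * (norm s * real m powr (- Re s - 1))"
      unfolding g_def norm_mult using SB[of m] B0 norm_powr_diff_le[of m s] False that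
      by (intro mult_mono) auto
    also have "\<dots> \<le> B * (R * real m powr (- e - 1))"
      using that False B0 by (intro mult_left_mono mult_mono powr_mono) (auto intro: order_trans[OF norm_ge_zero])
    finally show ?thesis by simp
  qed (simp add: g_def S0)
  have summ: "summable (\<lambda>m. (B * R) * real m powr (- e - 1))" if "e > 0" for R e
    using that by (intro summable_mult) (simp add: summable_real_powr_iff)
  have "L holomorphic_on {s. Re s > 0}"
  proof (rule holomorphic_uniform_sequence[where f = "\<lambda>M s. \<Sum>m<M. g m s"])
    show "open {s. Re s > 0}" by (simp add: open_halfspace_Re_gt)
    have "g m holomorphic_on {s. Re s > 0}" for m
    proof (cases "m = 0")
      case True
      then have "g m = (\<lambda>_. 0)" by (simp add: g_def S0 fun_eq_iff)
      then show ?thesis by simp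
    next
      case False
      then show ?thesis unfolding g_def by (intro holomorphic_intros) auto
    qed
    then show "(\<lambda>s. \<Sum>m<M. g m s) holomorphic_on {s. Re s > 0}" for M
      by (intro holomorphic_on_sum) auto
    fix x assume "x \<in> {s. Re s > 0}"
    then have x: "Re x > 0" by simp
    define d where "d = Re x / 2"
    have d: "d > 0" using x by (simp add: d_def)
    have near: "Re s \<ge> d \<and> norm s \<le> norm x + d" if "s \<in> cball x d" for s
    proof -
      have "norm (x - s) \<le> d" using that by (simp add: dist_norm)
      moreover have "\<bar>Re (x - s)\<bar> \<le> norm (x - s)" by (rule abs_Re_le_cmod)
      moreover have "norm s \<le> norm x + norm (x - s)"
        by (metis norm_minus_commute norm_triangle_sub)
      ultimately show ?thesis by (simp add: d_def)
    qed
    have "uniform_limit (cball x d) (\<lambda>M s. \<Sum>m<M. g m s) L sequentially"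
      unfolding L_def
      by (rule Weierstrass_m_test[OF g_bound summ[of d]]) (use near d in auto)
    then show "\<exists>d>0. cball x d \<subseteq> {s. Re s > 0} \<and> uniform_limit (cball x d) (\<lambda>M s. \<Sum>m<M. g m s) L sequentially"
      using d near by (intro exI[of _ d]) force
  qed
  moreover have "dirichlet_term f s sums L s" if s: "Re s > 0" for s
  proof -
    have "summable (\<lambda>m. g m s)"
      by (rule summable_comparison_test'[OF summ[of "Re s" "norm s"]]) (use s g_bound[of "Re s" s] in auto)
    then have 1: "(\<lambda>M. \<Sum>m<M. g m s) \<longlonglongrightarrow> L s"
      unfolding L_def by (simp add: summable_LIMSEQ)
    have 2: "(\<lambda>M. S M * of_nat M powr (-s)) \<longlonglongrightarrow> 0"
    proof (rule Lim_null_comparison)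
      show "(\<lambda>M. B * real M powr (- Re s)) \<longlonglongrightarrow> 0"
        using s by (intro tendsto_mult_right_zero tendsto_neg_powr filterlim_real_sequentially) auto
      show "\<forall>\<^sub>F M in sequentially. norm (S M * of_nat M powr (-s)) \<le> B * real M powr (- Re s)"
        using eventually_gt_at_top[of "0::nat"]
      proof eventually_elim
        case (elim M)
        then show ?case using SB[of M] by (simp add: norm_mult norm_nat_powr mult_right_mono)
      qed
    qed
    show ?thesis
      unfolding sums_def_le parts using tendsto_add[OF 1 2] by simp
  qed
  ultimately show ?thesis using that by blast
qed

text \<open>Complete periods contribute nothing, so only a partial period survives.\<close>
lemma bounded_partial_sums_periodic:
  fixes f :: "nat \<Rightarrow> 'a :: real_normed_vector"
  assumes "N > 0" "\<And>m. f (m + N) = f m" "(\<Sum>m<N. f m) = 0"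
  obtains B where "\<And>M. norm (\<Sum>m=1..M. f m) \<le> B"
proof -
  have per: "f (m + N * q) = f m" for m q
    by (induction q) (simp_all add: assms(2) add.assoc[symmetric] add.commute[of N])
  have block: "(\<Sum>m<N * q + r. f m) = (\<Sum>m<r. f m)" for q r
  proof (induction q)
    case (Suc q)
    have "(\<Sum>m<N * Suc q + r. f m) = (\<Sum>m<N. f m) + (\<Sum>m=N..<N * Suc q + r. f m)"
      by (simp add: lessThan_atLeast0 sum.atLeastLessThan_concat)
    also have "(\<Sum>m=N..<N * Suc q + r. f m) = (\<Sum>m<N * q + r. f (m + N))"
      using sum.shift_bounds_nat_ivl[of f 0 N "N * q + r"] by (simp add: lessThan_atLeast0 add_ac)
    finally show ?case using Suc assms by simp
  qed simp
  define B where "B = (\<Sum>m<N. norm (f m)) + norm (f 0)"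
  have "norm (\<Sum>m=1..M. f m) \<le> B" for M
  proof -
    have "(\<Sum>m<Suc M. f m) = f 0 + (\<Sum>m=1..M. f m)"
      by (simp add: lessThan_Suc_atMost sum.atLeast1_atMost_eq atMost_atLeast0 sum.atLeast_Suc_atMost)
    moreover have "(\<Sum>m<Suc M. f m) = (\<Sum>m<Suc M mod N. f m)"
      using block[of "Suc M div N" "Suc M mod N"] by simp
    moreover have "norm (\<Sum>m<Suc M mod N. f m) \<le> (\<Sum>m<N. norm (f m))"
      using assms(1) by (intro order_trans[OF norm_sum] sum_mono2) (auto intro: less_trans[OF _ mod_less_divisor])
    ultimately show ?thesis unfolding B_def
      by (metis add_diff_cancel_left' add_le_cancel_right norm_triangle_ineq4 order_trans)
  qed
  then show ?thesis using that by blast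
qed

section \<open>Newman's Tauberian theorem\<close>

lemma powr_succ_diff_mvt:
  fixes u y :: real assumes "u > 0"
  obtains z where "u < z" "z < u + 1" "(u + 1) powr y - u powr y = y * z powr (y - 1)"
proof -
  have "\<exists>z. u < z \<and> z < u + 1 \<and> (u + 1) powr y - u powr y = (u + 1 - u) * (y * z powr (y - 1))"
    by (rule MVT2) (use assms in \<open>auto intro!: derivative_eq_intros\<close>)
  then show ?thesis using that by auto
qed

text \<open>Comparison with the integral of \<open>u\<^sup>-\<^sup>1\<^sup>-\<^sup>x\<close> over \<open>[N, \<infinity>)\<close>, one unit interval at a time.\<close>
lemma sum_powr_tail_le:
  fixes x :: real assumes "x > 0" "N > 0"
  shows "(\<Sum>m=Suc N..M. real m powr (- 1 - x)) \<le> real N powr (- x) / x"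
proof (cases "M \<ge> N")
  case True
  then have "(\<Sum>m=Suc N..M. real m powr (- 1 - x)) \<le> (real N powr (- x) - real M powr (- x)) / x"
  proof (induction M rule: dec_induct)
    case (step M)
    obtain z where z: "real M < z" "z < real M + 1"
      "(real M + 1) powr (-x) - real M powr (-x) = (-x) * z powr (- x - 1)"
      using powr_succ_diff_mvt[of "real M" "-x"] step assms by auto
    have "real (Suc M) powr (- 1 - x) \<le> z powr (- 1 - x)"
      using z assms step by (intro powr_mono2') auto
    also have "\<dots> = (real M powr (- x) - real (Suc M) powr (- x)) / x"
      using z assms by (simp add: field_simps minus_diff_commute)
    finally show ?case using step by (simp add: diff_divide_distrib)
  qed simp
  also have "\<dots> \<le> real N powr (- x) / x" using assms by (simp add: divide_right_mono)
  finally show ?thesis .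
qed (use assms in auto)

text \<open>Comparison with the integral of \<open>u\<^sup>y\<^sup>-\<^sup>1\<close> over \<open>[0, N]\<close>. The integrand decreases for \<open>y < 1\<close>; for \<open>y \<ge> 1\<close> it
increases and the last term has to be split off.\<close>
lemma sum_powr_head_le:
  fixes y :: real assumes "y > 0" "N > 0"
  shows "(\<Sum>m=1..N. real m powr (y - 1)) \<le> real N powr y / y + real N powr (y - 1)"
  using assms(2)
proof (cases "y \<ge> 1")
  case True
  have "(\<Sum>m=1..<N. real m powr (y - 1)) \<le> real N powr y / y"
    using assms(2)
  proof (induction N rule: nat_induct_non_zero)
    case (Suc M)
    obtain z where z: "real M < z" "z < real M + 1"
      "(real M + 1) powr y - real M powr y = y * z powr (y - 1)"
      using powr_succ_diff_mvt[of "real M" y] Suc by auto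
    have "real M powr (y - 1) \<le> z powr (y - 1)"
      using z assms True by (intro powr_mono2) auto
    also have "\<dots> = (real (Suc M) powr y - real M powr y) / y"
      using z assms by (simp add: field_simps)
    finally show ?case using Suc by (simp add: diff_divide_distrib)
  qed (use assms in auto)
  moreover have "{1..N} = insert N {1..<N}" using assms(2) by auto
  ultimately show ?thesis by simp
next
  case False
  have "(\<Sum>m=1..N. real m powr (y - 1)) \<le> real N powr y / y"
    using assms(2)
  proof (induction N rule: nat_induct_non_zero)
    case (Suc M)
    obtain z where z: "real M < z" "z < real M + 1"
      "(real M + 1) powr y - real M powr y = y * z powr (y - 1)"
      using powr_succ_diff_mvt[of "real M" y] Suc by auto
    have "real (Suc M) powr (y - 1) \<le> z powr (y - 1)"
      using z assms False Suc by (intro powr_mono2') auto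
    also have "\<dots> = (real (Suc M) powr y - real M powr y) / y"
      using z assms by (simp add: field_simps)
    finally show ?case using Suc by (simp add: diff_divide_distrib)
  qed (use assms False in auto)
  then show ?thesis by (simp add: add_increasing2)
qed

text \<open>Newman's kernel \<open>N\<^sup>z (1/z + z/R\<^sup>2)\<close>: the simple pole at \<open>0\<close> has residue \<open>1\<close>, and the factor
\<open>1 + z\<^sup>2/R\<^sup>2\<close> vanishes at \<open>\<plusminus>iR\<close>, which compensates the blow-up of the tail estimates near the imaginary axis.\<close>
definition newman_kernel :: "real \<Rightarrow> nat \<Rightarrow> complex \<Rightarrow> complex" where
  "newman_kernel R N z = exp (z * of_real (ln (real N))) * ((1 + z\<^sup>2 / of_real R ^ 2) / z)"

text \<open>On the circle \<open>|z| = R\<close> one has \<open>1/z = cnj z / R\<^sup>2\<close>, so \<open>1/z + z/R\<^sup>2 = 2 Re z / R\<^sup>2\<close>.\<close>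
lemma norm_newman_kernel:
  assumes "norm z = R" "R > 0" "N > 0"
  shows "norm (newman_kernel R N z) = real N powr Re z * (2 * \<bar>Re z\<bar> / R\<^sup>2)"
proof -
  have z: "z \<noteq> 0" using assms by auto
  have "z * cnj z = of_real R ^ 2" using assms by (simp add: complex_norm_square[symmetric])
  then have "(1 + z\<^sup>2 / of_real R ^ 2) / z = (cnj z + z) / of_real R ^ 2"
    using z assms(2) by (simp add: field_simps power2_eq_square)
  also have "cnj z + z = of_real (2 * Re z)"
    by (simp add: complex_add_cnj add.commute)
  finally have "norm ((1 + z\<^sup>2 / of_real R ^ 2) / z) = 2 * \<bar>Re z\<bar> / R\<^sup>2"
    by (simp add: norm_divide norm_power norm_mult)
  then show ?thesis
    unfolding newman_kernel_def norm_mult using assms by (simp add: powr_def mult.commute)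
qed

text \<open>Cauchy's integral formula for the circle, cut at \<open>\<plusminus>iR\<close>. Splitting off \<open>P(0)/z\<close> leaves an entire integrand, which
integrates to zero over the closed curve; each half circle contributes \<open>i\<pi>\<close> to the integral of \<open>1/z\<close>.\<close>
lemma contour_integral_arcs_over_z:
  assumes "P holomorphic_on UNIV" "R > 0"
  defines "A \<equiv> part_circlepath 0 R (- (pi/2)) (pi/2)" and "B \<equiv> part_circlepath 0 R (pi/2) (3 * pi/2)"
  shows "contour_integral A (\<lambda>z. P z / z) + contour_integral B (\<lambda>z. P z / z) = 2 * of_real pi * \<i> * P 0"
proof -
  define Q where "Q z = (if z = 0 then deriv P 0 else (P z - P 0) / (z - 0))" for z
  have Q: "Q holomorphic_on UNIV"
    unfolding Q_def using pole_lemma_open[OF assms(1) open_UNIV, of 0] by simp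
  have nz: "z \<noteq> 0" if "z \<in> path_image A \<union> path_image B" for z
    using that assms(2) in_path_image_part_circlepath[of z 0 R "-(pi/2)" "pi/2"]
      in_path_image_part_circlepath[of z 0 R "pi/2" "3*pi/2"]
    by (auto simp: A_def B_def)
  have vp [simp]: "valid_path A" "valid_path B" by (auto simp: A_def B_def)
  have AB: "pathfinish A = pathstart B" "pathfinish B = pathstart A"
    using cos_3over2_pi sin_3over2_pi
    by (auto simp: A_def B_def complex_eq_iff Re_exp Im_exp mult.commute)
  have Qi: "Q contour_integrable_on g" if "valid_path g" for g
    using Q that contour_integrable_holomorphic_simple[of Q UNIV g] by auto
  have "contour_integral (A +++ B) Q = 0"
    using Q AB by (intro contour_integral_unique Cauchy_theorem_convex_simple[of _ UNIV]) auto
  then have Q0: "contour_integral A Q + contour_integral B Q = 0"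
    using AB Qi by simp
  have inv: "((\<lambda>z. 1 / z) has_contour_integral \<i> * of_real (t - s)) (part_circlepath 0 R s t)" if "s < t" for s t
  proof -
    have "((\<lambda>t. \<i>) has_integral of_real (t - s) * \<i>) {s..t}"
      using has_integral_const_real[of \<i> s t] that by (simp add: scaleR_conv_of_real)
    then have "((\<lambda>t. 1 / (0 + of_real R * cis t) * of_real R * \<i> * cis t) has_integral \<i> * of_real (t - s)) {s..t}"
      by (rule has_integral_eq[rotated, OF has_integral_eq_rhs])
         (use assms(2) in \<open>auto simp: field_simps\<close>)
    then show ?thesis
      unfolding has_contour_integral_part_circlepath_iff[OF that] .
  qed
  have *: "contour_integral g (\<lambda>z. P z / z) = P 0 * c + contour_integral g Q"
    if "valid_path g" "((\<lambda>z. 1 / z) has_contour_integral c) g" "\<And>z. z \<in> path_image g \<Longrightarrow> z \<noteq> 0" for g c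
  proof -
    have "((\<lambda>z. P 0 * (1 / z) + Q z) has_contour_integral P 0 * c + contour_integral g Q) g"
      using that Qi by (intro has_contour_integral_add has_contour_integral_lmul has_contour_integral_integral) auto
    then have "((\<lambda>z. P z / z) has_contour_integral P 0 * c + contour_integral g Q) g"
      by (rule has_contour_integral_eq) (use that in \<open>auto simp: Q_def field_simps\<close>)
    then show ?thesis by (rule contour_integral_unique)
  qed
  have "contour_integral A (\<lambda>z. P z / z) = P 0 * (\<i> * of_real pi) + contour_integral A Q"
    using inv[of "-(pi/2)" "pi/2"] nz by (intro *) (auto simp: A_def)
  moreover have "contour_integral B (\<lambda>z. P z / z) = P 0 * (\<i> * of_real pi) + contour_integral B Q"
    using inv[of "pi/2" "3*pi/2"] nz by (intro *) (auto simp: B_def)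
  ultimately show ?thesis using Q0 by (simp add: algebra_simps eq_neg_iff_add_eq_0)
qed

text \<open>After shifting the point \<open>1\<close> to \<open>0\<close>, let \<open>G(z) = F(1 + z)\<close> and let \<open>S\<close> be the partial sum up to \<open>N\<close>, an entire
function. Integrate \<open>S\<close> against Newman's kernel over the circle of radius \<open>R\<close>.
On the left half circle \<open>S\<close> itself is small enough. On the right half circle
write \<open>S = G - (G - S)\<close>; the tail \<open>G - S\<close> is again small enough. What remains is \<open>G\<close> on the right half circle.
Because \<open>G(0) = 0\<close>, the kernel times \<open>G\<close> has no pole, and the contour can be moved to the segment from \<open>iR\<close> to \<open>-iR\<close>,
where \<open>|N\<^sup>z| = 1\<close>. There an integration by parts gains the factor \<open>1 / ln N\<close>; the boundary terms vanish with
\<open>1 + z\<^sup>2/R\<^sup>2\<close>.\<close>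
lemma newman_partial_sum_bound:
  fixes a :: "nat \<Rightarrow> complex" and F :: "complex \<Rightarrow> complex"
  assumes bound: "\<And>m. norm (a m) \<le> C" and F: "F analytic_on {s. Re s \<ge> 1}"
    and sums: "\<And>s. Re s > 1 \<Longrightarrow> dirichlet_term a s sums F s" and F1: "F 1 = 0" and R: "R > 0"
  obtains K where "\<And>N. N \<ge> 2 \<Longrightarrow> 2 * pi * norm (\<Sum>m\<le>N. dirichlet_term a 1 m)
      \<le> (2 * C / R\<^sup>2) * R * pi + (2 * C / R\<^sup>2 + 2 * C / (R * real N)) * R * pi + K / ln (real N)"
proof -
  have C: "C \<ge> 0" using bound[of 0] norm_ge_zero order_trans by blast
  obtain U where U: "open U" "{s. Re s \<ge> 1} \<subseteq> U" "F holomorphic_on U"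
    using F analytic_on_holomorphic by blast
  define V where "V = (+) 1 -` U"
  have V: "open V" "{z. Re z \<ge> 0} \<subseteq> V"
    using U subsetD[OF U(2), of "1 + _"] by (auto simp: V_def intro!: open_vimage continuous_intros)
  define G where "G z = F (1 + z)" for z
  have G: "G holomorphic_on V"
    unfolding G_def using holomorphic_on_compose_gen[of "\<lambda>z. 1 + z" V F U] U
      holomorphic_on_add[of "\<lambda>_. 1" V "\<lambda>z. z"]
    by (auto simp: V_def o_def)
  define q where "q z = (if z = 0 then deriv G 0 else (G z - G 0) / (z - 0))" for z
  have q: "q holomorphic_on V"
    unfolding q_def using pole_lemma_open[OF G V(1), of 0] by simp
  have G0: "G 0 = 0" by (simp add: G_def F1)
  define K where "K z = q z * (1 + z\<^sup>2 / of_real R ^ 2)" for z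
  have K: "K holomorphic_on V"
    unfolding K_def by (intro holomorphic_intros q) (use R in auto)
  define A where "A = part_circlepath 0 R (- (pi/2)) (pi/2)"
  define B where "B = part_circlepath 0 R (pi/2) (3 * pi/2)"
  define \<sigma> where "\<sigma> = linepath (\<i> * of_real R) (- (\<i> * of_real R))"
  have A_image: "norm z = R" "Re z \<ge> 0" if "z \<in> path_image A" for z
  proof -
    show "norm z = R" using that R in_path_image_part_circlepath[of z 0 R "-(pi/2)" "pi/2"]
      by (auto simp: A_def)
    show "Re z \<ge> 0" using that R
      by (auto simp: A_def path_image_part_circlepath Re_exp intro!: mult_nonneg_nonneg cos_ge_zero)
  qed
  have B_image: "norm z = R" "Re z \<le> 0" if zB: "z \<in> path_image B" for z
  proof -
    show "norm z = R" using that R in_path_image_part_circlepath[of z 0 R "pi/2" "3*pi/2"]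
      by (auto simp: B_def)
    obtain x where x: "z = of_real R * exp (\<i> * of_real x)" "pi/2 \<le> x" "x \<le> 3*pi/2"
      using zB path_image_part_circlepath[of "pi/2" "3*pi/2" 0 R] by (auto simp: B_def)
    have "cos (x - pi) \<ge> 0" using x by (intro cos_ge_zero) auto
    then show "Re z \<le> 0" using x R by (simp add: Re_exp mult_nonneg_nonpos)
  qed
  have \<sigma>_image: "Re z = 0" if "z \<in> path_image \<sigma>" for z
    using that by (auto simp: \<sigma>_def closed_segment_def)
  have A_V: "path_image A \<subseteq> V" and \<sigma>_V: "path_image \<sigma> \<subseteq> V"
    using A_image \<sigma>_image V by auto
  have [simp]: "valid_path A" "valid_path B" "valid_path \<sigma>" by (auto simp: A_def B_def \<sigma>_def)
  have ends: "pathfinish A = pathstart \<sigma>" "pathfinish \<sigma> = pathstart A"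
    by (auto simp: A_def \<sigma>_def complex_eq_iff Re_exp Im_exp)
  have K': "deriv K holomorphic_on V" using K V(1) by (rule holomorphic_deriv)
  have "compact (path_image \<sigma>)" by (auto simp: \<sigma>_def)
  then have "bounded (deriv K ` path_image \<sigma>)"
    by (intro compact_imp_bounded compact_continuous_image)
       (use K' \<sigma>_V holomorphic_on_imp_continuous_on holomorphic_on_subset in blast)+
  then obtain M where M: "M > 0" "\<And>z. z \<in> path_image \<sigma> \<Longrightarrow> norm (deriv K z) \<le> M"
    by (auto simp: bounded_pos)

  have main: "2 * pi * norm (\<Sum>m\<le>N. dirichlet_term a 1 m)
      \<le> (2 * C / R\<^sup>2) * R * pi + (2 * C / R\<^sup>2 + 2 * C / (R * real N)) * R * pi + (M * (2 * R)) / ln (real N)"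
    if N: "N \<ge> 2" for N
  proof -
    define l where "l = complex_of_real (ln (real N))"
    have l: "l \<noteq> 0" "norm l = ln (real N)" using N by (auto simp: l_def)
    define S where "S z = (\<Sum>m\<le>N. dirichlet_term a (1 + z) m)" for z
    define k where "k = newman_kernel R N"
    define P where "P z = S z * exp (z * l) * (1 + z\<^sup>2 / of_real R ^ 2)" for z
    have "(\<lambda>z. of_nat m powr (- (1 + z)) :: complex) holomorphic_on UNIV" for m
      by (cases "m = 0") (auto intro!: holomorphic_intros)
    then have "S holomorphic_on UNIV"
      unfolding S_def by (intro holomorphic_on_sum holomorphic_on_mult) auto
    then have P: "P holomorphic_on UNIV"
      unfolding P_def by (intro holomorphic_intros) (use R in auto)
    have Pk: "P z / z = S z * k z" for z
      by (simp add: P_def k_def newman_kernel_def l_def)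
    have P0: "P 0 = S 0" by (simp add: P_def)
    have arcs: "contour_integral A (\<lambda>z. S z * k z) + contour_integral B (\<lambda>z. S z * k z) = 2 * of_real pi * \<i> * S 0"
      using contour_integral_arcs_over_z[OF P R] by (simp add: A_def B_def Pk P0)
    have Sk_int: "(\<lambda>z. S z * k z) contour_integrable_on g"
      if "valid_path g" "\<And>z. z \<in> path_image g \<Longrightarrow> norm z = R" for g
    proof -
      have "(\<lambda>z. P z / z) contour_integrable_on g"
        by (rule contour_integrable_holomorphic_simple[of _ "- {0}"])
           (use that(1) that(2)[of 0] R in \<open>auto intro!: holomorphic_intros holomorphic_on_subset[OF P]\<close>)
      then show ?thesis by (simp add: Pk)
    qed

    \<comment> \<open>Left arc: the head of the series of \<open>m\<^sup>y\<^sup>-\<^sup>1\<close> is about \<open>N\<^sup>y/y\<close>, cancelled by the kernel of size \<open>N\<^sup>-\<^sup>y y\<close>.\<close>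
    have boundB: "norm (S z * k z) \<le> 2 * C / R\<^sup>2 + 2 * C / (R * real N)" if z: "norm z = R" "Re z \<le> 0" for z
    proof (cases "Re z = 0")
      case True
      then have "norm (k z) = 0" unfolding k_def using norm_newman_kernel[OF z(1) R, of N] N by simp
      then show ?thesis using C R N by simp
    next
      case False
      define y where "y = - Re z"
      have y: "y > 0" "y \<le> R" using False z complex_Re_le_cmod[of "-z"] by (auto simp: y_def)
      have "norm (S z) \<le> (\<Sum>m\<le>N. norm (dirichlet_term a (1 + z) m))"
        unfolding S_def by (rule norm_sum)
      also have "\<dots> = (\<Sum>m=1..N. norm (dirichlet_term a (1 + z) m))"
        by (rule sum.mono_neutral_right) auto
      also have "\<dots> \<le> (\<Sum>m=1..N. C * real m powr (y - 1))"
        by (intro sum_mono) (auto simp: norm_mult norm_nat_powr y_def minus_diff_commute[of 1] intro!: mult_mono bound C)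
      also have "\<dots> \<le> C * (real N powr y / y + real N powr (y - 1))"
        unfolding sum_distrib_left[symmetric]
        by (intro mult_left_mono sum_powr_head_le C) (use y N in auto)
      finally have "norm (S z) \<le> C * (real N powr y / y + real N powr (y - 1))" .
      moreover have "norm (k z) = real N powr (- y) * (2 * y / R\<^sup>2)"
        unfolding k_def using norm_newman_kernel[OF z(1) R, of N] N y by (simp add: y_def)
      ultimately have "norm (S z * k z)
          \<le> C * (real N powr y / y + real N powr (y - 1)) * (real N powr (- y) * (2 * y / R\<^sup>2))"
        using y by (simp only: norm_mult) (rule mult_right_mono; simp)
      also have "\<dots> = 2 * C / R\<^sup>2 + 2 * C * y / (R\<^sup>2 * real N)"
        using y N R by (simp add: powr_minus powr_diff field_simps)
      also have "2 * C * y / (R\<^sup>2 * real N) \<le> 2 * C * R / (R\<^sup>2 * real N)"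
        using y C R by (intro divide_right_mono mult_left_mono) auto
      also have "\<dots> = 2 * C / (R * real N)" using R by (simp add: power2_eq_square)
      finally show ?thesis by simp
    qed
    have "norm (contour_integral B (\<lambda>z. S z * k z)) \<le> (2 * C / R\<^sup>2 + 2 * C / (R * real N)) * R * \<bar>3 * pi/2 - pi/2\<bar>"
      unfolding B_def
      by (rule contour_integral_bound_part_circlepath)
         (use Sk_int[of B] B_image boundB C R in \<open>auto simp: B_def[symmetric]\<close>)
    then have IB: "norm (contour_integral B (\<lambda>z. S z * k z)) \<le> (2 * C / R\<^sup>2 + 2 * C / (R * real N)) * R * pi"
      by simp

    \<comment> \<open>Right arc: the tail is about \<open>N\<^sup>-\<^sup>x/x\<close>, cancelled by the kernel of size \<open>N\<^sup>x x\<close>.\<close>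
    have boundA: "norm ((G z - S z) * k z) \<le> 2 * C / R\<^sup>2" if z: "norm z = R" "Re z \<ge> 0" for z
    proof (cases "Re z = 0")
      case True
      then have "norm (k z) = 0" unfolding k_def using norm_newman_kernel[OF z(1) R, of N] N by simp
      then show ?thesis using C R N by simp
    next
      case False
      define x where "x = Re z"
      have x: "x > 0" using False z by (auto simp: x_def)
      have "dirichlet_term a (1 + z) sums G z" unfolding G_def using x by (intro sums) (simp add: x_def)
      then have "(\<lambda>M. \<Sum>m\<le>M. dirichlet_term a (1 + z) m) \<longlonglongrightarrow> G z" by (simp add: sums_def_le)
      then have lim: "(\<lambda>M. (\<Sum>m\<le>M. dirichlet_term a (1 + z) m) - S z) \<longlonglongrightarrow> G z - S z"
        by (intro tendsto_intros)
      have "norm (G z - S z) \<le> C * (real N powr (- x) / x)"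
      proof (rule Lim_norm_ubound[OF _ lim])
        show "\<forall>\<^sub>F M in sequentially. norm ((\<Sum>m\<le>M. dirichlet_term a (1 + z) m) - S z) \<le> C * (real N powr (- x) / x)"
          using eventually_ge_at_top[of N]
        proof eventually_elim
          case (elim M)
          have "{..M} = {..N} \<union> {Suc N..M}" using elim by auto
          then have "(\<Sum>m\<le>M. dirichlet_term a (1 + z) m) - S z = (\<Sum>m=Suc N..M. dirichlet_term a (1 + z) m)"
            by (simp add: S_def sum.union_disjoint[of "{..N}" "{Suc N..M}"])
          also have "norm \<dots> \<le> (\<Sum>m=Suc N..M. norm (dirichlet_term a (1 + z) m))"
            by (rule norm_sum)
          also have "\<dots> \<le> (\<Sum>m=Suc N..M. C * real m powr (- 1 - x))"
            by (intro sum_mono) (auto simp: norm_mult norm_nat_powr x_def minus_diff_commute intro!: mult_mono bound C)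
          also have "\<dots> \<le> C * (real N powr (- x) / x)"
            unfolding sum_distrib_left[symmetric]
            by (intro mult_left_mono sum_powr_tail_le C) (use x N in auto)
          finally show ?case .
        qed
      qed auto
      moreover have "norm (k z) = real N powr x * (2 * x / R\<^sup>2)"
        unfolding k_def using norm_newman_kernel[OF z(1) R, of N] N x by (simp add: x_def)
      ultimately have "norm ((G z - S z) * k z) \<le> C * (real N powr (- x) / x) * (real N powr x * (2 * x / R\<^sup>2))"
        using x by (simp only: norm_mult) (rule mult_right_mono; simp)
      also have "\<dots> = 2 * C / R\<^sup>2"
        using x N R by (simp add: powr_minus field_simps)
      finally show ?thesis .
    qed
    have Gk: "G z * k z = K z * exp (z * l)" if "z \<in> path_image A" for z
    proof -
      have "z \<noteq> 0" using A_image(1)[OF that] R by auto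
      then show ?thesis by (simp add: K_def q_def G0 k_def newman_kernel_def l_def)
    qed
    have Ke: "(\<lambda>z. K z * exp (z * l)) holomorphic_on V" by (intro holomorphic_intros K)
    have Ke_int: "(\<lambda>z. K z * exp (z * l)) contour_integrable_on g" if "valid_path g" "path_image g \<subseteq> V" for g
      by (rule contour_integrable_holomorphic_simple[OF Ke V(1) that])
    have "contour_integral (A +++ \<sigma>) (\<lambda>z. K z * exp (z * l)) = 0"
    proof (intro contour_integral_unique Cauchy_theorem_convex_simple[of _ "{z. Re z \<ge> 0}"])
      show "(\<lambda>z. K z * exp (z * l)) holomorphic_on {z. Re z \<ge> 0}"
        using Ke V(2) holomorphic_on_subset by blast
      show "convex {z. Re z \<ge> 0}" by (simp add: convex_halfspace_Re_ge)
      show "path_image (A +++ \<sigma>) \<subseteq> {z. Re z \<ge> 0}"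
        using A_image \<sigma>_image by (auto simp: path_image_join[OF ends(1)])
    qed (use ends in auto)
    then have IA\<sigma>: "contour_integral A (\<lambda>z. K z * exp (z * l)) = - contour_integral \<sigma> (\<lambda>z. K z * exp (z * l))"
      using Ke_int A_V \<sigma>_V ends by (simp add: eq_neg_iff_add_eq_0)
    have I\<sigma>: "norm (contour_integral \<sigma> (\<lambda>z. K z * exp (z * l))) \<le> M * (2 * R) / ln (real N)"
    proof -
      have "((\<lambda>z. deriv K z * exp (z * l) + l * (K z * exp (z * l))) has_contour_integral
              K (pathfinish \<sigma>) * exp (pathfinish \<sigma> * l) - K (pathstart \<sigma>) * exp (pathstart \<sigma> * l)) \<sigma>"
      proof (rule contour_integral_primitive[OF _ _ \<sigma>_V])
        fix z assume "z \<in> V"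
        then have dK: "(K has_field_derivative deriv K z) (at z)"
          by (rule holomorphic_derivI[OF K V(1)])
        have de: "((\<lambda>z. exp (z * l)) has_field_derivative l * exp (z * l)) (at z)"
          by (auto intro!: derivative_eq_intros)
        show "((\<lambda>z. K z * exp (z * l)) has_field_derivative deriv K z * exp (z * l) + l * (K z * exp (z * l))) (at z within V)"
          by (rule has_field_derivative_at_within) (use DERIV_mult[OF dK de] in \<open>simp add: mult_ac\<close>)
      qed auto
      moreover have "K (pathfinish \<sigma>) = 0" "K (pathstart \<sigma>) = 0"
        using R by (auto simp: K_def \<sigma>_def power_mult_distrib)
      ultimately have "((\<lambda>z. deriv K z * exp (z * l) + l * (K z * exp (z * l))) has_contour_integral 0) \<sigma>"
        by simp
      moreover have "((\<lambda>z. l * (K z * exp (z * l))) has_contour_integral l * contour_integral \<sigma> (\<lambda>z. K z * exp (z * l))) \<sigma>"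
        using Ke_int[of \<sigma>] \<sigma>_V by (intro has_contour_integral_lmul has_contour_integral_integral) auto
      ultimately have "((\<lambda>z. deriv K z * exp (z * l)) has_contour_integral
            0 - l * contour_integral \<sigma> (\<lambda>z. K z * exp (z * l))) \<sigma>"
        using has_contour_integral_diff by fastforce
      then have "norm (0 - l * contour_integral \<sigma> (\<lambda>z. K z * exp (z * l)))
          \<le> M * norm (- (\<i> * of_real R) - \<i> * of_real R)"
        unfolding \<sigma>_def
      proof (rule has_contour_integral_bound_linepath)
        fix z assume "z \<in> closed_segment (\<i> * of_real R) (- (\<i> * of_real R))"
        then have z: "z \<in> path_image \<sigma>" by (simp add: \<sigma>_def)
        then have "norm (exp (z * l)) = 1" using \<sigma>_image by (simp add: norm_exp_eq_Re l_def)
        then show "norm (deriv K z * exp (z * l)) \<le> M" using M(2)[OF z] by (simp add: norm_mult)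
      qed (use M in auto)
      also have "norm (- (\<i> * of_real R) - \<i> * of_real R) = 2 * R"
        using R by (simp add: norm_mult flip: mult_2 minus_add_distrib)
      finally show ?thesis using N l by (simp add: norm_mult field_simps)
    qed
    have Gk_int: "(\<lambda>z. G z * k z) contour_integrable_on A"
      using Ke_int[of A] A_V Gk by (auto intro: contour_integrable_eq)
    have IG: "contour_integral A (\<lambda>z. G z * k z) = contour_integral A (\<lambda>z. K z * exp (z * l))"
      by (rule contour_integral_cong) (use Gk in auto)
    have SkA: "(\<lambda>z. S z * k z) contour_integrable_on A" using Sk_int[of A] A_image by auto
    have diff: "contour_integral A (\<lambda>z. (G z - S z) * k z) = contour_integral A (\<lambda>z. G z * k z) - contour_integral A (\<lambda>z. S z * k z)"
      unfolding left_diff_distrib by (rule contour_integral_diff[OF Gk_int SkA])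
    have "norm (contour_integral A (\<lambda>z. (G z - S z) * k z)) \<le> (2 * C / R\<^sup>2) * R * \<bar>pi/2 - (- (pi/2))\<bar>"
      unfolding A_def
    proof (rule contour_integral_bound_part_circlepath)
      show "(\<lambda>z. (G z - S z) * k z) contour_integrable_on part_circlepath 0 R (- (pi/2)) (pi/2)"
        unfolding left_diff_distrib A_def[symmetric] by (rule contour_integrable_diff[OF Gk_int SkA])
    qed (use A_image boundA C R in \<open>auto simp: A_def[symmetric]\<close>)
    then have ID: "norm (contour_integral A (\<lambda>z. (G z - S z) * k z)) \<le> (2 * C / R\<^sup>2) * R * pi"
      by simp

    have "2 * of_real pi * \<i> * S 0 = (- contour_integral \<sigma> (\<lambda>z. K z * exp (z * l))
        - contour_integral A (\<lambda>z. (G z - S z) * k z)) + contour_integral B (\<lambda>z. S z * k z)"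
      unfolding arcs[symmetric] diff IG IA\<sigma> by simp
    then have "norm (2 * of_real pi * \<i> * S 0) \<le> norm (contour_integral \<sigma> (\<lambda>z. K z * exp (z * l)))
        + norm (contour_integral A (\<lambda>z. (G z - S z) * k z)) + norm (contour_integral B (\<lambda>z. S z * k z))"
      by (simp only:) (intro norm_triangle_mono order_trans[OF norm_triangle_ineq4] order_refl, simp)
    moreover have "norm (2 * of_real pi * \<i> * S 0) = 2 * pi * norm (\<Sum>m\<le>N. dirichlet_term a 1 m)"
      by (simp add: norm_mult S_def)
    ultimately show ?thesis using I\<sigma> ID IB by linarith
  qed
  show ?thesis by (rule that[OF main])
qed

text \<open>Changing the first coefficient by \<open>F(1)\<close> reduces the statement to the case \<open>F(1) = 0\<close>. In the bound for the
partial sums first choose \<open>R\<close> large, then let \<open>N\<close> tend to infinity.\<close>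
theorem newman_tauberian:
  fixes a :: "nat \<Rightarrow> complex" and F :: "complex \<Rightarrow> complex"
  assumes bound: "\<And>m. norm (a m) \<le> C" and F: "F analytic_on {s. Re s \<ge> 1}"
    and sums: "\<And>s. Re s > 1 \<Longrightarrow> dirichlet_term a s sums F s"
  shows "dirichlet_term a 1 sums F 1"
proof -
  define b where "b m = (if m = 1 then a m - F 1 else a m)" for m
  define C' where "C' = C + norm (F 1)"
  have C: "C \<ge> 0" using bound[of 0] norm_ge_zero order_trans by blast
  have b: "norm (b m) \<le> C'" for m
    using bound[of m] norm_triangle_ineq4[of "a m" "F 1"] by (auto simp: b_def C'_def add_increasing2)
  have F': "(\<lambda>s. F s - F 1) analytic_on {s. Re s \<ge> 1}"
    using F by (intro analytic_intros)
  have split: "dirichlet_term b s = (\<lambda>m. dirichlet_term a s m - (if m = 1 then F 1 else 0))" for s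
    by (auto simp: b_def fun_eq_iff)
  have one: "(\<lambda>m::nat. if m = 1 then F 1 else 0) sums F 1"
    using sums_single[of 1 "\<lambda>_. F 1"] by simp
  have sums': "dirichlet_term b s sums (F s - F 1)" if "Re s > 1" for s
    unfolding split by (intro sums_diff sums[OF that] one)
  have "(\<lambda>N. \<Sum>m\<le>N. dirichlet_term b 1 m) \<longlonglongrightarrow> 0"
  proof (rule LIMSEQ_I)
    fix e :: real assume e: "e > 0"
    have C': "C' \<ge> 0" using C by (simp add: C'_def)
    \<comment> \<open>The two arcs contribute about \<open>4\<pi>C'/R\<close> in the limit, against \<open>2\<pi>e\<close> on the left.\<close>
    define R where "R = 4 * C' / e + 1"
    have R: "R > 0" using e C' by (simp add: R_def add_nonneg_pos)
    obtain K where K: "\<And>N. N \<ge> 2 \<Longrightarrow> 2 * pi * norm (\<Sum>m\<le>N. dirichlet_term b 1 m)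
      \<le> (2 * C' / R\<^sup>2) * R * pi + (2 * C' / R\<^sup>2 + 2 * C' / (R * real N)) * R * pi + K / ln (real N)"
      using newman_partial_sum_bound[OF b F' sums' _ R] by auto
    have "(\<lambda>N. (2 * C' / R\<^sup>2) * R * pi + (2 * C' / R\<^sup>2 + 2 * C' / (R * real N)) * R * pi + K / ln (real N))
        \<longlonglongrightarrow> (2 * C' / R\<^sup>2) * R * pi + (2 * C' / R\<^sup>2 + 0) * R * pi + 0"
      by (intro tendsto_intros tendsto_divide_0[OF tendsto_const] filterlim_at_top_imp_at_infinity
          filterlim_compose[OF ln_at_top] filterlim_real_sequentially filterlim_tendsto_pos_mult_at_top[OF tendsto_const R])
    moreover have "(2 * C' / R\<^sup>2) * R * pi + (2 * C' / R\<^sup>2 + 0) * R * pi + 0 < 2 * pi * e"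
    proof -
      have "4 * C' < R * e" using e by (simp add: R_def field_simps)
      moreover have "C' * 2 \<le> 4 * C'" using C' by simp
      ultimately have "2 * C' / R < e" using R by (simp add: field_simps)
      then have "2 * pi * (2 * C' / R) < 2 * pi * e" by (intro mult_strict_left_mono) auto
      moreover have "(2 * C' / R\<^sup>2) * R * pi + (2 * C' / R\<^sup>2 + 0) * R * pi + 0 = 2 * pi * (2 * C' / R)"
        using R by (simp add: power2_eq_square field_simps)
      ultimately show ?thesis by simp
    qed
    ultimately have "\<forall>\<^sub>F N in sequentially. (2 * C' / R\<^sup>2) * R * pi + (2 * C' / R\<^sup>2 + 2 * C' / (R * real N)) * R * pi
        + K / ln (real N) < 2 * pi * e"
      by (rule order_tendstoD)
    then have "\<forall>\<^sub>F N in sequentially. norm (\<Sum>m\<le>N. dirichlet_term b 1 m) < e"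
      using eventually_ge_at_top[of 2]
    proof eventually_elim
      case (elim N)
      then have "2 * pi * norm (\<Sum>m\<le>N. dirichlet_term b 1 m) < 2 * pi * e" using K[of N] by linarith
      then show ?case by simp
    qed
    then show "\<exists>no. \<forall>N\<ge>no. norm ((\<Sum>m\<le>N. dirichlet_term b 1 m) - 0) < e"
      by (simp add: eventually_sequentially)
  qed
  then have "dirichlet_term b 1 sums 0" by (simp add: sums_def_le)
  moreover have "dirichlet_term a 1 = (\<lambda>m. dirichlet_term b 1 m + (if m = 1 then F 1 else 0))"
    by (auto simp: b_def fun_eq_iff)
  ultimately show ?thesis using sums_add[OF _ one] by fastforce
qed

section \<open>Moebius inversion and Dirichlet convolution\<close>

lemma moebius_mu_simps [simp]: "moebius_mu 0 = 0" "moebius_mu (Suc 0) = 1"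
  by (simp_all add: moebius_mu_def)

lemma abs_moebius_mu_le: "\<bar>moebius_mu m\<bar> \<le> 1"
  by (simp add: moebius_mu_def power_abs)

lemma moebius_mu_prime_mult:
  assumes "prime p" "\<not> p dvd d" "d > 0"
  shows "moebius_mu (p * d) = - moebius_mu d"
proof -
  have "squarefree (p * d) \<longleftrightarrow> squarefree d"
    using assms squarefree_multD(2) prime_imp_coprime[of p d] squarefree_mult_coprime[of p d] squarefree_prime
    by blast
  moreover have "prime_factors (p * d) = insert p (prime_factors d)"
    using assms by (auto simp: prime_factors_product prime_prime_factors)
  moreover have "p \<notin> prime_factors d" using assms by auto
  ultimately show ?thesis by (simp add: moebius_mu_def)
qed

text \<open>For a prime \<open>p\<close> dividing \<open>N\<close>, the divisors \<open>d\<close> prime to \<open>p\<close> and the divisors \<open>p d\<close> cancel in pairs; \<open>\<mu>\<close> vanishes on all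
other divisors.\<close>
lemma sum_moebius_mu_divisors:
  assumes "N > 0"
  shows "(\<Sum>d | d dvd N. moebius_mu d) = (if N = 1 then 1 else 0)"
proof (cases "N = 1")
  case False
  then obtain p where p: "prime p" "p dvd N" using prime_factor_nat by blast
  then have p0: "p > 0" by (simp add: prime_gt_0_nat)
  have fin: "finite {d. d dvd N}" using assms by simp
  let ?A = "{d. d dvd N \<and> \<not> p dvd d}" and ?B = "{d. d dvd N \<and> p dvd d}"
  have "(\<Sum>d\<in>?B. moebius_mu d) = (\<Sum>d\<in>(*) p ` ?A. moebius_mu d)"
  proof (rule sum.mono_neutral_right)
    show "finite ?B" using fin by (rule rev_finite_subset) auto
    show "(*) p ` ?A \<subseteq> ?B"
      using p prime_imp_coprime[OF p(1)] by (auto intro: divides_mult)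
    show "\<forall>d\<in>?B - (*) p ` ?A. moebius_mu d = 0"
    proof
      fix d assume d: "d \<in> ?B - (*) p ` ?A"
      then obtain c where c: "d = p * c" by blast
      with d have "p dvd c" by (auto dest: dvd_mult_right)
      then have "p\<^sup>2 dvd d" unfolding c power2_eq_square by simp
      then have "\<not> squarefree d" using p(1) by (intro not_squarefreeI[of p]) auto
      then show "moebius_mu d = 0" by (simp add: moebius_mu_def)
    qed
  qed
  also have "\<dots> = (\<Sum>d\<in>?A. moebius_mu (p * d))"
    by (subst sum.reindex) (use p0 in \<open>auto simp: inj_on_def\<close>)
  also have "\<dots> = - (\<Sum>d\<in>?A. moebius_mu d)"
    unfolding sum_negf[symmetric]
    by (intro sum.cong refl moebius_mu_prime_mult[OF p(1)]) (use assms in \<open>auto intro: Nat.gr0I\<close>)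
  finally have "(\<Sum>d\<in>?A. moebius_mu d) + (\<Sum>d\<in>?B. moebius_mu d) = 0" by simp
  moreover have "(\<Sum>d | d dvd N. moebius_mu d) = (\<Sum>d\<in>?A. moebius_mu d) + (\<Sum>d\<in>?B. moebius_mu d)"
    by (subst sum.union_disjoint[symmetric]) (use fin in \<open>auto intro!: sum.cong\<close>)
  ultimately show ?thesis using False by simp
qed simp

lemma has_sum_product:
  fixes f :: "'a \<Rightarrow> complex" and g :: "'b \<Rightarrow> complex"
  assumes f: "(\<lambda>x. norm (f x)) summable_on A" and g: "(\<lambda>y. norm (g y)) summable_on B"
  shows "((\<lambda>(x, y). f x * g y) has_sum infsum f A * infsum g B) (A \<times> B)"
    "(\<lambda>(x, y). norm (f x * g y)) summable_on A \<times> B"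
proof -
  have *: "(\<lambda>z. norm (case z of (x, y) \<Rightarrow> f x * g y)) summable_on A \<times> B"
    by (rule Infinite_Sum.abs_summable_on_Sigma_iff[THEN iffD2])
       (use f g in \<open>auto simp: norm_mult infsum_cmult_right' infsum_nonneg
          intro!: summable_on_cmult_right summable_on_cmult_left\<close>)
  then show "(\<lambda>(x, y). norm (f x * g y)) summable_on A \<times> B"
    by (simp add: case_prod_unfold)
  show "((\<lambda>(x, y). f x * g y) has_sum infsum f A * infsum g B) (A \<times> B)"
  proof (rule has_sum_SigmaI)
    fix x
    show "((\<lambda>y. case (x, y) of (x, y) \<Rightarrow> f x * g y) has_sum f x * infsum g B) B"
      using abs_summable_summable[OF g] by (auto intro!: has_sum_cmult_right)
    show "((\<lambda>x. f x * infsum g B) has_sum infsum f A * infsum g B) A"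
      using abs_summable_summable[OF f] by (intro has_sum_cmult_left) auto
  qed (use * in \<open>rule abs_summable_summable\<close>)
qed

lemma of_nat_mult_powr: "(of_nat (m * k) :: complex) powr s = of_nat m powr s * of_nat k powr s"
  by (simp add: powr_times_real)

definition dirichlet_sum :: "(nat \<Rightarrow> complex) \<Rightarrow> complex \<Rightarrow> complex" where
  "dirichlet_sum f s = (\<Sum>\<^sub>\<infinity>m. dirichlet_term f s m)"

lemma dirichlet_convolution_has_sum:
  assumes f: "(\<lambda>m. norm (dirichlet_term f s m)) summable_on UNIV"
    and g: "(\<lambda>m. norm (dirichlet_term g s m)) summable_on UNIV"
  shows "(dirichlet_term (\<lambda>N. \<Sum>d | d dvd N. f d * g (N div d)) s has_sum dirichlet_sum f s * dirichlet_sum g s) UNIV"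
proof -
  have "((\<lambda>(m, k). dirichlet_term f s m * dirichlet_term g s k) has_sum dirichlet_sum f s * dirichlet_sum g s) (UNIV \<times> UNIV)"
    unfolding dirichlet_sum_def by (rule has_sum_product[OF f g])
  then have "((\<lambda>(m, k). dirichlet_term f s m * dirichlet_term g s k) has_sum dirichlet_sum f s * dirichlet_sum g s) ({0<..} \<times> {0<..})"
    by (rule has_sum_cong_neutral[THEN iffD1, rotated 3]) auto
  moreover have "((\<lambda>(m, k). dirichlet_term f s m * dirichlet_term g s k) has_sum dirichlet_sum f s * dirichlet_sum g s) ({0<..} \<times> {0<..}) \<longleftrightarrow>
     ((\<lambda>(N, d). f d * g (N div d) * of_nat N powr (-s)) has_sum dirichlet_sum f s * dirichlet_sum g s) (SIGMA N:{0<..}. {d. d dvd N})"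
    by (rule has_sum_reindex_bij_witness[of _ "\<lambda>(N, d). (d, N div d)" "\<lambda>(m, k). (m * k, m)"])
       (auto simp: of_nat_mult_powr simp del: of_nat_mult intro: Nat.gr0I elim!: dvdE)
  ultimately have "((\<lambda>(N, d). f d * g (N div d) * of_nat N powr (-s)) has_sum dirichlet_sum f s * dirichlet_sum g s) (SIGMA N:{0<..}. {d. d dvd N})"
    by simp
  then have "(dirichlet_term (\<lambda>N. \<Sum>d | d dvd N. f d * g (N div d)) s has_sum dirichlet_sum f s * dirichlet_sum g s) {0<..}"
    by (rule has_sum_SigmaD) (auto intro!: has_sum_finiteI simp: sum_distrib_right)
  then show ?thesis
    by (rule has_sum_cong_neutral[THEN iffD1, rotated 3]) auto
qed

section \<open>Dirichlet characters span the functions on the residue units\<close>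

text \<open>Pigeonhole: two powers of \<open>a\<close> are congruent, and the smaller one can be cancelled.\<close>
lemma exists_power_cong_1:
  fixes a n :: int
  assumes "coprime a n" "n > 0"
  obtains k :: nat where "k > 0" "[a ^ k = 1] (mod n)"
proof -
  have "(\<lambda>k::nat. a ^ k mod n) ` UNIV \<subseteq> {0..<n}" using assms by auto
  then have "finite (range (\<lambda>k::nat. a ^ k mod n))" by (rule finite_subset) simp
  then have "\<not> inj (\<lambda>k::nat. a ^ k mod n)"
    using finite_imageD by blast
  then obtain i j :: nat where ij: "i < j" "[a ^ i = a ^ j] (mod n)"
    unfolding inj_def Cong.cong_def by (metis linorder_neqE_nat)
  then have "[a ^ i * 1 = a ^ i * a ^ (j - i)] (mod n)"
    by (simp flip: power_add)
  then have "[1 = a ^ (j - i)] (mod n)"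
    using assms by (subst (asm) cong_mult_lcancel) auto
  then show ?thesis using that[of "j - i"] ij(1) by (simp add: cong_sym)
qed

definition periodic :: "int \<Rightarrow> (int \<Rightarrow> complex) \<Rightarrow> bool" where
  "periodic n f \<longleftrightarrow> (\<forall>x. f (x + n) = f x)"

lemma periodic_cong:
  assumes "periodic n f" "[x = y] (mod n)"
  shows "f x = f y"
proof -
  have *: "f (x + n * int k) = f x" for x k
  proof (induction k)
    case (Suc k)
    have "f (x + n * int (Suc k)) = f ((x + n * int k) + n)" by (simp add: algebra_simps)
    then show ?case using assms(1) Suc unfolding periodic_def by simp
  qed simp
  obtain c where c: "y = x + n * c" using assms(2) cong_iff_lin by blast
  show ?thesis
  proof (cases "c \<ge> 0")
    case True
    then show ?thesis using *[of x "nat c"] c by simp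
  next
    case False
    then show ?thesis using *[of y "nat (- c)"] c by simp
  qed
qed

definition dirichlet_character :: "int \<Rightarrow> (int \<Rightarrow> complex) \<Rightarrow> bool" where
  "dirichlet_character n \<psi> \<longleftrightarrow> periodic n \<psi> \<and> (\<forall>x y. \<psi> (x * y) = \<psi> x * \<psi> y) \<and> (\<forall>x. \<psi> x \<noteq> 0 \<longleftrightarrow> coprime x n)"

lemma dirichlet_characterD:
  assumes "dirichlet_character n \<psi>"
  shows "periodic n \<psi>" "\<psi> (x * y) = \<psi> x * \<psi> y" "\<psi> x \<noteq> 0 \<longleftrightarrow> coprime x n" "\<psi> 1 = 1"
proof -
  show *: "periodic n \<psi>" "\<psi> (x * y) = \<psi> x * \<psi> y" "\<psi> x \<noteq> 0 \<longleftrightarrow> coprime x n"  for x y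
    using assms by (auto simp: dirichlet_character_def)
  show "\<psi> 1 = 1" using *(2)[of 1 1] *(3)[of 1] by auto
qed

text \<open>A unit has a power congruent to \<open>1\<close>, so its character value is a root of unity.\<close>
lemma norm_dirichlet_character:
  assumes "dirichlet_character n \<psi>" "n > 0"
  shows "norm (\<psi> x) = (if coprime x n then 1 else 0)"
proof (cases "coprime x n")
  case True
  obtain k :: nat where k: "k > 0" "[x ^ k = 1] (mod n)"
    using exists_power_cong_1[OF True assms(2)] by blast
  note \<psi> = dirichlet_characterD[OF assms(1)]
  have "\<psi> (x ^ j) = \<psi> x ^ j" for j by (induction j) (simp_all add: \<psi>)
  then have "\<psi> x ^ k = 1" using periodic_cong[OF \<psi>(1) k(2)] \<psi>(4) by simp
  then have "norm (\<psi> x) ^ k = 1 ^ k" by (metis norm_one norm_power power_one)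
  then have "norm (\<psi> x) = 1" using k(1) by (metis norm_ge_zero power_eq_imp_eq_base zero_le_one)
  then show ?thesis using True by simp
next
  case False
  then show ?thesis using dirichlet_characterD(3)[OF assms(1), of x] by auto
qed

text \<open>Functions on the unit group modulo \<open>n\<close>, extended by zero, that \<open>x \<mapsto> -x\<close> multiplies by \<open>e\<close>.\<close>
definition unit_function :: "int \<Rightarrow> complex \<Rightarrow> (int \<Rightarrow> complex) \<Rightarrow> bool" where
  "unit_function n e f \<longleftrightarrow> periodic n f \<and> (\<forall>x. \<not> coprime x n \<longrightarrow> f x = 0) \<and> (\<forall>x. f (- x) = e * f x)"

definition dilation_eigen :: "(int \<Rightarrow> complex) \<Rightarrow> int \<Rightarrow> bool" where
  "dilation_eigen f g \<longleftrightarrow> (\<exists>c. \<forall>x. f (g * x) = c * f x)"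

lemma sum_cis_orthogonality:
  fixes k N :: nat
  assumes "k < N"
  shows "(\<Sum>j<N. cis (2 * pi / N) ^ (j * k)) = (if k = 0 then of_nat N else 0)"
proof (cases "k = 0")
  case False
  define w where "w = cis (2 * pi / N) ^ k"
  have N: "N > 0" using assms by simp
  have "w \<noteq> 1"
  proof
    assume "w = 1"
    then have "cis (2 * pi * real k / N) = cis (2 * pi * real 0 / N)"
      unfolding w_def Complex.DeMoivre by (simp add: mult_ac)
    moreover have "inj_on (\<lambda>k. cis (2 * pi * real k / real N)) {..<N}"
      using Complex.bij_betw_roots_unity[OF N] by (simp add: bij_betw_def)
    ultimately have "k = 0" using assms N by (auto dest!: inj_onD[where x = k and y = 0])
    then show False using False by simp
  qed
  moreover have "w ^ N = 1"
  proof -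
    have "w ^ N = cis (2 * pi * of_int (int k))"
      unfolding w_def Complex.DeMoivre using N by (simp add: mult_ac)
    then show ?thesis by (subst (asm) cis_multiple_2pi) auto
  qed
  ultimately have "(\<Sum>j<N. w ^ j) = 0" by (simp add: geometric_sum)
  then show ?thesis using False by (simp add: w_def mult.commute flip: power_mult)
qed simp

text \<open>The dilation \<open>f(x) \<mapsto> f(gx)\<close> by a unit has finite order \<open>N\<close> on these functions. Hence \<open>f\<close> is the sum of its
projections to the eigenspaces for the \<open>N\<close>-th roots of unity. As dilations commute, a projection for
one more \<open>g\<close> preserves the eigenvector property for the previous ones, and so finitely many dilations can be
diagonalised simultaneously. Stated as an induction principle, this avoids handling the finite sum explicitly.\<close>
lemma eigenfunction_induct:
  fixes n :: int
  assumes n: "n > 0" and fin: "finite S" and S: "\<And>g. g \<in> S \<Longrightarrow> coprime g n"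
    and zero: "Q (\<lambda>_. 0)" and add: "\<And>f g. Q f \<Longrightarrow> Q g \<Longrightarrow> Q (\<lambda>x. f x + g x)"
    and eigen: "\<And>f. unit_function n e f \<Longrightarrow> (\<And>g. g \<in> S \<Longrightarrow> dilation_eigen f g) \<Longrightarrow> Q f"
    and f: "unit_function n e f"
  shows "Q f"
  using fin S eigen f
proof (induction S arbitrary: f rule: finite_induct)
  case (insert g S)
  show ?case
  proof (rule insert.IH)
    show "unit_function n e f" by (rule insert.prems)
    fix f assume f: "unit_function n e f" and eS: "\<And>g. g \<in> S \<Longrightarrow> dilation_eigen f g"
    have g: "coprime g n" using insert.prems by simp
    obtain N :: nat where N: "N > 0" "[g ^ N = 1] (mod n)"
      using exists_power_cong_1[OF g n] by blast
    define w where "w = cis (2 * pi / N)"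
    have wN: "w ^ N = 1" unfolding w_def Complex.DeMoivre using N by simp
    have w0: "w \<noteq> 0" by (simp add: w_def)
    \<comment> \<open>The projection to the eigenspace of the dilation by \<open>g\<close> for the eigenvalue \<open>w\<^sup>-\<^sup>j\<close>.\<close>
    define P where "P j x = (\<Sum>k<N. w ^ (j * k) * f (g ^ k * x)) / of_nat N" for j x
    have sumP: "f = (\<lambda>x. \<Sum>j<N. P j x)"
    proof
      fix x
      have "(\<Sum>j<N. P j x) = (\<Sum>k<N. (\<Sum>j<N. w ^ (j * k)) * f (g ^ k * x)) / of_nat N"
        unfolding P_def sum_divide_distrib[symmetric] sum_distrib_right by (subst sum.swap) simp
      also have "\<dots> = (\<Sum>k<N. if k = 0 then of_nat N * f x else 0) / of_nat N"
        unfolding w_def using sum_cis_orthogonality[of _ N]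
        by (intro arg_cong2[where f = "(/)"] sum.cong refl) auto
      also have "\<dots> = f x" using N by simp
      finally show "f x = (\<Sum>j<N. P j x)" ..
    qed
    have "Q (P j)" for j
    proof (rule insert.prems(2))
      show "unit_function n e (P j)"
        unfolding unit_function_def
      proof (intro conjI allI impI)
        show "periodic n (P j)"
          unfolding periodic_def P_def
        proof
          fix x
          have "f (g ^ k * (x + n)) = f (g ^ k * x)" for k
            using f by (intro periodic_cong[of n]) (auto simp: unit_function_def Cong.cong_def algebra_simps)
          then show "(\<Sum>k<N. w ^ (j * k) * f (g ^ k * (x + n))) / of_nat N = (\<Sum>k<N. w ^ (j * k) * f (g ^ k * x)) / of_nat N"
            by simp
        qed
        fix x
        show "P j x = 0" if "\<not> coprime x n"
          using f that unfolding P_def unit_function_def by (simp add: coprime_mult_left_iff)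
        show "P j (- x) = e * P j x"
          using f unfolding P_def unit_function_def by (simp add: sum_distrib_left mult_ac)
      qed
      fix h assume h: "h \<in> insert g S"
      show "dilation_eigen (P j) h"
      proof (cases "h \<in> S")
        case True
        then obtain c where c: "\<And>x. f (h * x) = c * f x"
          using eS by (auto simp: dilation_eigen_def)
        have "f (g ^ k * (h * x)) = c * f (g ^ k * x)" for k x
          using c[of "g ^ k * x"] by (simp add: mult_ac)
        then have "P j (h * x) = c * P j x" for x
          by (simp add: P_def sum_distrib_left mult.left_commute[of _ c])
        then show ?thesis unfolding dilation_eigen_def by blast
      next
        case False
        then have [simp]: "h = g" using h by simp
        have "w ^ j * P j (g * x) = P j x" for x
        proof -
          define t where "t k = w ^ (j * k) * f (g ^ k * x)" for k
          have "w ^ j * P j (g * x) = (\<Sum>k<N. t (Suc k)) / of_nat N"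
            by (simp add: P_def t_def sum_distrib_left power_add mult_ac)
          also have "(\<Sum>k<N. t (Suc k)) = (\<Sum>k<N. t k)"
          proof -
            have "w ^ (j * N) = 1" by (metis mult.commute power_mult power_one wN)
            moreover have "f (g ^ N * x) = f x"
              using f cong_mult[OF N(2) cong_refl, of x] periodic_cong[of n f "g ^ N * x" x]
              by (auto simp: unit_function_def)
            ultimately have "t N = t 0" by (simp add: t_def)
            then show ?thesis using sum.lessThan_Suc[of t N] sum.lessThan_Suc_shift[of t N] by simp
          qed
          finally show ?thesis by (simp add: P_def t_def)
        qed
        then have "\<forall>x. P j (g * x) = inverse (w ^ j) * P j x"
          using w0 by (simp add: field_simps)
        then show ?thesis unfolding dilation_eigen_def by auto
      qed
    qed
    then have "Q (\<lambda>x. \<Sum>j<M. P j x)" for M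
      by (induction M) (use zero add in auto)
    then show "Q f" using sumP by metis
  qed (use insert.prems in auto)
qed auto

text \<open>A common eigenfunction \<open>f\<close> of all dilations by units is \<open>f(1)\<close> times a character: comparing
\<open>f(gx) = c f(x)\<close> at \<open>x\<close> and at \<open>1\<close> gives \<open>f(gx) f(1) = f(g) f(x)\<close>. Hence functions of a given parity are
linear combinations of characters of that parity, and a linear property of characters passes to all of them.\<close>
lemma character_induct:
  fixes n :: int
  assumes n: "n > 0"
    and zero: "Q (\<lambda>_. 0)" and add: "\<And>f g. Q f \<Longrightarrow> Q g \<Longrightarrow> Q (\<lambda>x. f x + g x)"
    and scale: "\<And>c f. Q f \<Longrightarrow> Q (\<lambda>x. c * f x)"
    and char: "\<And>\<psi>. dirichlet_character n \<psi> \<Longrightarrow> \<psi> (- 1) = e \<Longrightarrow> Q \<psi>"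
    and f: "unit_function n e f"
  shows "Q f"
proof (rule eigenfunction_induct[where S = "{g \<in> {0..<n}. coprime g n}" and Q = Q, OF n _ _ zero add _ f])
  fix f assume f: "unit_function n e f"
    and eig: "\<And>g. g \<in> {g \<in> {0..<n}. coprime g n} \<Longrightarrow> dilation_eigen f g"
  have per: "periodic n f" and supp: "\<And>x. \<not> coprime x n \<Longrightarrow> f x = 0"
    and sym: "\<And>x. f (- x) = e * f x"
    using f by (auto simp: unit_function_def)
  have mult: "f (g * x) * f 1 = f g * f x" for g x
  proof (cases "coprime g n")
    case True
    have "g mod n \<in> {g \<in> {0..<n}. coprime g n}" using n True by simp
    then obtain c where c: "\<And>x. f (g mod n * x) = c * f x"
      using eig unfolding dilation_eigen_def by blast
    have "f (g mod n * x) = f (g * x)" for x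
      by (rule periodic_cong[OF per]) (simp add: Cong.cong_def mod_mult_left_eq)
    then have "f (g * x) = c * f x" for x using c by simp
    from this[of x] this[of 1] show ?thesis by simp
  next
    case False
    then show ?thesis using supp[of g] supp[of "g * x"] by (simp add: coprime_mult_left_iff)
  qed
  show "Q f"
  proof (cases "f 1 = 0")
    case True
    have "f x = 0" for x
    proof (cases "coprime x n")
      case c: True
      then obtain y where y: "[x * y = 1] (mod n)" by (metis cong_modular_inverse1)
      have "x mod n \<in> {g \<in> {0..<n}. coprime g n}" using n c by simp
      then obtain c where c: "\<And>y. f (x mod n * y) = c * f y"
        using eig unfolding dilation_eigen_def by blast
      have "f x = f (x mod n * 1)" by (rule periodic_cong[OF per]) (simp add: Cong.cong_def)
      then show ?thesis using c[of 1] True by simp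
    qed (use supp in auto)
    then have "f = (\<lambda>_. 0)" by auto
    then show ?thesis using zero by simp
  next
    case False
    define \<psi> where "\<psi> x = f x / f 1" for x
    have \<psi>_mult: "\<psi> (x * y) = \<psi> x * \<psi> y" for x y
      using mult[of x y] False by (simp add: \<psi>_def field_simps)
    have \<psi>_per: "periodic n \<psi>" using per by (simp add: periodic_def \<psi>_def)
    have "\<psi> x \<noteq> 0 \<longleftrightarrow> coprime x n" for x
    proof
      assume "coprime x n"
      then obtain y where y: "[x * y = 1] (mod n)" by (metis cong_modular_inverse1)
      then have "\<psi> x * \<psi> y = 1"
        using periodic_cong[OF \<psi>_per y] False by (simp add: \<psi>_mult) (simp add: \<psi>_def)
      then show "\<psi> x \<noteq> 0" by auto
    qed (use supp in \<open>auto simp: \<psi>_def\<close>)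
    then have "dirichlet_character n \<psi>"
      using \<psi>_mult \<psi>_per by (simp add: dirichlet_character_def)
    moreover have "\<psi> (- 1) = e" using sym[of 1] False by (simp add: \<psi>_def)
    ultimately have "Q (\<lambda>x. f 1 * \<psi> x)" by (intro scale char)
    then show ?thesis using False by (simp add: \<psi>_def)
  qed
qed (auto intro: finite_subset[of _ "{0..<n}"])

section \<open>Dirichlet series of odd functions and of the principal character\<close>

lemma dirichlet_sum_sums:
  assumes "(\<lambda>m. norm (dirichlet_term f s m)) summable_on UNIV"
  shows "(dirichlet_term f s has_sum dirichlet_sum f s) UNIV" "dirichlet_term f s sums dirichlet_sum f s"
proof -
  show *: "(dirichlet_term f s has_sum dirichlet_sum f s) UNIV"
    unfolding dirichlet_sum_def using abs_summable_summable[OF assms] by simp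
  show "dirichlet_term f s sums dirichlet_sum f s" using * by (rule has_sum_imp_sums)
qed

lemma dirichlet_sum_eqI:
  assumes "(\<lambda>m. norm (dirichlet_term f s m)) summable_on UNIV" "dirichlet_term f s sums S"
  shows "dirichlet_sum f s = S"
  using dirichlet_sum_sums(2)[OF assms(1)] assms(2) by (rule sums_unique2)

text \<open>By complete multiplicativity the convolution of \<open>\<mu>g\<close> and \<open>g\<close> is \<open>g(N)\<close> times the sum of \<open>\<mu>\<close> over the divisors of \<open>N\<close>.\<close>
lemma completely_multiplicative_moebius_inverse:
  assumes bound: "\<And>m. m > 0 \<Longrightarrow> norm (g m) \<le> 1" and mult: "\<And>m k. g (m * k) = g m * g k" and one: "g 1 = 1"
    and s: "Re s > 1"
  shows "dirichlet_sum (\<lambda>m. of_int (moebius_mu m) * g m) s * dirichlet_sum g s = 1"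
proof -
  have \<mu>: "norm (of_int (moebius_mu m) * g m) \<le> 1" if "m > 0" for m
    using bound[OF that] abs_moebius_mu_le[of m]
    by (auto simp: norm_mult intro!: mult_le_one simp flip: of_int_abs)
  have "(dirichlet_term (\<lambda>N. \<Sum>d | d dvd N. of_int (moebius_mu d) * g d * g (N div d)) s
          has_sum dirichlet_sum (\<lambda>m. of_int (moebius_mu m) * g m) s * dirichlet_sum g s) UNIV"
    by (rule dirichlet_convolution_has_sum; rule summable_dirichlet_term[OF _ s]; fact)
  moreover have "(\<Sum>d | d dvd N. of_int (moebius_mu d) * g d * g (N div d)) = (if N = 1 then 1 else 0)" if "N > 0" for N
  proof -
    have "(\<Sum>d | d dvd N. of_int (moebius_mu d) * g d * g (N div d)) = (\<Sum>d | d dvd N. of_int (moebius_mu d) * g N)"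
      by (intro sum.cong refl) (auto simp: mult.assoc simp flip: mult)
    also have "\<dots> = of_int (\<Sum>d | d dvd N. moebius_mu d) * g N"
      by (simp add: sum_distrib_right)
    finally show ?thesis using sum_moebius_mu_divisors[OF that] one by simp
  qed
  then have "dirichlet_term (\<lambda>N. \<Sum>d | d dvd N. of_int (moebius_mu d) * g d * g (N div d)) s N = (if N = 1 then 1 else 0)" for N
    by (cases "N = 0") auto
  ultimately have "((\<lambda>N::nat. if N = 1 then 1 else 0) has_sum dirichlet_sum (\<lambda>m. of_int (moebius_mu m) * g m) s * dirichlet_sum g s) UNIV"
    by simp
  moreover have "((\<lambda>N::nat. if N = 1 then 1 else 0 :: complex) has_sum 1) UNIV"
    by (rule has_sum_finite_neutralI[of "{1}"]) auto
  ultimately show ?thesis using has_sum_unique by blast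
qed

text \<open>The reflection \<open>m \<mapsto> n - m\<close> changes the sign of the sum over a period.\<close>
lemma sum_odd_periodic:
  assumes "periodic n f" "\<And>x. f (- x) = - f x" "n > 0"
  shows "(\<Sum>m<nat n. f (int m)) = 0"
proof -
  have "f 0 = 0" using assms(2)[of 0] by simp
  define S where "S = (\<Sum>m=1..<nat n. f (int m))"
  have "S = (\<Sum>m=1..<nat n. f (int (nat n - m)))"
    unfolding S_def by (rule sum.reindex_bij_witness[of _ "\<lambda>m. nat n - m" "\<lambda>m. nat n - m"]) auto
  also have "\<dots> = (\<Sum>m=1..<nat n. - f (int m))"
  proof (intro sum.cong refl)
    fix m assume m: "m \<in> {1..<nat n}"
    have "f (int (nat n - m)) = f (- int m)"
      by (rule periodic_cong[OF assms(1)]) (use m in \<open>simp add: of_nat_diff Cong.cong_def\<close>)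
    then show "f (int (nat n - m)) = - f (int m)" using assms(2) by simp
  qed
  also have "\<dots> = - S" by (simp add: S_def sum_negf)
  finally have "S = 0" by simp
  moreover have "{..<nat n} = insert 0 {1..<nat n}" using assms(3) by auto
  ultimately show ?thesis using \<open>f 0 = 0\<close> by (simp add: S_def)
qed

lemma odd_periodic_dirichlet_series:
  assumes "periodic n f" "\<And>x. f (- x) = - f x" "n > 0"
  obtains L where "L holomorphic_on {s. Re s > 0}"
    "\<And>s. Re s > 0 \<Longrightarrow> dirichlet_term (\<lambda>m. f (int m)) s sums L s"
proof -
  have "f (int (m + nat n)) = f (int m)" for m
    using assms by (simp add: periodic_def)
  then obtain B where "\<And>M. norm (\<Sum>m=1..M. f (int m)) \<le> B"
    using bounded_partial_sums_periodic[of "nat n" "\<lambda>m. f (int m)"] sum_odd_periodic[OF assms] assms(3) by auto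
  then show ?thesis using dirichlet_series_bounded_partial_sums that by blast
qed

lemma powr_dirichlet_twist: "of_nat m powr (- w) * of_nat m powr (- s) = (of_nat m powr (- (s + w)) :: complex)"
  unfolding minus_add_distrib powr_add by (rule mult.commute)

definition principal_char :: "int \<Rightarrow> nat \<Rightarrow> complex" where
  "principal_char n m = of_bool (coprime (int m) n)"

lemma principal_char_simps:
  "principal_char n (m * k) = principal_char n m * principal_char n k"
  "norm (principal_char n m) \<le> 1" "principal_char n 1 = 1" "principal_char n m * principal_char n m = principal_char n m"
  by (simp_all add: principal_char_def coprime_mult_left_iff)

text \<open>The factor \<open>1 - 2\<^sup>1\<^sup>-\<^sup>s\<close> removes the pole at \<open>1\<close>: on coefficients it subtracts \<open>2 p(m/2)\<close> at the even \<open>m\<close>, and the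
result has period \<open>2n\<close> and sum zero over a period. It vanishes at \<open>1\<close> to first order, so it also records
the order of the pole.\<close>
lemma alternating_principal_series:
  assumes "n > 0"
  obtains W where "W holomorphic_on {s. Re s > 0}"
    "\<And>s. Re s > 1 \<Longrightarrow> W s = (1 - 2 powr (1 - s)) * dirichlet_sum (principal_char n) s"
proof -
  define p where "p = principal_char n"
  define N where "N = nat n"
  have N: "N > 0" using assms by (simp add: N_def)
  have per: "p (m + N) = p m" for m
    using assms by (simp add: p_def N_def principal_char_def coprime_iff_gcd_eq_1 del: of_nat_add) (simp add: N_def)
  define f where "f m = p m - (if even m then 2 * p (m div 2) else 0)" for m
  have "f (m + 2 * N) = f m" for m
  proof -
    have "p (m + 2 * N) = p m" by (metis add.assoc mult_2 per)
    moreover have "(m + 2 * N) div 2 = m div 2 + N" by simp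
    ultimately show ?thesis by (simp add: f_def per)
  qed
  moreover have "(\<Sum>m<2 * N. f m) = 0"
  proof -
    have "(\<Sum>m<2 * N. p m) = (\<Sum>m<N. p m) + (\<Sum>m=N..<N + N. p m)"
      by (simp add: lessThan_atLeast0 mult_2 sum.atLeastLessThan_concat)
    also have "(\<Sum>m=N..<N + N. p m) = (\<Sum>m<N. p (m + N))"
      using sum.shift_bounds_nat_ivl[of p 0 N N] by (simp add: lessThan_atLeast0)
    finally have 1: "(\<Sum>m<2 * N. p m) = 2 * (\<Sum>m<N. p m)" by (simp add: per)
    have "(\<Sum>m<2 * N. if even m then 2 * p (m div 2) else 0) = (\<Sum>m\<in>(*) 2 ` {..<N}. 2 * p (m div 2))"
      by (rule sum.mono_neutral_cong_right) (auto elim!: evenE)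
    also have "\<dots> = (\<Sum>m<N. 2 * p m)"
      by (subst sum.reindex) (auto simp: inj_on_def)
    finally show ?thesis using 1 by (simp add: f_def sum_subtractf sum_distrib_left)
  qed
  ultimately obtain B where B: "\<And>M. norm (\<Sum>m=1..M. f m) \<le> B"
    using bounded_partial_sums_periodic[of "2 * N" f] N by auto
  obtain W where W: "W holomorphic_on {s. Re s > 0}" "\<And>s. Re s > 0 \<Longrightarrow> dirichlet_term f s sums W s"
    using dirichlet_series_bounded_partial_sums[OF B] by blast
  have "W s = (1 - 2 powr (1 - s)) * dirichlet_sum (principal_char n) s" if s: "Re s > 1" for s
  proof -
    have summ: "(\<lambda>m. norm (dirichlet_term p s m)) summable_on UNIV"
      by (rule summable_dirichlet_term[of _ 1]) (use s in \<open>auto simp: p_def principal_char_simps\<close>)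
    have 1: "(dirichlet_term p s has_sum dirichlet_sum p s) UNIV" by (rule dirichlet_sum_sums[OF summ])
    have "((\<lambda>m. (2 powr (1 - s)) * dirichlet_term p s m) has_sum (2 powr (1 - s)) * dirichlet_sum p s) UNIV"
      by (rule has_sum_cmult_right[OF 1])
    also have "(\<lambda>m. (2 powr (1 - s)) * dirichlet_term p s m) = dirichlet_term (\<lambda>m. if even m then 2 * p (m div 2) else 0) s \<circ> (*) 2"
    proof
      fix m
      have "of_nat (2 * m) powr (- s) = (2 powr (- s) * of_nat m powr (- s) :: complex)"
        using of_nat_mult_powr[of 2 m "-s"] by simp
      moreover have "2 powr (1 - s) = (2 * 2 powr (- s) :: complex)"
        by (simp add: powr_diff powr_minus field_simps)
      ultimately show "2 powr (1 - s) * dirichlet_term p s m = (dirichlet_term (\<lambda>m. if even m then 2 * p (m div 2) else 0) s \<circ> (*) 2) m"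
        by simp
    qed
    finally have "(dirichlet_term (\<lambda>m. if even m then 2 * p (m div 2) else 0) s has_sum (2 powr (1 - s)) * dirichlet_sum p s) (range ((*) 2))"
      by (rule has_sum_reindex[THEN iffD2, rotated]) (auto simp: inj_on_def)
    then have 2: "(dirichlet_term (\<lambda>m. if even m then 2 * p (m div 2) else 0) s has_sum (2 powr (1 - s)) * dirichlet_sum p s) UNIV"
      by (rule has_sum_cong_neutral[THEN iffD1, rotated 3]) (auto elim!: evenE)
    have "dirichlet_term f s sums (dirichlet_sum p s - (2 powr (1 - s)) * dirichlet_sum p s)"
      using sums_diff[OF has_sum_imp_sums[OF 1] has_sum_imp_sums[OF 2]]
      by (simp add: f_def left_diff_distrib)
    then show ?thesis using W(2)[of s] s sums_unique2 by (fastforce simp: p_def left_diff_distrib)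
  qed
  then show ?thesis using that W(1) by blast
qed

section \<open>The Ramanujan--Ingham identity\<close>

text \<open>A pair of positive integers is uniquely \<open>(gu, gv)\<close> with \<open>u\<close> and \<open>v\<close> coprime, where \<open>g\<close> is the gcd.\<close>
lemma gcd_parametrisation:
  fixes f :: "nat \<Rightarrow> nat \<Rightarrow> nat \<Rightarrow> complex"
  shows "((\<lambda>(g, u, v). f g u v) has_sum S) ({0<..} \<times> {(u, v). u > 0 \<and> v > 0 \<and> coprime u v}) \<longleftrightarrow>
    ((\<lambda>(d, e). f (gcd d e) (d div gcd d e) (e div gcd d e)) has_sum S) ({0<..} \<times> {0<..})"
proof (rule has_sum_reindex_bij_witness[of _ "\<lambda>(d, e). (gcd d e, d div gcd d e, e div gcd d e)" "\<lambda>(g, u, v). (g * u, g * v)"])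
  fix b :: "nat \<times> nat" assume "b \<in> {0<..} \<times> {0<..}"
  then obtain d e where b: "b = (d, e)" "d > 0" "e > 0" by auto
  then show "(case case b of (d, e) \<Rightarrow> (gcd d e, d div gcd d e, e div gcd d e) of (g, u, v) \<Rightarrow> (g * u, g * v)) = b"
    by simp
  show "(case b of (d, e) \<Rightarrow> (gcd d e, d div gcd d e, e div gcd d e)) \<in> {0<..} \<times> {(u, v). u > 0 \<and> v > 0 \<and> coprime u v}"
    using b by (auto intro: div_gcd_coprime simp: div_greater_zero_iff)
qed (auto simp: gcd_mult_distrib_nat[symmetric])

text \<open>Let \<open>Y\<close> be the sum of \<open>g(u) cnj (g(v)) (uv)\<^sup>-\<^sup>s\<close> over coprime pairs \<open>(u, v)\<close>, and write \<open>Z\<close> for the series of the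
principal character. Parametrising all pairs by their gcd, and using that \<open>|g|\<^sup>2\<close> is the
principal character, the product of the series of \<open>g\<close> and its conjugate is \<open>Z(2s) Y\<close>.
On the other side, \<open>|\<Sum> g(d)|\<^sup>2\<close> is a sum over pairs of divisors of \<open>m\<close>; such a pair is \<open>(au, av)\<close> with
\<open>m = k a u v\<close>, because \<open>a u v\<close> is its least common multiple. So the series of squares is \<open>Z(s)\<^sup>2 Y\<close>, with one
factor \<open>Z(s)\<close> each for \<open>k\<close> and \<open>a\<close>.\<close>
lemma square_divisor_sum_identity:
  fixes g :: "nat \<Rightarrow> complex" and s :: complex
  assumes mult: "\<And>m k. g (m * k) = g m * g k"
    and norm: "\<And>m. g m * cnj (g m) = principal_char n m" and s: "Re s > 1"
  defines "c \<equiv> \<lambda>m. principal_char n m * ((\<Sum>d | d dvd m. g d) * cnj (\<Sum>d | d dvd m. g d))"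
  obtains D where "(dirichlet_term c s has_sum D) UNIV"
    "dirichlet_sum (principal_char n) (2 * s) * D
       = dirichlet_sum (principal_char n) s ^ 2 * (dirichlet_sum g s * dirichlet_sum (\<lambda>m. cnj (g m)) s)"
proof -
  define p where "p = principal_char n"
  define h where "h m = (of_nat m powr (- s) :: complex)" for m
  have h_mult: "h (m * k) = h m * h k" for m k unfolding h_def by (rule of_nat_mult_powr)
  have norm_g: "norm (g m) \<le> 1" for m
  proof -
    have "norm (g m) ^ 2 = norm (principal_char n m)"
      by (simp add: norm[symmetric] norm_mult power2_eq_square)
    then have "norm (g m) ^ 2 \<le> 1" using principal_char_simps(2)[of n m] by simp
    then show ?thesis by (simp add: power_le_one_iff)
  qed
  have p_g: "p m * g m = g m" for m
  proof -
    have "norm (g m) ^ 2 = norm (p m)"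
      by (simp add: p_def norm[symmetric] norm_mult power2_eq_square)
    then show ?thesis by (auto simp: p_def principal_char_def)
  qed
  have p_g': "p m * cnj (g m) = cnj (g m)" for m
    using p_g[of m] by (cases "coprime (int m) n") (auto simp: p_def principal_char_def)
  have summ_g: "(\<lambda>m. norm (dirichlet_term g s m)) summable_on UNIV"
    "(\<lambda>m. norm (dirichlet_term (\<lambda>m. cnj (g m)) s m)) summable_on UNIV"
    "(\<lambda>m. norm (dirichlet_term p s m)) summable_on UNIV"
    by (rule summable_dirichlet_term[of _ 1]; use s norm_g in \<open>simp add: p_def principal_char_simps\<close>)+
  have summ_p2: "(\<lambda>m. norm (dirichlet_term p (2 * s) m)) summable_on UNIV"
    by (rule summable_dirichlet_term[of _ 1]) (use s in \<open>auto simp: p_def principal_char_simps\<close>)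
  define X where "X = {(u, v). u > 0 \<and> v > 0 \<and> coprime u (v :: nat)}"
  define F where "F = (\<lambda>(u, v). dirichlet_term g s u * dirichlet_term (\<lambda>m. cnj (g m)) s v)"
  have GG: "(F has_sum dirichlet_sum g s * dirichlet_sum (\<lambda>m. cnj (g m)) s) (UNIV \<times> UNIV)"
    "(\<lambda>z. norm (F z)) summable_on UNIV \<times> UNIV"
    using has_sum_product[OF summ_g(1,2)] unfolding dirichlet_sum_def F_def
    by (simp_all add: case_prod_unfold)
  have "(\<lambda>z. norm (F z)) summable_on X"
    by (rule summable_on_subset_banach[OF GG(2)]) auto
  note F_X = this
  have on_pos: "(\<lambda>m. norm (dirichlet_term f w m)) summable_on {0<..}" "infsum (dirichlet_term f w) {0<..} = dirichlet_sum f w"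
    if "(\<lambda>m. norm (dirichlet_term f w m)) summable_on UNIV" for f w
  proof -
    show "(\<lambda>m. norm (dirichlet_term f w m)) summable_on {0<..}"
      using that by (rule summable_on_subset_banach) auto
    show "infsum (dirichlet_term f w) {0<..} = dirichlet_sum f w"
      unfolding dirichlet_sum_def by (rule infsum_cong_neutral) auto
  qed

  \<comment> \<open>The product of the two twisted series, by the gcd of the pair of indices.\<close>
  have "((\<lambda>(g', z). dirichlet_term p (2 * s) g' * F z) has_sum dirichlet_sum p (2 * s) * infsum F X) ({0<..} \<times> X)"
    using has_sum_product(1)[OF on_pos(1)[OF summ_p2] F_X] on_pos(2)[OF summ_p2] by simp
  also have "(\<lambda>(g', z). dirichlet_term p (2 * s) g' * F z) = (\<lambda>(g', u, v). F (g' * u, g' * v))"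
  proof (safe intro!: ext)
    fix a u v
    have "of_nat a powr (- (2 * s)) = h a * h a"
      unfolding h_def by (simp flip: powr_add)
    moreover have "p a = g a * cnj (g a)" by (simp add: p_def norm)
    ultimately show "dirichlet_term p (2 * s) a * F (u, v) = F (a * u, a * v)"
      by (simp add: F_def mult flip: h_def) (simp add: h_mult mult_ac)
  qed
  finally have "((\<lambda>(d, e). F (d, e)) has_sum dirichlet_sum p (2 * s) * infsum F X) ({0<..} \<times> {0<..})"
    unfolding X_def by (subst (asm) gcd_parametrisation) simp
  then have "((\<lambda>(d, e). F (d, e)) has_sum dirichlet_sum p (2 * s) * infsum F X) (UNIV \<times> UNIV)"
    by (rule has_sum_cong_neutral[THEN iffD1, rotated 3]) (auto simp: F_def)
  then have LL: "dirichlet_sum g s * dirichlet_sum (\<lambda>m. cnj (g m)) s = dirichlet_sum p (2 * s) * infsum F X"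
    using GG(1) by (simp add: has_sum_unique)

  \<comment> \<open>The series of squares, by the quadruple \<open>(k, a, u, v)\<close>.\<close>
  have "((\<lambda>(a, z). dirichlet_term p s a * F z) has_sum dirichlet_sum p s * infsum F X) ({0<..} \<times> X)"
    "(\<lambda>(a, z). norm (dirichlet_term p s a * F z)) summable_on {0<..} \<times> X"
    using has_sum_product[OF on_pos(1)[OF summ_g(3)] F_X] on_pos(2)[OF summ_g(3)] by simp_all
  note inner = this
  have "((\<lambda>(k, y). dirichlet_term p s k * (case y of (a, z) \<Rightarrow> dirichlet_term p s a * F z)) has_sum
      dirichlet_sum p s * (dirichlet_sum p s * infsum F X)) ({0<..} \<times> ({0<..} \<times> X))"
    using has_sum_product(1)[OF on_pos(1)[OF summ_g(3)], of "\<lambda>(a, z). dirichlet_term p s a * F z" "{0<..} \<times> X"]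
      inner on_pos(2)[OF summ_g(3)] infsumI[OF inner(1)]
    by (simp add: case_prod_unfold)
  also have "?this \<longleftrightarrow> ((\<lambda>(m, d, e). p m * (g d * cnj (g e)) * h m) has_sum
      dirichlet_sum p s * (dirichlet_sum p s * infsum F X)) (SIGMA m:{0<..}. {d. d dvd m} \<times> {e. e dvd m})"
  proof (rule has_sum_reindex_bij_witness[of _
        "\<lambda>(m, d, e). (m div lcm d e, gcd d e, d div gcd d e, e div gcd d e)"
        "\<lambda>(k, a, u, v). (k * a * u * v, a * u, a * v)"])
    fix x :: "nat \<times> nat \<times> nat \<times> nat"
    assume "x \<in> {0<..} \<times> ({0<..} \<times> X)"
    then obtain k a u v where x: "x = (k, a, u, v)" "k > 0" "a > 0" "u > 0" "v > 0" "coprime u v"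
      by (auto simp: X_def)
    have gcd: "gcd (a * u) (a * v) = a" using x by (simp add: gcd_mult_distrib_nat[symmetric])
    have lcm: "lcm (a * u) (a * v) = a * u * v"
      using x gcd by (simp add: lcm_nat_def)
    show "(case case x of (k, a, u, v) \<Rightarrow> (k * a * u * v, a * u, a * v) of (m, d, e) \<Rightarrow>
        (m div lcm d e, gcd d e, d div gcd d e, e div gcd d e)) = x"
      using x by (simp add: gcd lcm)
    show "(case x of (k, a, u, v) \<Rightarrow> (k * a * u * v, a * u, a * v)) \<in> (SIGMA m:{0<..}. {d. d dvd m} \<times> {e. e dvd m})"
      using x by (auto simp: mult_ac)
    have "p (k * a * u * v) * (g (a * u) * cnj (g (a * v))) * h (k * a * u * v)
        = p k * h k * ((p a * g a * cnj (g a)) * h a * ((p u * g u) * h u * ((p v * cnj (g v)) * h v)))"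
      by (simp add: mult h_mult p_def principal_char_simps)
    also have "p a * g a * cnj (g a) = p a"
      using norm[of a] principal_char_simps(4)[of n a] by (simp add: p_def mult.assoc)
    finally show "(case case x of (k, a, u, v) \<Rightarrow> (k * a * u * v, a * u, a * v) of (m, d, e) \<Rightarrow>
        p m * (g d * cnj (g e)) * h m) =
        (case x of (k, y) \<Rightarrow> dirichlet_term p s k * (case y of (a, z) \<Rightarrow> dirichlet_term p s a * F z))"
      unfolding x(1) p_g p_g' by (simp add: F_def h_def)
  next
    fix x :: "nat \<times> nat \<times> nat"
    assume "x \<in> (SIGMA m:{0<..}. {d. d dvd m} \<times> {e. e dvd (m :: nat)})"
    then obtain m d e where x: "x = (m, d, e)" "m > 0" "d dvd m" "e dvd m" by auto
    have pos: "d > 0" "e > 0" using x by (auto intro: Nat.gr0I)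
    obtain k where k: "m = lcm d e * k" using lcm_least[OF x(3,4)] by (rule dvdE)
    have lcm0: "lcm d e > 0" using pos by (simp add: lcm_pos_nat)
    define a u v where a_u_v_def: "a = gcd d e" "u = d div gcd d e" "v = e div gcd d e"
    have du: "d = a * u" "e = a * v" by (simp_all add: a_u_v_def)
    have cop: "coprime u v" unfolding a_u_v_def using pos by (intro div_gcd_coprime) auto
    have auv: "a > 0" "u > 0" "v > 0" using pos du by auto
    have lcm: "lcm d e = a * u * v"
    proof -
      have "gcd (a * u) (a * v) = a" using cop by (simp add: gcd_mult_distrib_nat[symmetric])
      then show ?thesis unfolding du using auv by (simp add: lcm_nat_def)
    qed
    have folds: "gcd d e = a" "d div a = u" "e div a = v" by (simp_all add: a_u_v_def)
    show "(case case x of (m, d, e) \<Rightarrow> (m div lcm d e, gcd d e, d div gcd d e, e div gcd d e) of (k, a, u, v) \<Rightarrow>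
        (k * a * u * v, a * u, a * v)) = x"
      unfolding x(1) using lcm0 by (simp add: k folds) (use du lcm in \<open>simp add: mult_ac\<close>)
    show "(case x of (m, d, e) \<Rightarrow> (m div lcm d e, gcd d e, d div gcd d e, e div gcd d e)) \<in> {0<..} \<times> ({0<..} \<times> X)"
      unfolding x(1) using lcm0 x(2) auv cop k folds by (auto simp: X_def)
  qed auto
  finally have "(dirichlet_term c s has_sum dirichlet_sum p s * (dirichlet_sum p s * infsum F X)) {0<..}"
  proof (rule has_sum_SigmaD)
    fix m :: nat assume "m \<in> {0<..}"
    then have fin: "finite ({d. d dvd m} \<times> {e. e dvd m})" by simp
    have "(\<Sum>d | d dvd m. g d) * cnj (\<Sum>d | d dvd m. g d) = (\<Sum>(d, e)\<in>{d. d dvd m} \<times> {e. e dvd m}. g d * cnj (g e))"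
      by (simp add: cnj_sum sum_product sum.cartesian_product)
    note sq = this
    have "dirichlet_term c s m = (\<Sum>y\<in>{d. d dvd m} \<times> {e. e dvd m}. case (m, y) of (m, d, e) \<Rightarrow> p m * (g d * cnj (g e)) * h m)"
      unfolding c_def h_def p_def sq by (simp add: sum_distrib_left sum_distrib_right case_prod_unfold)
    then show "((\<lambda>y. case (m, y) of (m, d, e) \<Rightarrow> p m * (g d * cnj (g e)) * h m) has_sum dirichlet_term c s m) ({d. d dvd m} \<times> {e. e dvd m})"
      by (rule has_sum_finiteI[OF fin])
  qed
  then have "(dirichlet_term c s has_sum dirichlet_sum p s * (dirichlet_sum p s * infsum F X)) UNIV"
    by (rule has_sum_cong_neutral[THEN iffD1, rotated 3]) auto
  then show ?thesis
    by (rule that) (simp add: LL p_def power2_eq_square mult_ac)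
qed

section \<open>Dirichlet series with nonnegative coefficients\<close>

lemma sum_le_sums:
  fixes f :: "nat \<Rightarrow> real"
  assumes "finite I" "\<And>n. 0 \<le> f n" "f sums S"
  shows "sum f I \<le> S"
  using sum_le_suminf[of f I] assms by (auto simp: sums_iff)

lemma higher_deriv_dirichlet_polynomial:
  "(deriv ^^ k) (\<lambda>s. \<Sum>m<M. dirichlet_term c s m) = (\<lambda>s. \<Sum>m<M. dirichlet_term (\<lambda>m. c m * (- of_real (ln (real m))) ^ k) s m)"
proof (induction k)
  case (Suc k)
  have "((\<lambda>s. \<Sum>m<M. dirichlet_term (\<lambda>m. c m * (- of_real (ln (real m))) ^ k) s m) has_field_derivative
      (\<Sum>m<M. dirichlet_term (\<lambda>m. c m * (- of_real (ln (real m))) ^ Suc k) s m)) (at s)" for s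
  proof (rule DERIV_sum)
    fix m
    have "((\<lambda>s. of_nat m powr (- s)) has_field_derivative - of_real (ln (real m)) * of_nat m powr (- s)) (at s)"
    proof (cases "m = 0")
      case False
      then have "Ln (of_nat m) = of_real (ln (real m))"
        by (metis Ln_of_nat of_nat_0_less_iff Nat.gr0I)
      moreover have "((\<lambda>s. of_nat m powr (- s)) has_field_derivative (Ln (of_nat m) * of_nat m powr (- s)) * (- 1)) (at s)"
        by (rule DERIV_chain2[where f = "\<lambda>z. of_nat m powr z" and g = uminus])
           (use False in \<open>auto intro!: has_field_derivative_powr_right derivative_eq_intros\<close>)
      ultimately show ?thesis by simp
    qed simp
    from DERIV_cmult[OF this, of "c m * (- of_real (ln (real m))) ^ k"]
    show "((\<lambda>s. dirichlet_term (\<lambda>m. c m * (- of_real (ln (real m))) ^ k) s m) has_field_derivative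
        dirichlet_term (\<lambda>m. c m * (- of_real (ln (real m))) ^ Suc k) s m) (at s)"
      by (simp add: mult_ac)
  qed
  then have "deriv (\<lambda>s. \<Sum>m<M. dirichlet_term (\<lambda>m. c m * (- of_real (ln (real m))) ^ k) s m)
      = (\<lambda>s. \<Sum>m<M. dirichlet_term (\<lambda>m. c m * (- of_real (ln (real m))) ^ Suc k) s m)"
    by (intro ext DERIV_imp_deriv)
  then show ?case by (simp only: funpow.simps o_apply Suc)
qed simp

text \<open>Landau's argument. Differentiating a Dirichlet series \<open>k\<close> times multiplies its coefficients by \<open>(- ln m)\<^sup>k\<close>, so
with nonnegative coefficients the \<open>k\<close>-th derivative at \<open>2\<close> has sign \<open>(-1)\<^sup>k\<close>. To the left of \<open>2\<close> all terms
of the Taylor series about \<open>2\<close> are therefore nonnegative, also outside the half-plane where the Dirichlet series is known to converge. Keeping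
the term of order zero gives the bound.\<close>
lemma nonneg_dirichlet_series_lower_bound:
  fixes c :: "nat \<Rightarrow> real"
  assumes c: "\<And>m. c m \<ge> 0" and summ: "\<And>s. Re s > 1 \<Longrightarrow> dirichlet_term (\<lambda>m. of_real (c m)) s summable_on UNIV"
    and H: "H holomorphic_on ball 2 (3 / 2)"
    and H_sums: "\<And>s. Re s > 1 \<Longrightarrow> s \<in> ball 2 (3/2) \<Longrightarrow> dirichlet_term (\<lambda>m. of_real (c m)) s sums H s"
    and x: "1 / 2 < x" "x < 2"
  shows "Re (H (of_real x)) \<ge> c 1"
proof -
  have powr_m2: "of_nat m powr (- 2) = complex_of_real (real m powr (- 2))" for m
    using powr_of_real[of "real m" "- 2"] by simp
  define P where "P M s = (\<Sum>m<M. dirichlet_term (\<lambda>m. of_real (c m)) s m)" for M s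
  have sum_real: "summable (\<lambda>m. c m * real m powr (- (3 / 2)))"
  proof -
    have "(\<lambda>m. norm (dirichlet_term (\<lambda>m. of_real (c m)) (3/2) m)) summable_on UNIV"
      using summ[of "3/2"] by (simp add: summable_on_iff_abs_summable_on_complex)
    then have "summable (\<lambda>m. norm (dirichlet_term (\<lambda>m. of_real (c m)) (3/2) m))"
      by (rule summable_on_imp_summable)
    moreover have "norm (dirichlet_term (\<lambda>m. of_real (c m)) (3/2) m) = c m * real m powr (- (3 / 2))" for m
      using c[of m] by (cases "m = 0") (auto simp: norm_mult norm_nat_powr)
    ultimately show ?thesis by simp
  qed
  have Re_near: "Re s > 3 / 2" "s \<in> ball 2 (3/2)" if "s \<in> ball 2 (1 / 2)" for s :: complex
  proof -
    have "norm (2 - s) < 1 / 2" using that by (simp add: dist_norm)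
    moreover have "\<bar>Re (2 - s)\<bar> \<le> norm (2 - s)" by (rule abs_Re_le_cmod)
    ultimately show "Re s > 3/2" "s \<in> ball 2 (3/2)" by (auto simp: dist_norm)
  qed
  have "uniform_limit (ball 2 (1/2)) P (\<lambda>s. \<Sum>m. dirichlet_term (\<lambda>m. of_real (c m)) s m) sequentially"
  unfolding P_def[abs_def]
  proof (rule Weierstrass_m_test[OF _ sum_real])
    fix m and s :: complex assume "s \<in> ball 2 (1/2)"
    then have "Re s > 3/2" by (rule Re_near)
    then show "norm (dirichlet_term (\<lambda>m. of_real (c m)) s m) \<le> c m * real m powr (- (3/2))"
      using c[of m] by (cases "m = 0") (auto simp: norm_mult norm_nat_powr intro!: mult_left_mono powr_mono)
  qed
  also have "?this \<longleftrightarrow> uniform_limit (ball 2 (1/2)) P H sequentially"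
  proof (rule uniform_limit_cong')
    fix s :: complex assume s: "s \<in> ball 2 (1/2)"
    have "dirichlet_term (\<lambda>m. of_real (c m)) s sums H s"
      by (rule H_sums) (use Re_near[OF s] in auto)
    then show "(\<Sum>m. dirichlet_term (\<lambda>m. of_real (c m)) s m) = H s" by (rule sums_unique[symmetric])
  qed simp
  finally have unif: "uniform_limit (ball 2 (1/2)) P H sequentially" .
  have P_hol: "P M holomorphic_on ball 2 (1/2)" for M
  proof -
    have "(\<lambda>s. of_nat m powr (- s) :: complex) holomorphic_on UNIV" for m
      by (cases "m = 0") (auto intro!: holomorphic_intros)
    then show ?thesis unfolding P_def
      by (intro holomorphic_on_sum holomorphic_on_mult holomorphic_on_const) (auto intro: holomorphic_on_subset)
  qed
  have deriv_lim: "(\<lambda>M. (deriv ^^ k) (P M) 2) \<longlonglongrightarrow> (deriv ^^ k) H 2" for k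
    by (rule higher_deriv_complex_uniform_limit[OF unif]) (auto simp: P_hol)
  have sign: "Re ((deriv ^^ k) H 2 * (-1) ^ k) \<ge> 0" for k
  proof (rule tendsto_lowerbound)
    show "(\<lambda>M. Re ((deriv ^^ k) (P M) 2 * (-1) ^ k)) \<longlonglongrightarrow> Re ((deriv ^^ k) H 2 * (-1) ^ k)"
      by (intro tendsto_intros deriv_lim)
    have "(deriv ^^ k) (P M) 2 * (-1) ^ k = of_real (\<Sum>m<M. c m * ln (real m) ^ k * real m powr (- 2))" for M
    proof -
      have "(deriv ^^ k) (P M) 2 * (-1) ^ k =
          (\<Sum>m<M. of_real (c m) * ((- of_real (ln (real m))) ^ k * (-1) ^ k) * of_nat m powr (- 2))"
        unfolding P_def[abs_def] higher_deriv_dirichlet_polynomial sum_distrib_right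
        by (intro sum.cong refl) (simp add: mult_ac)
      also have "\<dots> = (\<Sum>m<M. of_real (c m * ln (real m) ^ k * real m powr (- 2)))"
      proof (intro sum.cong refl)
        fix m
        have "(- complex_of_real (ln (real m))) ^ k * (-1) ^ k = of_real (ln (real m)) ^ k"
          by (simp flip: power_mult_distrib)
        then show "of_real (c m) * ((- of_real (ln (real m))) ^ k * (-1) ^ k) * of_nat m powr (- 2)
            = complex_of_real (c m * ln (real m) ^ k * real m powr (- 2))"
          by (simp only: powr_m2) simp
      qed
      finally show ?thesis by simp
    qed
    moreover have "(\<Sum>m<M. c m * ln (real m) ^ k * real m powr (- 2)) \<ge> 0" for M
    proof (intro sum_nonneg mult_nonneg_nonneg c)
      fix m :: nat show "ln (real m) ^ k \<ge> 0" by (cases "m = 0") auto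
    qed auto
    ultimately show "\<forall>\<^sub>F M in sequentially. 0 \<le> Re ((deriv ^^ k) (P M) 2 * (-1) ^ k)"
      by simp
  qed auto
  have x_ball: "of_real x \<in> ball (2 :: complex) (3/2)"
    using x dist_of_real[of 2 x, where 'a = complex] by (simp add: dist_real_def)
  define T where "T k = (deriv ^^ k) H 2 / fact k * (of_real x - 2) ^ k" for k
  have "T sums H (of_real x)"
    unfolding T_def by (rule holomorphic_power_series[OF H x_ball])
  then have T: "(\<lambda>k. Re (T k)) sums Re (H (of_real x))" by (simp add: sums_Re)
  have T_nonneg: "Re (T k) \<ge> 0" for k
  proof -
    have "T k = of_real ((2 - x) ^ k / fact k) * ((deriv ^^ k) H 2 * (-1) ^ k)"
    proof -
      have "(complex_of_real x - 2) ^ k = ((-1) * of_real (2 - x)) ^ k" by simp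
      also have "\<dots> = (-1) ^ k * of_real (2 - x) ^ k" by (rule power_mult_distrib)
      finally show ?thesis by (simp add: T_def)
    qed
    then have "Re (T k) = ((2 - x) ^ k / fact k) * Re ((deriv ^^ k) H 2 * (-1) ^ k)"
      by (simp only: Re_complex_of_real times_complex.sel Im_complex_of_real mult_zero_left diff_zero)
    then show ?thesis using sign[of k] x by simp
  qed
  have "c 1 \<le> Re (T 0)"
  proof -
    have "dirichlet_term (\<lambda>m. of_real (c m)) 2 sums H 2" by (rule H_sums) auto
    then have "(\<lambda>m. Re (dirichlet_term (\<lambda>m. of_real (c m)) 2 m)) sums Re (H 2)" by (rule sums_Re)
    moreover have "Re (dirichlet_term (\<lambda>m. of_real (c m)) 2 m) = c m * real m powr (- 2)" for m
    proof -
      show ?thesis by (simp only: powr_m2) simp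
    qed
    ultimately have "(\<lambda>m. c m * real m powr (- 2)) sums Re (H 2)" by (simp only:)
    then have "(\<Sum>m\<in>{1}. c m * real m powr (- 2)) \<le> Re (H 2)"
      by (intro sum_le_sums) (auto intro!: mult_nonneg_nonneg c)
    then show ?thesis by (simp add: T_def)
  qed
  also have "Re (T 0) \<le> Re (H (of_real x))"
    using sum_le_sums[OF _ _ T, of "{0}"] T_nonneg by simp
  finally show ?thesis .
qed

section \<open>Non-vanishing of odd L-functions on the closed half-plane\<close>

lemma holomorphic_on_substitute:
  assumes "f holomorphic_on S" "g holomorphic_on T" "\<And>z. z \<in> T \<Longrightarrow> g z \<in> S"
  shows "(\<lambda>z. f (g z)) holomorphic_on T"
  using holomorphic_on_compose_gen[OF assms(2,1)] assms(3) by (auto simp: o_def)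

lemma holomorphic_quotient_by_root:
  assumes "f holomorphic_on S" "open S" "f a = 0"
  obtains h where "h holomorphic_on S" "\<And>z. f z = (z - a) * h z" "h a = deriv f a"
proof
  show "(\<lambda>z. if z = a then deriv f a else (f z - f a) / (z - a)) holomorphic_on S"
    by (rule pole_lemma_open[OF assms(1,2)])
qed (use assms(3) in auto)

text \<open>The numbers \<open>1 + nk\<close> are coprime to \<open>n\<close>, and the sum of their reciprocals is comparable to the harmonic series.\<close>
lemma sum_principal_char_unbounded:
  assumes "n > 0"
  obtains M where "(\<Sum>m<M. Re (principal_char n m) / real m) > B"
proof -
  define N where "N = nat n"
  have N: "N > 0" using assms by (simp add: N_def)
  have div: "\<not> summable (\<lambda>k. inverse (real (Suc k)))"
    using not_summable_harmonic[where 'a = real] by (subst summable_Suc_iff[of "\<lambda>k. inverse (real k)"])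
  have "\<exists>K. (\<Sum>k<K. inverse (real (Suc k))) > B * N"
  proof (rule ccontr)
    assume "\<not> ?thesis"
    then have "summable (\<lambda>k. inverse (real (Suc k)))"
      by (intro summableI_nonneg_bounded[of _ "B * N"]) (auto simp: not_less simp del: of_nat_Suc)
    with div show False by contradiction
  qed
  then obtain K where K: "(\<Sum>k<K. inverse (real (Suc k))) > B * N" by blast
  have p: "principal_char n (1 + N * k) = 1" for k
  proof -
    have "coprime (1 + n * int k) n"
      by (metis coprime_1_left coprime_iff_gcd_eq_1 gcd_add_mult gcd.commute mult.commute add.commute)
    then show ?thesis using assms by (simp add: principal_char_def N_def)
  qed
  have "B < (\<Sum>k<K. inverse (real (Suc k))) / N" using K N by (simp add: field_simps)
  also have "\<dots> \<le> (\<Sum>k<K. Re (principal_char n (1 + N * k)) / real (1 + N * k))"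
    unfolding sum_divide_distrib
  proof (rule sum_mono)
    fix k
    have "real (1 + N * k) \<le> real N * real (Suc k)" using N by (simp add: algebra_simps)
    then show "inverse (real (Suc k)) / real N \<le> Re (principal_char n (1 + N * k)) / real (1 + N * k)"
      unfolding p using N by (simp add: field_simps del: of_nat_Suc of_nat_add of_nat_mult)
  qed
  also have "\<dots> = (\<Sum>m\<in>(\<lambda>k. 1 + N * k) ` {..<K}. Re (principal_char n m) / real m)"
    by (subst sum.reindex) (use N in \<open>auto simp: inj_on_def\<close>)
  also have "\<dots> \<le> (\<Sum>m<1 + N * K. Re (principal_char n m) / real m)"
    by (rule sum_mono2) (use N in \<open>auto simp: principal_char_def\<close>)
  finally show ?thesis by (rule that)
qed

text \<open>The zeros of \<open>1 - 2\<^sup>1\<^sup>-\<^sup>s\<close> are \<open>1 + 2\<pi>ik / ln 2\<close>; those with \<open>k \<noteq> 0\<close> lie outside the strip \<open>|Im s| < 2\<close>.\<close>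
lemma two_powr_neq_1:
  assumes "s \<noteq> 1" "\<bar>Im s\<bar> < 2"
  shows "(2 :: complex) powr (1 - s) \<noteq> 1"
proof
  assume "(2 :: complex) powr (1 - s) = 1"
  then have "exp ((1 - s) * of_real (ln 2)) = 1"
    by (simp add: powr_def Ln_of_real[of 2, simplified])
  then obtain k :: int where k: "(1 - Re s) * ln 2 = 0" "- Im s * ln 2 = of_int (2 * k) * pi"
    by (auto simp: exp_eq_1)
  have "\<bar>Im s * ln 2\<bar> \<le> \<bar>Im s\<bar> * 1"
    unfolding abs_mult using ln_2_less_1 by (intro mult_left_mono) auto
  then have "\<bar>of_int (2 * k) * pi\<bar> < 2" using assms(2) k(2) by (metis abs_minus_cancel minus_mult_left mult_1_right order_le_less_trans)
  then have "\<bar>of_int k * pi\<bar> < 1" by (simp add: abs_mult)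
  moreover have "\<bar>of_int k :: real\<bar> \<ge> 1" if "k \<noteq> 0" using that by linarith
  ultimately have "k = 0" using pi_gt3 mult_mono[of 1 "\<bar>of_int k :: real\<bar>" 1 pi] by (auto simp: abs_mult)
  then have "s = 1" using k by (simp add: complex_eq_iff)
  then show False using assms by simp
qed

lemma two_powr_neq_1_right:
  assumes "Re s > 1"
  shows "(2 :: complex) powr (1 - s) \<noteq> 1"
proof
  assume "(2 :: complex) powr (1 - s) = 1"
  then have "2 powr (1 - Re s) = (1 :: real)"
    using norm_powr_real_powr[of 2 "1 - s"] by simp
  then show False using assms by (simp add: powr_eq_one_iff)
qed

text \<open>To the right of the line the Moebius series inverts \<open>L\<close>. On the line \<open>Re s = 1\<close> put \<open>w = s - 1\<close> and twist \<open>\<psi>\<close> by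
\<open>m\<^sup>-\<^sup>w\<close>, which has modulus \<open>1\<close>. The functions \<open>A\<close>, \<open>B\<close> and \<open>q\<close> of the proof are \<open>L(z + w)\<close>, its conjugate counterpart and
\<open>1 - 2\<^sup>1\<^sup>-\<^sup>z\<close>, each divided by \<open>z - 1\<close>. So \<open>F = W\<^sup>2 A B / q\<^sup>2\<close> is holomorphic near \<open>[1/2, 2]\<close> and continues the product of the
squared principal series with the two twisted series. Dividing by the principal series at \<open>2z\<close> gives a function \<open>H\<close> that
continues a series of squares, so that \<open>H \<ge> 1\<close> on \<open>(1/2, 2)\<close>. This forces \<open>F\<close> to be
unbounded at \<open>1/2\<close>.\<close>
theorem odd_character_L_nonzero:
  assumes \<psi>: "dirichlet_character n \<psi>" "\<psi> (- 1) = - 1" and n: "n > 1"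
    and L: "L holomorphic_on {s. Re s > 0}" "\<And>s. Re s > 0 \<Longrightarrow> dirichlet_term (\<lambda>m. \<psi> (int m)) s sums L s"
    and s: "Re s \<ge> 1"
  shows "L s \<noteq> 0"
proof
  assume Ls: "L s = 0"
  note \<psi>' = dirichlet_characterD[OF \<psi>(1)]
  have n0: "n > 0" using n by simp
  have norm_\<psi>: "norm (\<psi> x) \<le> 1" for x
    using norm_dirichlet_character[OF \<psi>(1) n0] by simp
  have L_eq_sum: "L w = dirichlet_sum (\<lambda>m. \<psi> (int m)) w" if "Re w > 1" for w
  proof -
    have "(\<lambda>m. norm (dirichlet_term (\<lambda>m. \<psi> (int m)) w m)) summable_on UNIV"
      by (rule summable_dirichlet_term[OF _ that]) (rule norm_\<psi>)
    then show ?thesis using dirichlet_sum_sums(2) L(2)[of w] that sums_unique2 by fastforce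
  qed
  show False
  proof (cases "Re s > 1")
    case True
    have "dirichlet_sum (\<lambda>m. of_int (moebius_mu m) * \<psi> (int m)) s * dirichlet_sum (\<lambda>m. \<psi> (int m)) s = 1"
      by (rule completely_multiplicative_moebius_inverse) (use True norm_\<psi> \<psi>' in auto)
    then show False using Ls L_eq_sum[OF True] by simp
  next
    case False
    define w where "w = s - 1"
    have w: "s = 1 + w" "Re w = 0" using s False by (auto simp: w_def)
    have w_cnj: "cnj w = - w" using w(2) by (simp add: complex_eq_iff)
    define g where "g m = \<psi> (int m) * of_nat m powr (- w)" for m
    have g_mult: "g (m * k) = g m * g k" for m k
      by (simp add: g_def \<psi>' of_nat_mult_powr del: of_nat_mult) (simp add: \<psi>')
    have p: "principal_char n 0 = 0" using n by (auto simp: principal_char_def)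
    have g_norm: "g m * cnj (g m) = principal_char n m" for m
    proof (cases "m = 0")
      case False
      then have "norm (g m) = norm (\<psi> (int m))"
        using w by (simp add: g_def norm_mult norm_nat_powr)
      then show ?thesis using norm_dirichlet_character[OF \<psi>(1) n0, of "int m"]
        by (simp add: complex_norm_square[symmetric] principal_char_def)
    qed (simp add: g_def p)
    have g_cnj: "cnj (g m) = cnj (\<psi> (int m)) * of_nat m powr w" for m
      by (cases "m = 0") (simp_all add: g_def cnj_powr w_cnj)
    have norm_g: "norm (g m) \<le> 1" if "m > 0" for m
      using that w norm_\<psi>[of "int m"] by (simp add: g_def norm_mult norm_nat_powr)
    \<comment> \<open>The conjugate character has its own continuation \<open>L'\<close>, which vanishes at the conjugate point \<open>1 - w\<close>.\<close>
    have odd: "\<psi> (- x) = - \<psi> x" for x using \<psi>'(2)[of "-1" x] \<psi>(2) by simp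
    obtain L' where L': "L' holomorphic_on {s. Re s > 0}"
      "\<And>s. Re s > 0 \<Longrightarrow> dirichlet_term (\<lambda>m. cnj (\<psi> (int m))) s sums L' s"
      using odd_periodic_dirichlet_series[of n "\<lambda>x. cnj (\<psi> x)"] \<psi>'(1) odd n0
      by (auto simp: periodic_def)
    have L's: "L' (1 - w) = 0"
    proof -
      have "(\<lambda>m. cnj (dirichlet_term (\<lambda>m. \<psi> (int m)) (1 + w) m)) sums cnj (L (1 + w))"
        unfolding sums_cnj using L(2)[of "1 + w"] w by simp
      moreover have "cnj (dirichlet_term (\<lambda>m. \<psi> (int m)) (1 + w) m) = dirichlet_term (\<lambda>m. cnj (\<psi> (int m))) (1 - w) m" for m
        by (cases "m = 0") (simp_all add: cnj_powr w_cnj)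
      ultimately have "dirichlet_term (\<lambda>m. cnj (\<psi> (int m))) (1 - w) sums cnj (L (1 + w))"
        by (simp only:)
      moreover have "dirichlet_term (\<lambda>m. cnj (\<psi> (int m))) (1 - w) sums L' (1 - w)"
        by (rule L'(2)) (use w in simp)
      ultimately have "L' (1 - w) = cnj (L (1 + w))" by (simp only: sums_unique2)
      then show ?thesis using Ls w by simp
    qed
    define \<Omega> where "\<Omega> = {s. Re s > 0}"
    have \<Omega>: "open \<Omega>" by (simp add: \<Omega>_def open_halfspace_Re_gt)
    have hol_A: "(\<lambda>s. L (s + w)) holomorphic_on \<Omega>"
      by (rule holomorphic_on_substitute[OF L(1)]) (use w in \<open>auto simp: \<Omega>_def intro!: holomorphic_intros\<close>)
    have hol_B: "(\<lambda>s. L' (s - w)) holomorphic_on \<Omega>"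
      by (rule holomorphic_on_substitute[OF L'(1)]) (use w in \<open>auto simp: \<Omega>_def intro!: holomorphic_intros\<close>)
    obtain A where A: "A holomorphic_on \<Omega>" "\<And>s. L (s + w) = (s - 1) * A s"
      using holomorphic_quotient_by_root[OF hol_A \<Omega>, of 1] Ls w by auto
    obtain B where B: "B holomorphic_on \<Omega>" "\<And>s. L' (s - w) = (s - 1) * B s"
      using holomorphic_quotient_by_root[OF hol_B \<Omega>, of 1] L's by auto
    have q_deriv: "((\<lambda>s. 1 - 2 powr (1 - s)) has_field_derivative Ln 2) (at (1::complex))"
    proof -
      have "((\<lambda>s. 2 powr (1 - s)) has_field_derivative (Ln 2 * 2 powr (1 - 1)) * (- 1)) (at (1::complex))"
        by (rule DERIV_chain2[where f = "\<lambda>z. 2 powr z" and g = "\<lambda>s. 1 - s"])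
           (auto intro!: has_field_derivative_powr_right derivative_eq_intros)
      from DERIV_diff[OF DERIV_const[of 1] this] show ?thesis by simp
    qed
    have "(\<lambda>s. 1 - 2 powr (1 - s) :: complex) holomorphic_on \<Omega>"
      by (intro holomorphic_intros) auto
    then obtain q where q: "q holomorphic_on \<Omega>" "\<And>s. 1 - 2 powr (1 - s) = (s - 1) * q s"
      "q 1 = deriv (\<lambda>s. 1 - 2 powr (1 - s)) 1"
      using holomorphic_quotient_by_root[of "\<lambda>s. 1 - 2 powr (1 - s) :: complex" \<Omega> 1] \<Omega> by auto
    have q_nz: "q s \<noteq> 0" if "\<bar>Im s\<bar> < 2" for s
    proof (cases "s = 1")
      case True
      then show ?thesis using q(3) DERIV_imp_deriv[OF q_deriv] by simp
    next
      case False
      then show ?thesis using q(2)[of s] two_powr_neq_1[OF False that] by auto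
    qed
    obtain W where W: "W holomorphic_on \<Omega>"
      "\<And>s. Re s > 1 \<Longrightarrow> W s = (1 - 2 powr (1 - s)) * dirichlet_sum (principal_char n) s"
      using alternating_principal_series[OF n0] unfolding \<Omega>_def by blast
    define Z where "Z = dirichlet_sum (principal_char n)"
    have Z_nz: "Z s \<noteq> 0" if "Re s > 1" for s
    proof
      assume "Z s = 0"
      moreover have "dirichlet_sum (\<lambda>m. of_int (moebius_mu m) * principal_char n m) s * Z s = 1"
        unfolding Z_def by (rule completely_multiplicative_moebius_inverse) (use that principal_char_simps in auto)
      ultimately show False by simp
    qed
    define F where "F s = W s ^ 2 * A s * B s / q s ^ 2" for s
    \<comment> \<open>The factor after \<open>F s\<close> is the reciprocal of the principal series at \<open>2 s\<close>.\<close>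
    define H where "H s = F s * (1 - 2 powr (1 - 2 * s)) / W (2 * s)" for s
    have F_eq: "F s = Z s ^ 2 * (L (s + w) * L' (s - w))" if "Re s > 1" "\<bar>Im s\<bar> < 2" for s
    proof -
      have "s \<noteq> 1" using that by auto
      then show ?thesis using q_nz[OF that(2)]
        unfolding F_def W(2)[OF that(1)] A(2) B(2) q(2) Z_def by (simp add: field_simps power2_eq_square)
    qed
    define D where "D = {s. Re s > 0 \<and> \<bar>Im s\<bar> < 2}"
    have F_hol: "F holomorphic_on D"
      unfolding F_def using W(1) A(1) B(1) q(1) q_nz
      by (intro holomorphic_intros) (auto simp: D_def \<Omega>_def elim: holomorphic_on_subset)
    have ball: "Re s > 1 / 2" "\<bar>Im s\<bar> < 2" if "s \<in> ball 2 (3/2)" for s :: complex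
    proof -
      have "norm (2 - s) < 3 / 2" using that by (simp add: dist_norm)
      moreover have "\<bar>Re (2 - s)\<bar> \<le> norm (2 - s)" "\<bar>Im (2 - s)\<bar> \<le> norm (2 - s)"
        by (rule abs_Re_le_cmod abs_Im_le_cmod)+
      ultimately show "Re s > 1/2" "\<bar>Im s\<bar> < 2" by auto
    qed
    have W2_nz: "W (2 * s) \<noteq> 0" if "Re s > 1 / 2" for s
      using W(2)[of "2 * s"] Z_nz[of "2 * s"] two_powr_neq_1_right[of "2 * s"] that by (simp add: Z_def)
    have H_eq: "H s = F s / Z (2 * s)" if "Re s > 1 / 2" for s
    proof -
      have r: "Re (2 * s) > 1" using that by simp
      then have "1 - 2 powr (1 - 2 * s) \<noteq> (0 :: complex)"
        using two_powr_neq_1_right[of "2 * s"] by simp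
      then show ?thesis unfolding H_def W(2)[OF r] Z_def by simp
    qed
    have H_hol: "H holomorphic_on ball 2 (3/2)"
    proof -
      have "(\<lambda>s. W (2 * s)) holomorphic_on ball 2 (3/2)"
        by (rule holomorphic_on_substitute[OF W(1)]) (use ball(1) in \<open>force simp: \<Omega>_def intro!: holomorphic_intros\<close>)+
      moreover have "F holomorphic_on ball 2 (3/2)"
        by (rule holomorphic_on_subset[OF F_hol]) (use ball in \<open>fastforce simp: D_def\<close>)
      ultimately show ?thesis
        unfolding H_def using W2_nz ball(1) by (intro holomorphic_intros) auto
    qed
    define c where "c m = Re (principal_char n m) * (norm (\<Sum>d | d dvd m. g d))\<^sup>2" for m
    have c_eq: "complex_of_real (c m) = principal_char n m * ((\<Sum>d | d dvd m. g d) * cnj (\<Sum>d | d dvd m. g d))" for m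
      unfolding complex_norm_square[symmetric] by (simp add: c_def principal_char_def)
    have g1: "g 1 = 1" by (simp add: g_def \<psi>')
    have "{d::nat. d dvd 1} = {1}" by auto
    then have c1: "c 1 = 1" using g1 principal_char_simps(3)[of n] by (simp add: c_def)
    have squares: "(dirichlet_term (\<lambda>m. of_real (c m)) s has_sum F s / Z (2 * s)) UNIV" if "Re s > 1" "\<bar>Im s\<bar> < 2" for s
    proof -
      have rs: "Re s > 1" using that by simp
      obtain D where D: "(dirichlet_term (\<lambda>m. of_real (c m)) s has_sum D) UNIV"
        "dirichlet_sum (principal_char n) (2 * s) * D = dirichlet_sum (principal_char n) s ^ 2 *
          (dirichlet_sum g s * dirichlet_sum (\<lambda>m. cnj (g m)) s)"
        unfolding c_eq using square_divisor_sum_identity[OF g_mult g_norm rs] by blast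
      have "dirichlet_sum g s = L (s + w)"
      proof -
        have "dirichlet_term g s = dirichlet_term (\<lambda>m. \<psi> (int m)) (s + w)"
          by (auto simp: g_def fun_eq_iff mult.assoc powr_dirichlet_twist)
        then show ?thesis using L_eq_sum[of "s + w"] that w by (simp add: dirichlet_sum_def)
      qed
      moreover have "dirichlet_sum (\<lambda>m. cnj (g m)) s = L' (s - w)"
      proof -
        have eq: "dirichlet_term (\<lambda>m. cnj (g m)) s = dirichlet_term (\<lambda>m. cnj (\<psi> (int m))) (s - w)"
          using powr_dirichlet_twist[of _ "-w" s] by (auto simp: g_cnj fun_eq_iff mult.assoc)
        have "dirichlet_term (\<lambda>m. cnj (\<psi> (int m))) (s - w) sums L' (s - w)"
          by (rule L') (use that w in auto)
        moreover have "(\<lambda>m. norm (dirichlet_term (\<lambda>m. cnj (\<psi> (int m))) (s - w) m)) summable_on UNIV"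
          by (rule summable_dirichlet_term[of _ 1]) (use that w norm_\<psi> in auto)
        ultimately have "dirichlet_sum (\<lambda>m. cnj (\<psi> (int m))) (s - w) = L' (s - w)"
          by (intro dirichlet_sum_eqI)
        then show ?thesis unfolding dirichlet_sum_def eq .
      qed
      ultimately have "Z (2 * s) * D = F s" using D(2) F_eq[OF that] by (simp add: Z_def)
      then have "D = F s / Z (2 * s)" using Z_nz[of "2 * s"] that by (auto simp: field_simps)
      then show ?thesis using D(1) by simp
    qed
    have H_ge: "Re (H (of_real x)) \<ge> 1" if "1/2 < x" "x < 2" for x
    proof -
      have summ: "dirichlet_term (\<lambda>m. of_real (c m)) s summable_on UNIV" if "Re s > 1" for s
      proof -
        have "dirichlet_term (\<lambda>m. of_real (c m)) (of_real (Re s)) summable_on UNIV"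
          using squares[of "of_real (Re s)"] that has_sum_imp_summable by auto
        then have "(\<lambda>m. norm (dirichlet_term (\<lambda>m. of_real (c m)) (of_real (Re s)) m)) summable_on UNIV"
          by (simp add: summable_on_iff_abs_summable_on_complex)
        also have "(\<lambda>m. norm (dirichlet_term (\<lambda>m. of_real (c m)) (of_real (Re s)) m)) = (\<lambda>m. norm (dirichlet_term (\<lambda>m. of_real (c m)) s m))"
        proof
          fix m show "norm (dirichlet_term (\<lambda>m. of_real (c m)) (of_real (Re s)) m) = norm (dirichlet_term (\<lambda>m. of_real (c m)) s m)"
            by (cases "m = 0") (simp_all add: norm_mult norm_nat_powr)
        qed
        finally show ?thesis by (rule abs_summable_summable)
      qed
      have "c 1 \<le> Re (H (of_real x))"
      proof (rule nonneg_dirichlet_series_lower_bound[OF _ summ H_hol _ that])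
        show "c m \<ge> 0" for m by (simp add: c_def principal_char_def)
        show "dirichlet_term (\<lambda>m. of_real (c m)) s sums H s" if "Re s > 1" "s \<in> ball 2 (3/2)" for s
          using squares[OF that(1) ball(2)[OF that(2)]] H_eq[of s] that(1) by (auto intro: has_sum_imp_sums)
      qed auto
      then show ?thesis by (simp only: c1)
    qed
    have F_ge: "Re (F (of_real x)) \<ge> (\<Sum>m<M. Re (principal_char n m) * real m powr (- 2 * x))"
      if x: "1/2 < x" "x < 2" for x M
    proof -
      define z where "z m = Re (principal_char n m) * real m powr (- 2 * x)" for m
      have z: "dirichlet_term (principal_char n) (2 * of_real x) m = of_real (z m)" for m
      proof -
        have "of_nat m powr (- (2 * of_real x)) = complex_of_real (real m powr (- 2 * x))"
          using powr_of_real[of "real m" "- 2 * x"] by simp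
        then show ?thesis by (simp add: z_def principal_char_def)
      qed
      have "(\<lambda>m. norm (dirichlet_term (principal_char n) (2 * of_real x) m)) summable_on UNIV"
        by (rule summable_dirichlet_term[of _ 1]) (use x principal_char_simps in auto)
      from dirichlet_sum_sums(2)[OF this] have Z_sums: "(\<lambda>m. complex_of_real (z m)) sums Z (2 * of_real x)"
        unfolding z Z_def .
      then have Zz: "z sums Re (Z (2 * of_real x))" "(\<lambda>m. 0) sums Im (Z (2 * of_real x))"
        using sums_Re[OF Z_sums] sums_Im[OF Z_sums] by simp_all
      then have Z_real: "Z (2 * of_real x) = of_real (Re (Z (2 * of_real x)))"
        by (simp add: complex_eq_iff sums_unique2[OF Zz(2) sums_zero])
      have le: "(\<Sum>m<M. z m) \<le> Re (Z (2 * of_real x))"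
        by (rule sum_le_sums[OF _ _ Zz(1)]) (auto simp: z_def principal_char_def)
      have "Re (Z (2 * of_real x)) \<ge> 0"
        using sum_le_sums[OF _ _ Zz(1), of "{}"] by (simp add: z_def principal_char_def)
      have "F (of_real x) = H (of_real x) * of_real (Re (Z (2 * of_real x)))"
        unfolding Z_real[symmetric] using H_eq[of "of_real x"] Z_nz[of "2 * of_real x"] x by simp
      then have "Re (F (of_real x)) = Re (H (of_real x)) * Re (Z (2 * of_real x))" by simp
      also have "\<dots> \<ge> 1 * Re (Z (2 * of_real x))"
        using H_ge[OF x] \<open>Re (Z (2 * of_real x)) \<ge> 0\<close> by (intro mult_right_mono)
      finally show ?thesis using le unfolding z_def by simp
    qed
    have "Re (F (1/2)) \<ge> (\<Sum>m<M. Re (principal_char n m) / real m)" for M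
    proof (rule tendsto_le)
      have "isCont F (1/2)"
      proof -
        have "open D" unfolding D_def
          by (intro open_Collect_conj open_Collect_less continuous_intros)
        moreover have "(1/2) \<in> D" by (simp add: D_def)
        ultimately show ?thesis
          using F_hol holomorphic_on_imp_continuous_on continuous_on_eq_continuous_at by blast
      qed
      moreover have "((\<lambda>x. complex_of_real x) \<longlongrightarrow> 1/2) (at_right (1/2))"
        using tendsto_of_real[OF tendsto_ident_at[of "1/2::real" "{1/2<..}"], where 'a = complex] by simp
      ultimately have "((\<lambda>x. F (of_real x)) \<longlongrightarrow> F (1/2)) (at_right (1/2))"
        by (rule isCont_tendsto_compose)
      then show "((\<lambda>x. Re (F (of_real x))) \<longlongrightarrow> Re (F (1/2))) (at_right (1/2))"
        by (intro tendsto_intros)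
      have "((\<lambda>x. \<Sum>m<M. Re (principal_char n m) * real m powr (- 2 * x)) \<longlongrightarrow>
          (\<Sum>m<M. Re (principal_char n m) * real m powr (- 2 * (1/2)))) (at_right (1/2))"
      proof (rule tendsto_sum)
        fix m
        show "((\<lambda>x. Re (principal_char n m) * real m powr (- 2 * x)) \<longlongrightarrow>
          Re (principal_char n m) * real m powr (- 2 * (1/2))) (at_right (1/2))"
        proof (cases "m = 0")
          case False
          then show ?thesis by (intro tendsto_intros) auto
        qed simp
      qed
      also have "(\<Sum>m<M. Re (principal_char n m) * real m powr (- 2 * (1/2))) = (\<Sum>m<M. Re (principal_char n m) / real m)"
      proof (rule sum.cong)
        fix m show "Re (principal_char n m) * real m powr (- 2 * (1/2)) = Re (principal_char n m) / real m"
          by (cases "m = 0") (simp_all add: powr_minus field_simps)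
      qed auto
      finally show "((\<lambda>x. \<Sum>m<M. Re (principal_char n m) * real m powr (- 2 * x)) \<longlongrightarrow>
          (\<Sum>m<M. Re (principal_char n m) / real m)) (at_right (1/2))" .
      show "\<forall>\<^sub>F x in at_right (1/2). (\<Sum>m<M. Re (principal_char n m) * real m powr (- 2 * x)) \<le> Re (F (of_real x))"
      proof -
        have "\<forall>\<^sub>F x in at_right (1/2). x \<in> {1/2<..<2::real}"
          by (rule eventually_at_right_real) simp
        then show ?thesis by eventually_elim (use F_ge in auto)
      qed
    qed auto
    then show False using sum_principal_char_unbounded[OF n0, of "Re (F (1/2))"] by (meson not_le)
  qed
qed

section \<open>Cotangent derivatives as Dirichlet series\<close>

text \<open>The logarithmic derivative of the reflection formula for the Gamma function.\<close>
lemma cot_eq_Digamma: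
  fixes x :: real
  assumes "0 < x" "x < 1"
  shows "pi * cot (pi * x) = Digamma (1 - x) - Digamma x"
proof -
  have eq: "Gamma y * Gamma (1 - y) * sin (pi * y) = pi" if "0 < y" "y < 1" for y :: real
  proof -
    have "complex_of_real (Gamma y * Gamma (1 - y)) = Gamma (of_real y) * Gamma (1 - of_real y)"
      using Gamma_complex_of_real[of y] Gamma_complex_of_real[of "1 - y"] by simp
    also have "\<dots> = of_real pi / sin (of_real pi * of_real y)"
      by (rule Gamma_reflection_complex)
    also have "\<dots> = complex_of_real (pi / sin (pi * y))"
      using sin_of_real[of "pi * y", where 'a = complex] by simp
    finally have "Gamma y * Gamma (1 - y) = pi / sin (pi * y)" by (simp only: of_real_eq_iff)
    moreover have "sin (pi * y) > 0" using that by (intro sin_gt_zero) auto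
    ultimately show ?thesis by simp
  qed
  have nz: "Gamma x \<noteq> 0" "Gamma (1 - x) \<noteq> 0" "sin (pi * x) > 0"
    using assms Gamma_real_pos[THEN less_imp_neq, of x] Gamma_real_pos[THEN less_imp_neq, of "1 - x"]
      sin_gt_zero[of "pi * x"] by auto
  have "((\<lambda>y. Gamma y * Gamma (1 - y) * sin (pi * y)) has_real_derivative
      Gamma x * Gamma (1 - x) * ((Digamma x - Digamma (1 - x)) * sin (pi * x) + pi * cos (pi * x))) (at x)"
    using assms by (auto intro!: derivative_eq_intros simp: nonpos_Ints_def algebra_simps)
  moreover have "((\<lambda>y. Gamma y * Gamma (1 - y) * sin (pi * y)) has_real_derivative 0) (at x)"
  proof (rule has_field_derivative_transform_within_open[of "\<lambda>_. pi" _ _ "{0<..<1}"])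
    show "((\<lambda>_. pi) has_real_derivative 0) (at x)" by simp
  qed (use assms eq in auto)
  ultimately have "Gamma x * Gamma (1 - x) * ((Digamma x - Digamma (1 - x)) * sin (pi * x) + pi * cos (pi * x)) = 0"
    using DERIV_unique by blast
  then have "(Digamma x - Digamma (1 - x)) * sin (pi * x) + pi * cos (pi * x) = 0" using nz by simp
  then show ?thesis using nz by (simp add: cot_def field_simps)
qed

lemma higher_deriv_cot:
  fixes x :: real
  assumes "0 < x" "x < 1"
  shows "pi ^ Suc k * (deriv ^^ k) cot (pi * x) = (- 1) ^ k * Polygamma k (1 - x) - Polygamma k x"
  using assms
proof (induction k arbitrary: x)
  case 0
  then show ?case using cot_eq_Digamma[of x] by simp
next
  case (Suc k)
  define G where "G y = ((- 1) ^ k * Polygamma k (1 - y / pi) - Polygamma k (y / pi)) / pi ^ Suc k" for y :: real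
  have G_eq: "(deriv ^^ k) cot y = G y" if "y \<in> {0<..<pi}" for y
  proof -
    have "pi ^ Suc k * (deriv ^^ k) cot (pi * (y / pi)) = (- 1) ^ k * Polygamma k (1 - y / pi) - Polygamma k (y / pi)"
      by (rule Suc.IH) (use that in auto)
    then show ?thesis by (simp add: G_def field_simps)
  qed
  have "(G has_real_derivative
      ((- 1) ^ Suc k * Polygamma (Suc k) (1 - x) - Polygamma (Suc k) x) / pi ^ Suc (Suc k)) (at (pi * x))"
    unfolding G_def using Suc.prems
    by (auto intro!: derivative_eq_intros simp: nonpos_Ints_def field_simps) (simp add: diff_divide_distrib)
  then have "((deriv ^^ k) cot has_real_derivative
      ((- 1) ^ Suc k * Polygamma (Suc k) (1 - x) - Polygamma (Suc k) x) / pi ^ Suc (Suc k)) (at (pi * x))"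
    by (rule has_field_derivative_transform_within_open[of _ _ _ "{0<..<pi}"]) (use Suc.prems G_eq in auto)
  then have "(deriv ^^ Suc k) cot (pi * x) =
      ((- 1) ^ Suc k * Polygamma (Suc k) (1 - x) - Polygamma (Suc k) x) / pi ^ Suc (Suc k)"
    by (simp add: DERIV_imp_deriv)
  then show ?case by simp
qed

lemma higher_deriv_cot_periodic:
  "(deriv ^^ k) cot (x + pi * of_int m) = (deriv ^^ k) (cot :: real \<Rightarrow> real) x"
proof (induction k arbitrary: x)
  case 0
  show ?case by (simp add: cot_def sin_add cos_add) 
next
  case (Suc k)
  have eq: "(deriv ^^ k) cot = (\<lambda>y. (deriv ^^ k) (cot :: real \<Rightarrow> real) (y + pi * of_int m))"
    using Suc by auto
  have "((deriv ^^ k) cot has_real_derivative D) (at x) \<longleftrightarrow> ((deriv ^^ k) cot has_real_derivative D) (at (x + pi * of_int m))" for D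
    by (subst (1) eq) (simp only: DERIV_shift)
  then have "deriv ((deriv ^^ k) cot) (x + pi * of_int m) = deriv ((deriv ^^ k) (cot :: real \<Rightarrow> real)) x"
    unfolding deriv_def[of "(deriv ^^ k) cot"] by (simp only:)
  then show ?case by simp
qed

text \<open>The partial fraction expansion of the cotangent and its derivatives, with the poles paired as \<open>-k\<close> and \<open>k + 1\<close>. The
pairing is what makes the series converge for \<open>m = 0\<close>.\<close>
lemma higher_deriv_cot_sums:
  fixes x :: real
  assumes x: "0 < x" "x < 1"
  shows "(\<lambda>k. inverse ((x + real k) ^ Suc m) + (- 1) ^ Suc m * inverse ((1 - x + real k) ^ Suc m))
    sums ((- 1) ^ m * pi ^ Suc m / fact m * (deriv ^^ m) cot (pi * x))"
proof (cases "m = 0")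
  case True
  have "(\<lambda>k. inverse (of_nat (Suc k)) - inverse (z + of_nat k)) sums (Digamma z + euler_mascheroni)"
    if "z > 0" for z :: real
    using summable_Digamma[of z] that by (simp add: Digamma_def summable_sums)
  from sums_diff[OF this[of "1 - x"] this[of x]] show ?thesis
    using x True cot_eq_Digamma[OF x] by simp
next
  case False
  have "(\<lambda>k. inverse ((z + real k) ^ Suc m)) sums ((- 1) ^ Suc m * Polygamma m z / fact m)"
    if "z > 0" for z :: real
  proof -
    have "(- 1) ^ Suc m * Polygamma m z / fact m = (\<Sum>k. inverse ((z + real k) ^ Suc m))"
      using False by (simp add: Polygamma_def flip: power_mult_distrib)
    then show ?thesis
      using Polygamma_converges'[of z "Suc m"] that False by (simp add: summable_sums)
  qed
  from sums_add[OF this[of x] sums_mult[OF this[of "1 - x"], of "(- 1) ^ Suc m"]]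
  have "(\<lambda>k. inverse ((x + real k) ^ Suc m) + (- 1) ^ Suc m * inverse ((1 - x + real k) ^ Suc m))
    sums ((- 1) ^ Suc m * Polygamma m x / fact m + (- 1) ^ Suc m * ((- 1) ^ Suc m * Polygamma m (1 - x) / fact m))"
    using x by simp
  also have "(- 1) ^ Suc m * Polygamma m x / fact m + (- 1) ^ Suc m * ((- 1) ^ Suc m * Polygamma m (1 - x) / fact m)
      = (- 1) ^ m * ((- 1) ^ m * Polygamma m (1 - x) - Polygamma m x) / fact m"
    by (simp add: field_simps)
  also have "\<dots> = (- 1) ^ m * pi ^ Suc m / fact m * (deriv ^^ m) cot (pi * x)"
    unfolding higher_deriv_cot[OF x, symmetric] by simp
  finally show ?thesis .
qed

text \<open>The indicator of the class of \<open>j\<close>, made even or odd according to the parity of \<open>r\<close>. A sum over all integers congruent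
to \<open>j\<close> of a function of parity \<open>(-1)\<^sup>r\<close> is a sum over positive integers weighted with this function.\<close>
definition parity_class :: "nat \<Rightarrow> int \<Rightarrow> int \<Rightarrow> int \<Rightarrow> real" where
  "parity_class r n j m = of_bool ([m = j] (mod n)) + (- 1) ^ r * of_bool ([m = - j] (mod n))"

text \<open>Let \<open>a\<close> be the residue of \<open>j\<close> in \<open>(0, n)\<close>. In the block from \<open>nk\<close> to \<open>n(k+1)\<close> only \<open>nk + a\<close> and \<open>n(k+1) - a\<close> have nonzero
weight, and the two terms are the \<open>k\<close>-th paired term of the partial fraction expansion at \<open>a/n\<close>. Grouping
into blocks does not change the sum.\<close>
lemma cot_dirichlet_series:
  fixes n j :: int
  assumes n: "n > 0" and j: "\<not> n dvd j"
    and L: "(\<lambda>m. parity_class (Suc r) n j (int m) / real m ^ Suc r) sums L"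
  shows "(deriv ^^ r) cot (pi * real_of_int j / real_of_int n) = (- 1) ^ r * fact r * n ^ Suc r / pi ^ Suc r * L"
proof -
  define a where "a = nat (j mod n)"
  define N where "N = nat n"
  have N: "int N = n" "N > 0" using n by (auto simp: N_def)
  have a: "int a = j mod n" using n by (simp add: a_def)
  have "j mod n > 0" using n j by (metis dvd_eq_mod_eq_0 pos_mod_sign order_le_less)
  moreover have "j mod n < n" using n by simp
  ultimately have a_bounds: "0 < a" "a < N" using a N by linarith+
  define x where "x = real a / real N"
  have x: "0 < x" "x < 1" using a_bounds by (auto simp: x_def)
  define f where "f m = parity_class (Suc r) n j (int m) / real m ^ Suc r" for m
  have cong_a: "[int m = j] (mod n) \<longleftrightarrow> m mod N = a" for m
    using a N by (auto simp: Cong.cong_def simp flip: zmod_int)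
  have cong_ma: "[int m = - j] (mod n) \<longleftrightarrow> m mod N = N - a" for m
  proof -
    have "(- j) mod n = n - j mod n" using \<open>j mod n > 0\<close> by (simp add: zmod_zminus1_eq_if)
    then have "(- j) mod n = int (N - a)" using a N a_bounds by (simp add: of_nat_diff)
    then show ?thesis using N by (auto simp: Cong.cong_def simp flip: zmod_int)
  qed
  have block: "(\<Sum>m=N * k..<N * Suc k. f m) =
      inverse ((real N * (x + real k)) ^ Suc r) + (- 1) ^ Suc r * inverse ((real N * (1 - x + real k)) ^ Suc r)" for k
  proof -
    have "(\<Sum>m=N * k..<N * Suc k. f m) = (\<Sum>i<N. f (i + N * k))"
      using sum.shift_bounds_nat_ivl[of f 0 "N * k" N] by (simp add: lessThan_atLeast0 add.commute)
    also have "\<dots> = (\<Sum>i<N. of_bool (i = a) / real (i + N * k) ^ Suc r) + (\<Sum>i<N. (- 1) ^ Suc r * (of_bool (i = N - a) / real (i + N * k) ^ Suc r))"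
      unfolding sum.distrib[symmetric]
      by (intro sum.cong refl) (simp add: f_def parity_class_def cong_a cong_ma add_divide_distrib diff_divide_distrib del: of_nat_add)
    also have "(\<Sum>i<N. of_bool (i = a) / real (i + N * k) ^ Suc r) = 1 / real (a + N * k) ^ Suc r"
      using a_bounds by (subst sum.mono_neutral_right[of _ "{a}"]) auto
    also have "(\<Sum>i<N. (- 1) ^ Suc r * (of_bool (i = N - a) / real (i + N * k) ^ Suc r)) = (- 1) ^ Suc r / real (N - a + N * k) ^ Suc r"
      using a_bounds by (subst sum.mono_neutral_right[of _ "{N - a}"]) auto
    also have "real (a + N * k) = real N * (x + real k)" using N by (simp add: x_def field_simps)
    also have "real (N - a + N * k) = real N * (1 - x + real k)"
      using N a_bounds by (simp add: x_def field_simps of_nat_diff)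
    finally show ?thesis by (simp add: divide_inverse)
  qed
  have "(\<lambda>k. \<Sum>m<N * k. f m) \<longlonglongrightarrow> L"
  proof -
    have "filterlim (\<lambda>k. N * k) sequentially sequentially"
      using N by (intro filterlim_subseq) (simp add: strict_mono_def)
    then show ?thesis
      using L unfolding sums_def f_def[symmetric] by (rule filterlim_compose[rotated])
  qed
  moreover have "(\<Sum>m<N * k. f m) = (\<Sum>i<k. \<Sum>m=N * i..<N * Suc i. f m)" for k
  proof (induction k)
    case (Suc k)
    have "(\<Sum>m<N * Suc k. f m) = (\<Sum>m<N * k. f m) + (\<Sum>m=N * k..<N * Suc k. f m)"
      using sum.atLeastLessThan_concat[of 0 "N * k" "N * Suc k" f] by (simp add: lessThan_atLeast0)
    then show ?case using Suc by simp
  qed simp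
  ultimately have "(\<lambda>k. \<Sum>m=N * k..<N * Suc k. f m) sums L" by (simp add: sums_def)
  then have "(\<lambda>k. real N ^ Suc r * (\<Sum>m=N * k..<N * Suc k. f m)) sums (real N ^ Suc r * L)"
    by (rule sums_mult)
  also have "(\<lambda>k. real N ^ Suc r * (\<Sum>m=N * k..<N * Suc k. f m)) =
      (\<lambda>k. inverse ((x + real k) ^ Suc r) + (- 1) ^ Suc r * inverse ((1 - x + real k) ^ Suc r))"
  proof -
    have "p * (inverse (p * A) + c * inverse (p * B)) = inverse A + c * inverse B" if "p \<noteq> 0" for p A B c :: real
    proof -
      have "p * inverse (p * A) = inverse A" for A using that by (cases "A = 0") (auto simp: field_simps)
      then show ?thesis by (simp only: distrib_left mult.left_commute[of p c])
    qed
    note cancel = this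
    show ?thesis
      unfolding block power_mult_distrib by (rule ext, rule cancel) (use N in simp)
  qed
  finally have "real N ^ Suc r * L = (- 1) ^ r * pi ^ Suc r / fact r * (deriv ^^ r) cot (pi * x)"
    using higher_deriv_cot_sums[OF x, of r] by (rule sums_unique2)
  note NL = this
  have nN: "real_of_int n = real N" by (simp flip: N(1))
  have "(- 1) ^ r * fact r * n ^ Suc r / pi ^ Suc r * L = (- 1) ^ r * fact r / pi ^ Suc r * (real N ^ Suc r * L)"
    by (simp add: nN)
  also have "\<dots> = (deriv ^^ r) cot (pi * x)"
    unfolding NL by (cases "even r") simp_all
  finally have "(deriv ^^ r) cot (pi * x) = (- 1) ^ r * fact r * n ^ Suc r / pi ^ Suc r * L" ..
  moreover have "pi * real_of_int j / real_of_int n = pi * x + pi * of_int (j div n)"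
  proof -
    have "real_of_int j = real_of_int n * of_int (j div n) + of_int (j mod n)"
      by (simp flip: of_int_add of_int_mult)
    also have "\<dots> = real N * of_int (j div n) + real a" unfolding a[symmetric] nN by simp
    finally show ?thesis using N nN by (simp add: x_def field_simps)
  qed
  ultimately show ?thesis by (simp only: higher_deriv_cot_periodic)
qed

section \<open>Convolution over half the residue units\<close>

lemma parity_class_uminus: "parity_class r n (- j) m = (- 1) ^ r * parity_class r n j m"
  by (simp add: parity_class_def algebra_simps flip: power_mult_distrib)

lemma cong_uminus_swap: "[- m = j] (mod n) \<longleftrightarrow> [m = - j] (mod (n :: int))"
  using cong_minus_minus_iff[of m "- j" n] by simp

lemma parity_class_uminus_arg: "parity_class r n j (- m) = (- 1) ^ r * parity_class r n j m"
  using cong_minus_minus_iff[of m j n]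
  by (simp add: parity_class_def algebra_simps cong_uminus_swap flip: power_mult_distrib)

lemma parity_class_cong:
  assumes "[j = j'] (mod n)" "[m = m'] (mod n)"
  shows "parity_class r n j m = parity_class r n j' m'"
proof -
  have "[m = j] (mod n) \<longleftrightarrow> [m' = j'] (mod n)" "[m = - j] (mod n) \<longleftrightarrow> [m' = - j'] (mod n)"
    using assms cong_minus_minus_iff[of j j' n] by (meson cong_sym cong_trans)+
  then show ?thesis by (simp add: parity_class_def)
qed

lemma parity_class_nonzeroD:
  assumes "parity_class r n j m \<noteq> 0"
  shows "[m = j] (mod n) \<or> [m = - j] (mod n)"
  using assms by (auto simp: parity_class_def split: if_splits)

lemma parity_class_coprime:
  assumes "parity_class r n j m \<noteq> 0" "coprime j n"
  shows "coprime m n"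
  using parity_class_nonzeroD[OF assms(1)] assms(2) by (metis cong_imp_coprime cong_sym coprime_minus_left_iff)

text \<open>If \<open>x \<equiv> -x\<close> for a unit \<open>x\<close>, then \<open>n\<close> divides \<open>2\<close>.\<close>
lemma parity_class_self:
  assumes "coprime x n" "n \<ge> 3"
  shows "parity_class r n x x = 1"
proof -
  have "\<not> [x = - x] (mod n)"
  proof
    assume "[x = - x] (mod n)"
    then have "n dvd x * 2" by (simp add: cong_iff_dvd_diff mult.commute)
    then have "n dvd 2" using assms(1) by (simp add: coprime_commute coprime_dvd_mult_right_iff)
    then show False using assms(2) zdvd_imp_le by fastforce
  qed
  then show ?thesis by (simp add: parity_class_def)
qed

lemma parity_class_mult:
  assumes "coprime x n"
  shows "parity_class r n (x * j) (x * m) = parity_class r n j m"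
  using cong_mult_lcancel[OF assms, of m j] cong_mult_lcancel[OF assms, of m "- j"]
  by (simp add: parity_class_def)

lemma abs_parity_class_le: "\<bar>parity_class r n j m\<bar> \<le> 2"
  by (cases "even r") (auto simp: parity_class_def)

lemma unit_function_parity_class:
  assumes "coprime j n"
  shows "unit_function n ((- 1) ^ r) (\<lambda>m. of_real (parity_class r n j m))"
  unfolding unit_function_def periodic_def
proof (intro conjI allI impI)
  show "complex_of_real (parity_class r n j (x + n)) = of_real (parity_class r n j x)" for x
    using parity_class_cong[of j j n "x + n" x r] by (simp add: Cong.cong_def)
  show "complex_of_real (parity_class r n j x) = 0" if "\<not> coprime x n" for x
    using parity_class_coprime[of r n j x] assms that by auto
qed (simp add: parity_class_uminus_arg)

lemma half_residues_representative:
  assumes "coprime x n" "n \<ge> 3"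
  obtains l \<sigma> where "l \<in> half_residues n" "\<sigma> = 1 \<or> \<sigma> = - 1" "[l = \<sigma> * x] (mod n)"
proof -
  define c where "c = x mod n"
  have c: "coprime c n" "0 \<le> c" "c < n" "[c = x] (mod n)" using assms by (auto simp: c_def)
  have "c \<noteq> 0" using c(1) assms(2) by auto
  show ?thesis
  proof (cases "2 * c \<le> n")
    case True
    then have "real_of_int c \<le> real_of_int n / 2" by linarith
    then show ?thesis using c \<open>c \<noteq> 0\<close> that[of c 1] by (auto simp: half_residues_def)
  next
    case False
    then have "real_of_int (n - c) \<le> real_of_int n / 2" by linarith
    moreover have "coprime (n - c) n"
      using c(1) by (metis coprime_commute coprime_minus_left_iff coprime_iff_gcd_eq_1 gcd_diff1 minus_diff_eq)
    moreover have "[n - c = - x] (mod n)"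
      using c(4) by (simp add: cong_iff_dvd_diff) (metis dvd_add_triv_left_iff dvd_diff_commute add_diff_eq diff_add_eq)
    ultimately show ?thesis using c(3) that[of "n - c" "-1"] by (auto simp: half_residues_def)
  qed
qed

lemma half_residues_unique:
  assumes "l \<in> half_residues n" "l' \<in> half_residues n" "n \<ge> 3" "[l = l'] (mod n) \<or> [l = - l'] (mod n)"
  shows "l = l'"
proof -
  have b: "1 \<le> l" "2 * l \<le> n" "1 \<le> l'" "2 * l' \<le> n" "coprime l n"
    using assms(1,2) by (auto simp: half_residues_def)
  from assms(4) show ?thesis
  proof
    assume "[l = l'] (mod n)"
    then show ?thesis using b assms(3) by (simp add: Cong.cong_def)
  next
    assume "[l = - l'] (mod n)"
    then have "n dvd l + l'" by (simp add: cong_iff_dvd_diff)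
    then have "n \<le> l + l'" using b by (intro zdvd_imp_le) auto
    then show ?thesis using b by linarith
  qed
qed

lemma half_residues_neg:
  assumes "l \<in> half_residues n" "l' \<in> half_residues n" "n \<ge> 3"
  shows "\<not> [l = - l'] (mod n)"
proof
  assume *: "[l = - l'] (mod n)"
  then have "l = l'" using half_residues_unique[OF assms] by simp
  moreover have "coprime l n" using assms(1) by (simp add: half_residues_def)
  ultimately have "parity_class 1 n l l = 0" using * by (auto simp: parity_class_def)
  then show False using parity_class_self[OF \<open>coprime l n\<close> assms(3), of 1] by simp
qed

lemma finite_half_residues: "finite (half_residues n)"
  by (rule finite_subset[of _ "{1..n}"]) (auto simp: half_residues_def)

text \<open>For \<open>x\<close> coprime to \<open>n\<close> the first factor singles out the one \<open>l\<close> with \<open>l b \<equiv> \<sigma>x\<close>, \<open>\<sigma> = \<plusminus>1\<close>, and equals \<open>\<sigma>\<^sup>r\<close> there. For this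
\<open>l\<close> the second factor is \<open>\<sigma>\<^sup>r\<close> times the right-hand side, and the signs cancel.\<close>
lemma sum_half_residues_parity_class:
  assumes n: "n \<ge> 3" and a: "coprime a n" and b: "coprime b n"
  shows "(\<Sum>l\<in>half_residues n. parity_class r n (l * b) x * parity_class r n (a * modular_inverse n l) y)
    = parity_class r n (a * b) (x * y)"
proof (cases "coprime x n")
  case False
  have "parity_class r n (l * b) x = 0" if "l \<in> half_residues n" for l
    using parity_class_coprime[of r n "l * b" x] that b False by (auto simp: half_residues_def)
  moreover have "parity_class r n (a * b) (x * y) = 0"
    using parity_class_coprime[of r n "a * b" "x * y"] a b False by auto
  ultimately show ?thesis by simp
next
  case x: True
  define b' where "b' = modular_inverse n b"
  have b': "[b * b' = 1] (mod n)" "coprime b' n" using b by (auto simp: b'_def cong_modular_inverse1)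
  obtain l \<sigma> where l: "l \<in> half_residues n" "\<sigma> = 1 \<or> \<sigma> = - 1" "[l = \<sigma> * (x * b')] (mod n)"
    using half_residues_representative[of "x * b'" n] x b' n by auto
  have \<sigma>: "\<sigma> * \<sigma> = 1" using l(2) by auto
  have lb: "[l * b = \<sigma> * x] (mod n)"
  proof -
    have "[l * b = \<sigma> * (x * b') * b] (mod n)" by (intro cong_mult l cong_refl)
    also have "\<sigma> * (x * b') * b = \<sigma> * x * (b * b')" by (simp add: mult_ac)
    also have "[\<dots> = \<sigma> * x * 1] (mod n)" by (intro cong_mult b' cong_refl)
    finally show ?thesis by simp
  qed
  have zero: "parity_class r n (k * b) x = 0" if k: "k \<in> half_residues n" "k \<noteq> l" for k
  proof (rule ccontr)
    assume "parity_class r n (k * b) x \<noteq> 0"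
    then obtain \<tau> where \<tau>: "\<tau> = 1 \<or> \<tau> = - 1" "[x = \<tau> * (k * b)] (mod n)"
      using parity_class_nonzeroD by (metis mult_1 mult_minus1)
    have "[l * b = \<sigma> * (\<tau> * (k * b))] (mod n)"
      by (rule cong_trans[OF lb]) (intro cong_mult \<tau> cong_refl)
    then have "[l * b = (\<sigma> * \<tau> * k) * b] (mod n)" by (simp add: mult_ac)
    then have "[l = \<sigma> * \<tau> * k] (mod n)" using cong_mult_rcancel[OF b] by blast
    then have "[l = k] (mod n) \<or> [l = - k] (mod n)" using l(2) \<tau>(1) by auto
    then show False using half_residues_unique[OF l(1) k(1) n] k(2) by simp
  qed
  have sgn: "parity_class r n (\<sigma> * j) m = of_int \<sigma> ^ r * parity_class r n j m" for j m
    using l(2) by (auto simp: parity_class_uminus)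
  have "(\<Sum>k\<in>half_residues n. parity_class r n (k * b) x * parity_class r n (a * modular_inverse n k) y)
      = parity_class r n (l * b) x * parity_class r n (a * modular_inverse n l) y"
    using zero l(1) finite_half_residues by (subst sum.mono_neutral_right[of _ "{l}"]) auto
  also have "parity_class r n (l * b) x = of_int \<sigma> ^ r"
    using parity_class_cong[OF lb cong_refl, of r x] sgn parity_class_self[OF x n] by simp
  also have "parity_class r n (a * modular_inverse n l) y = of_int \<sigma> ^ r * parity_class r n (a * b) (x * y)"
  proof -
    have ln: "coprime l n" using l by (simp add: half_residues_def)
    have "parity_class r n (a * modular_inverse n l) y = parity_class r n (l * (a * modular_inverse n l)) (l * y)"
      by (rule parity_class_mult[OF ln, symmetric])
    also have "\<dots> = parity_class r n (b * a) (b * (l * y))"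
    proof -
      have "[l * (a * modular_inverse n l) = a] (mod n)"
        using cong_mult[OF cong_modular_inverse1[OF ln] cong_refl[of a]] by (simp add: mult_ac)
      then have "parity_class r n (l * (a * modular_inverse n l)) (l * y) = parity_class r n a (l * y)"
        by (intro parity_class_cong cong_refl)
      then show ?thesis using parity_class_mult[OF b] by simp
    qed
    also have "\<dots> = parity_class r n (a * b) (\<sigma> * (x * y))"
      using cong_mult[OF lb cong_refl[of y]] by (intro parity_class_cong) (auto simp: mult_ac)
    also have "\<dots> = of_int \<sigma> ^ r * parity_class r n (a * b) (x * y)"
      using l(2) by (auto simp: parity_class_uminus_arg)
    finally show ?thesis .
  qed
  also have "of_int \<sigma> ^ r * (of_int \<sigma> ^ r * parity_class r n (a * b) (x * y)) = parity_class r n (a * b) (x * y)"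
    using \<sigma> by (simp add: mult.assoc[symmetric] flip: power_mult_distrib of_int_mult)
  finally show ?thesis .
qed

definition class_coeff :: "nat \<Rightarrow> int \<Rightarrow> int \<Rightarrow> nat \<Rightarrow> complex" where
  "class_coeff r n j m = of_real (parity_class r n j (int m))"

lemma norm_class_coeff_le: "norm (class_coeff r n j m) \<le> 2"
  by (simp add: class_coeff_def abs_parity_class_le)

lemma norm_moebius_class_coeff_le: "norm (of_int (moebius_mu m) * class_coeff r n j m) \<le> 2"
proof -
  have "norm (of_int (moebius_mu m) :: complex) \<le> 1"
    using abs_moebius_mu_le[of m] by (simp flip: of_int_abs)
  then show ?thesis unfolding norm_mult
    using mult_mono[of _ 1 "norm (class_coeff r n j m)" 2] norm_class_coeff_le[of r n j m] by simp
qed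

lemma has_sum_finite_sum:
  fixes f :: "'i \<Rightarrow> 'a \<Rightarrow> complex"
  assumes "finite I" "\<And>i. i \<in> I \<Longrightarrow> (f i has_sum S i) A"
  shows "((\<lambda>x. \<Sum>i\<in>I. f i x) has_sum (\<Sum>i\<in>I. S i)) A"
  using assms by (induction I rule: finite_induct) (auto intro!: has_sum_add)

text \<open>Absolute convergence allows the products to be multiplied out. By \<open>sum_half_residues_parity_class\<close> the coefficient at \<open>N\<close> of
the sum of products is the weight of \<open>N\<close> in the class \<open>ab\<close> times the sum of \<open>\<mu>\<close> over the divisors of \<open>N\<close>, so only \<open>N = 1\<close> remains.\<close>
lemma half_residues_dirichlet_identity:
  assumes n: "n \<ge> 3" and a: "coprime a n" and b: "coprime b n" and s: "Re s > 1"
  shows "(\<Sum>l\<in>half_residues n. dirichlet_sum (class_coeff r n (a * modular_inverse n l)) s *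
      dirichlet_sum (\<lambda>m. of_int (moebius_mu m) * class_coeff r n (l * b) m) s) = of_real (parity_class r n (a * b) 1)"
proof -
  define c where "c l N = (\<Sum>d | d dvd N. of_int (moebius_mu d) * class_coeff r n (l * b) d *
      class_coeff r n (a * modular_inverse n l) (N div d))" for l N
  have "(dirichlet_term (c l) s has_sum dirichlet_sum (\<lambda>m. of_int (moebius_mu m) * class_coeff r n (l * b) m) s *
      dirichlet_sum (class_coeff r n (a * modular_inverse n l)) s) UNIV" for l
    unfolding c_def
    by (rule dirichlet_convolution_has_sum; rule summable_dirichlet_term[OF _ s])
       (rule norm_moebius_class_coeff_le norm_class_coeff_le)+
  then have "((\<lambda>N. \<Sum>l\<in>half_residues n. dirichlet_term (c l) s N) has_sum
      (\<Sum>l\<in>half_residues n. dirichlet_sum (\<lambda>m. of_int (moebius_mu m) * class_coeff r n (l * b) m) s *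
      dirichlet_sum (class_coeff r n (a * modular_inverse n l)) s)) UNIV"
    by (intro has_sum_finite_sum finite_half_residues)
  moreover have "(\<Sum>l\<in>half_residues n. dirichlet_term (c l) s N) = (if N = 1 then of_real (parity_class r n (a * b) 1) else 0)" for N
  proof (cases "N = 0")
    case False
    have "(\<Sum>l\<in>half_residues n. c l N) = (\<Sum>d | d dvd N. of_int (moebius_mu d) *
        of_real (\<Sum>l\<in>half_residues n. parity_class r n (l * b) (int d) * parity_class r n (a * modular_inverse n l) (int (N div d))))"
      unfolding c_def class_coeff_def by (subst sum.swap) (simp add: sum_distrib_left mult_ac)
    also have "\<dots> = (\<Sum>d | d dvd N. of_int (moebius_mu d) * of_real (parity_class r n (a * b) (int N)))"
      unfolding sum_half_residues_parity_class[OF n a b]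
      by (intro sum.cong refl) (auto simp flip: of_nat_mult)
    also have "\<dots> = of_int (\<Sum>d | d dvd N. moebius_mu d) * of_real (parity_class r n (a * b) (int N))"
      by (simp add: sum_distrib_right)
    finally have "(\<Sum>l\<in>half_residues n. c l N) = (if N = 1 then of_real (parity_class r n (a * b) 1) else 0)"
      using sum_moebius_mu_divisors[of N] False by simp
    then show ?thesis by (simp add: sum_distrib_right[symmetric])
  qed simp
  moreover have "((\<lambda>N::nat. if N = 1 then of_real (parity_class r n (a * b) 1) else 0 :: complex) has_sum
      of_real (parity_class r n (a * b) 1)) UNIV"
    by (rule has_sum_finite_neutralI[of "{1}"]) auto
  ultimately show ?thesis by (simp add: has_sum_unique mult.commute)
qed

section \<open>Cotangent numbers and Hecke's numbers as values of the series\<close>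

lemma powr_minus_of_nat:
  assumes "r \<ge> 1"
  shows "(of_nat m :: complex) powr (- of_nat r) = of_real (1 / real m ^ r)"
  using assms by (cases "m = 0") (simp_all add: powr_minus divide_inverse power_0_left)

text \<open>Having such a continuation is a linear property of the coefficient function. It holds for an
odd character, with continuation \<open>1/L\<close>, hence for every odd function on the units.\<close>
lemma moebius_odd_class_coeff_analytic:
  assumes n: "n \<ge> 3" and j: "coprime j n"
  obtains F where "F analytic_on {s. Re s \<ge> 1}"
    "\<And>s. Re s > 1 \<Longrightarrow> dirichlet_term (\<lambda>m. of_int (moebius_mu m) * class_coeff 1 n j m) s sums F s"
proof -
  define Q where "Q f \<longleftrightarrow> (\<exists>F. F analytic_on {s. Re s \<ge> 1} \<and>
    (\<forall>s. Re s > 1 \<longrightarrow> dirichlet_term (\<lambda>m. of_int (moebius_mu m) * f (int m)) s sums F s))" for f :: "int \<Rightarrow> complex"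
  have "Q (\<lambda>m. of_real (parity_class 1 n j m))"
  proof (rule character_induct[of n Q "- 1"])
    show "n > 0" using n by simp
    show "Q (\<lambda>_. 0)" unfolding Q_def by (rule exI[of _ "\<lambda>_. 0"]) auto
    show "Q (\<lambda>x. f x + g x)" if fg: "Q f" "Q g" for f g
    proof -
      obtain F G where FG: "F analytic_on {s. Re s \<ge> 1}" "G analytic_on {s. Re s \<ge> 1}"
        "\<And>s. Re s > 1 \<Longrightarrow> dirichlet_term (\<lambda>m. of_int (moebius_mu m) * f (int m)) s sums F s"
        "\<And>s. Re s > 1 \<Longrightarrow> dirichlet_term (\<lambda>m. of_int (moebius_mu m) * g (int m)) s sums G s"
        using fg unfolding Q_def by blast
      have "dirichlet_term (\<lambda>m. of_int (moebius_mu m) * (f (int m) + g (int m))) s sums (F s + G s)" if "Re s > 1" for s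
        using sums_add[OF FG(3,4)[OF that]] by (simp add: algebra_simps)
      then show ?thesis unfolding Q_def using analytic_on_add[OF FG(1,2)] by blast
    qed
    show "Q (\<lambda>x. c * f x)" if f: "Q f" for c f
    proof -
      obtain F where F: "F analytic_on {s. Re s \<ge> 1}"
        "\<And>s. Re s > 1 \<Longrightarrow> dirichlet_term (\<lambda>m. of_int (moebius_mu m) * f (int m)) s sums F s"
        using f unfolding Q_def by blast
      have "dirichlet_term (\<lambda>m. of_int (moebius_mu m) * (c * f (int m))) s sums (c * F s)" if "Re s > 1" for s
        using sums_mult[OF F(2)[OF that], of c] by (simp add: mult_ac)
      then show ?thesis unfolding Q_def using analytic_on_mult[OF analytic_on_const F(1)] by blast
    qed
    show "Q \<psi>" if \<psi>: "dirichlet_character n \<psi>" "\<psi> (- 1) = - 1" for \<psi>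
    proof -
      note \<psi>' = dirichlet_characterD[OF \<psi>(1)]
      have odd: "\<psi> (- x) = - \<psi> x" for x using \<psi>'(2)[of "-1" x] \<psi>(2) by simp
      have norm_\<psi>: "norm (\<psi> x) \<le> 1" for x
        using norm_dirichlet_character[OF \<psi>(1), of x] n by simp
      obtain L where L: "L holomorphic_on {s. Re s > 0}"
        "\<And>s. Re s > 0 \<Longrightarrow> dirichlet_term (\<lambda>m. \<psi> (int m)) s sums L s"
        using odd_periodic_dirichlet_series[OF \<psi>'(1) odd] n by auto
      have nz: "L s \<noteq> 0" if "Re s \<ge> 1" for s
        using odd_character_L_nonzero[OF \<psi> _ L that] n by simp
      have "L analytic_on {s. Re s > 0}"
        using L(1) by (subst analytic_on_open) (auto simp: open_halfspace_Re_gt)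
      then have "L analytic_on {s. Re s \<ge> 1}" by (rule analytic_on_subset) auto
      then have "(\<lambda>s. inverse (L s)) analytic_on {s. Re s \<ge> 1}"
        using nz by (intro analytic_on_inverse) auto
      moreover have "dirichlet_term (\<lambda>m. of_int (moebius_mu m) * \<psi> (int m)) s sums inverse (L s)" if s: "Re s > 1" for s
      proof -
        have "dirichlet_sum (\<lambda>m. of_int (moebius_mu m) * \<psi> (int m)) s * dirichlet_sum (\<lambda>m. \<psi> (int m)) s = 1"
          by (rule completely_multiplicative_moebius_inverse) (use s norm_\<psi> \<psi>' in auto)
        moreover have "dirichlet_sum (\<lambda>m. \<psi> (int m)) s = L s"
          by (rule dirichlet_sum_eqI[OF summable_dirichlet_term[OF norm_\<psi> s]]) (use s in \<open>auto intro: L(2)\<close>)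
        ultimately have eq: "dirichlet_sum (\<lambda>m. of_int (moebius_mu m) * \<psi> (int m)) s = inverse (L s)"
          using nz[of s] s by (simp add: field_simps)
        have bound: "norm (of_int (moebius_mu m) * \<psi> (int m)) \<le> 1" for m
          using norm_\<psi>[of "int m"] abs_moebius_mu_le[of m]
          by (auto simp: norm_mult intro!: mult_le_one simp flip: of_int_abs)
        have "(\<lambda>m. norm (dirichlet_term (\<lambda>m. of_int (moebius_mu m) * \<psi> (int m)) s m)) summable_on UNIV"
          by (rule summable_dirichlet_term[OF _ s]) (rule bound)
        from dirichlet_sum_sums(2)[OF this] show ?thesis by (simp only: eq)
      qed
      ultimately show ?thesis unfolding Q_def by blast
    qed
    show "unit_function n (- 1) (\<lambda>m. complex_of_real (parity_class 1 n j m))"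
      using unit_function_parity_class[OF j, of 1] by simp
  qed
  then show ?thesis unfolding Q_def class_coeff_def[symmetric] using that by blast
qed

lemma analytic_tendsto_at_right_1:
  assumes "F analytic_on S" "1 \<in> S"
  shows "((\<lambda>x. F (complex_of_real x)) \<longlongrightarrow> F 1) (at_right 1)"
proof -
  have "isCont F 1" using assms analytic_at_imp_isCont analytic_on_analytic_at by blast
  moreover have "((\<lambda>x. complex_of_real x) \<longlongrightarrow> 1) (at_right 1)"
    using tendsto_of_real[OF tendsto_ident_at[of "1::real" "{1<..}"], where 'a = complex] by simp
  ultimately show ?thesis by (rule isCont_tendsto_compose)
qed

lemma eventually_at_right_1: "\<forall>\<^sub>F x in at_right (1::real). x > 1"
  by (simp add: eventually_at_right_less)

lemma hecke_partial_sum: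
  "(\<Sum>m | \<bar>m\<bar> \<le> int k \<and> [m = j] (mod n). real_of_int (moebius_mu (nat \<bar>m\<bar>)) / real_of_int m ^ r)
    = (\<Sum>m\<le>k. real_of_int (moebius_mu m) * parity_class r n j (int m) / real m ^ r)"
proof -
  define f where "f m = real_of_int (moebius_mu (nat \<bar>m\<bar>)) / real_of_int m ^ r * of_bool ([m = j] (mod n))" for m
  have "(\<Sum>m | \<bar>m\<bar> \<le> int k \<and> [m = j] (mod n). real_of_int (moebius_mu (nat \<bar>m\<bar>)) / real_of_int m ^ r)
      = (\<Sum>m\<in>{- int k..int k}. f m)"
    by (rule sum.mono_neutral_cong_left) (auto simp: f_def)
  also have "{- int k..int k} = insert 0 (int ` {1..k} \<union> (\<lambda>m. - int m) ` {1..k})"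
  proof (intro set_eqI iffI)
    fix x assume x: "x \<in> {- int k..int k}"
    then have "x = 0 \<or> (x = int (nat x) \<and> nat x \<in> {1..k}) \<or> (x = - int (nat (- x)) \<and> nat (- x) \<in> {1..k})"
      by auto
    then show "x \<in> insert 0 (int ` {1..k} \<union> (\<lambda>m. - int m) ` {1..k})" by blast
  qed auto
  also have "(\<Sum>m\<in>insert 0 (int ` {1..k} \<union> (\<lambda>m. - int m) ` {1..k}). f m)
      = (\<Sum>m\<in>int ` {1..k}. f m) + (\<Sum>m\<in>(\<lambda>m. - int m) ` {1..k}. f m)"
    by (subst sum.insert) (auto simp: f_def intro!: sum.union_disjoint)
  also have "\<dots> = (\<Sum>m=1..k. f (int m) + f (- int m))"
    by (simp add: sum.reindex inj_on_def sum.distrib)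
  also have "\<dots> = (\<Sum>m=1..k. real_of_int (moebius_mu m) * parity_class r n j (int m) / real m ^ r)"
  proof (intro sum.cong refl)
    fix m
    have "(- real m) ^ r = (- 1) ^ r * real m ^ r" by (simp flip: power_mult_distrib)
    then show "f (int m) + f (- int m) = real_of_int (moebius_mu m) * parity_class r n j (int m) / real m ^ r"
      by (cases "even r") (simp_all add: f_def parity_class_def cong_uminus_swap add_divide_distrib diff_divide_distrib distrib_left)
  qed
  also have "\<dots> = (\<Sum>m\<le>k. real_of_int (moebius_mu m) * parity_class r n j (int m) / real m ^ r)"
    by (rule sum.mono_neutral_left) (auto simp: Suc_le_eq)
  finally show ?thesis .
qed

text \<open>Both definitions of Hecke's number are limits of the symmetric partial sums: for \<open>r = 1\<close> literally, for \<open>r \<ge> 2\<close> because the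
symmetric sets exhaust the residue class and the unordered sum converges.\<close>
lemma hecke_number_eqI:
  assumes "r \<ge> 1" and sums: "dirichlet_term (\<lambda>m. of_int (moebius_mu m) * class_coeff r n j m) (of_nat r) sums D"
  shows "D = of_real (hecke_number r n j)"
proof -
  define g where "g m = real_of_int (moebius_mu m) * parity_class r n j (int m) / real m ^ r" for m
  have dt: "dirichlet_term (\<lambda>m. of_int (moebius_mu m) * class_coeff r n j m) (of_nat r) m = of_real (g m)" for m
    unfolding powr_minus_of_nat[OF assms(1)] by (simp add: g_def class_coeff_def)
  have D: "(\<lambda>m. complex_of_real (g m)) sums D" using sums unfolding dt .
  have g: "g sums Re D" using sums_Re[OF D] by simp
  have "(\<lambda>m. 0) sums Im D" using sums_Im[OF D] by simp
  then have "Im D = 0" using sums_unique2 sums_zero by blast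
  then have D_real: "D = of_real (Re D)" by (simp add: complex_eq_iff)
  define h where "h m = real_of_int (moebius_mu (nat \<bar>m\<bar>)) / real_of_int m ^ r" for m
  have lim: "(\<lambda>k. \<Sum>m | \<bar>m\<bar> \<le> int k \<and> [m = j] (mod n). h m) \<longlonglongrightarrow> Re D"
    using g unfolding h_def hecke_partial_sum sums_def_le g_def .
  have "hecke_number r n j = Re D"
  proof (cases "r = 1")
    case True
    have "hecke_number r n j = lim (\<lambda>k. \<Sum>m | \<bar>m\<bar> \<le> int k \<and> [m = j] (mod n). h m)"
      unfolding hecke_number_def Let_def using True by (simp add: h_def)
    then show ?thesis using limI[OF lim] by simp
  next
    case False
    then have r: "r \<ge> 2" using assms(1) by simp
    have bound: "summable (\<lambda>m. 1 / real m ^ r)"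
      using r inverse_power_summable[of r, where 'a = real] by (simp add: divide_inverse)
    have nat_summ: "(\<lambda>m::nat. 1 / real m ^ r) summable_on UNIV"
      by (rule norm_summable_imp_summable_on) (use bound in simp)
    have int_summ: "(\<lambda>m::int. 1 / \<bar>real_of_int m\<bar> ^ r) summable_on UNIV"
    proof -
      have "(\<lambda>m::int. 1 / \<bar>real_of_int m\<bar> ^ r) summable_on range int"
        by (subst summable_on_reindex) (use nat_summ in \<open>auto simp: inj_on_def o_def\<close>)
      moreover have "(\<lambda>m::int. 1 / \<bar>real_of_int m\<bar> ^ r) summable_on range (\<lambda>m. - int m)"
        by (subst summable_on_reindex) (use nat_summ in \<open>auto simp: inj_on_def o_def\<close>)
      moreover have "range int \<union> range (\<lambda>m. - int m) = UNIV"
        by (auto simp: image_iff) (metis int_cases2)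
      ultimately show ?thesis using summable_on_union by metis
    qed
    have "(\<lambda>m. norm (h m)) summable_on UNIV"
    proof (rule Infinite_Sum.abs_summable_on_comparison_test'[OF int_summ])
      fix m :: int
      have "\<bar>real_of_int (moebius_mu (nat \<bar>m\<bar>))\<bar> \<le> 1"
        using abs_moebius_mu_le[of "nat \<bar>m\<bar>"] by (simp flip: of_int_abs)
      then show "norm (h m) \<le> 1 / \<bar>real_of_int m\<bar> ^ r"
        by (simp add: h_def power_abs divide_right_mono)
    qed
    then have "h summable_on UNIV" by (rule abs_summable_summable)
    then have "h summable_on {m. [m = j] (mod n)}" by (rule summable_on_subset_banach) auto
    then have "(sum h \<longlongrightarrow> infsum h {m. [m = j] (mod n)}) (finite_subsets_at_top {m. [m = j] (mod n)})"
      by (rule infsum_tendsto)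
    moreover have "filterlim (\<lambda>k. {m. \<bar>m\<bar> \<le> int k \<and> [m = j] (mod n)}) (finite_subsets_at_top {m. [m = j] (mod n)}) sequentially"
    proof (rule filterlim_finite_subsets_at_top[THEN iffD2], intro allI impI)
      fix X assume X: "finite X \<and> X \<subseteq> {m. [m = j] (mod n)}"
      then obtain K where K: "\<And>x. x \<in> X \<Longrightarrow> \<bar>x\<bar> \<le> K"
        by (metis Max_ge finite_imageI imageI)
      have fin: "finite {m. \<bar>m\<bar> \<le> int k \<and> [m = j] (mod n)}" for k
        by (rule finite_subset[of _ "{- int k..int k}"]) auto
      show "\<forall>\<^sub>F k in sequentially. finite {m. \<bar>m\<bar> \<le> int k \<and> [m = j] (mod n)} \<and>
          X \<subseteq> {m. \<bar>m\<bar> \<le> int k \<and> [m = j] (mod n)} \<and> {m. \<bar>m\<bar> \<le> int k \<and> [m = j] (mod n)} \<subseteq> {m. [m = j] (mod n)}"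
        using eventually_ge_at_top[of "nat K"]
      proof eventually_elim
        case (elim k)
        then show ?case using X K fin by fastforce
      qed
    qed
    ultimately have "(\<lambda>k. \<Sum>m | \<bar>m\<bar> \<le> int k \<and> [m = j] (mod n). h m) \<longlonglongrightarrow> infsum h {m. [m = j] (mod n)}"
      by (rule filterlim_compose)
    then have "infsum h {m. [m = j] (mod n)} = Re D" using lim LIMSEQ_unique by blast
    then show ?thesis using False unfolding hecke_number_def Let_def h_def[abs_def] by simp
  qed
  then show ?thesis using D_real by simp
qed

lemma cotangent_number_eqI:
  assumes n: "n \<ge> 3" and j: "coprime j n" and r: "r \<ge> 1"
    and sums: "dirichlet_term (class_coeff r n j) (of_nat r) sums Z"
  shows "cotangent_number r n j = \<i> ^ r * ((- 1) ^ (r - 1) * fact (r - 1) * of_int n ^ r / of_real pi ^ r) * Z"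
proof -
  obtain q where q: "r = Suc q" using r by (cases r) auto
  define g where "g m = parity_class r n j (int m) / real m ^ r" for m
  have dt: "dirichlet_term (class_coeff r n j) (of_nat r) m = of_real (g m)" for m
    unfolding powr_minus_of_nat[OF r] by (simp add: g_def class_coeff_def)
  have Z: "(\<lambda>m. complex_of_real (g m)) sums Z" using sums unfolding dt .
  have g: "g sums Re Z" using sums_Re[OF Z] by simp
  have "(\<lambda>m. 0) sums Im Z" using sums_Im[OF Z] by simp
  then have "Im Z = 0" using sums_unique2 sums_zero by blast
  then have Z_real: "Z = of_real (Re Z)" by (simp add: complex_eq_iff)
  have "\<not> n dvd j"
  proof
    assume "n dvd j"
    then have "is_unit n" using j coprime_common_divisor[of j n n] by auto
    then show False using n by auto
  qed
  then have "(deriv ^^ q) cot (pi * real_of_int j / real_of_int n) = (- 1) ^ q * fact q * n ^ Suc q / pi ^ Suc q * Re Z"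
    using g n unfolding g_def[abs_def] q by (intro cot_dirichlet_series) simp_all
  then show ?thesis
    by (subst Z_real) (simp add: cotangent_number_def q)
qed

text \<open>Passage from exponents \<open>s\<close> with \<open>Re s > 1\<close> to the exponent \<open>r\<close>. Only \<open>r = 1\<close> lies on the boundary; there both families of series
have analytic continuations that agree with the sums at \<open>1\<close>, and the identity extends by continuity along the real axis.\<close>
lemma cotangent_hecke_sum_limit:
  assumes n: "n \<ge> 3" and a: "\<And>l. l \<in> half_residues n \<Longrightarrow> coprime (a l) n" and b: "\<And>l. l \<in> half_residues n \<Longrightarrow> coprime (b l) n"
    and r: "r \<ge> 1"
    and C: "\<And>s. Re s > 1 \<Longrightarrow> (\<Sum>l\<in>half_residues n. dirichlet_sum (class_coeff r n (a l)) s *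
        dirichlet_sum (\<lambda>m. of_int (moebius_mu m) * class_coeff r n (b l) m) s) = C"
  obtains Z where "\<And>l. l \<in> half_residues n \<Longrightarrow> dirichlet_term (class_coeff r n (a l)) (of_nat r) sums Z l"
    "(\<Sum>l\<in>half_residues n. Z l * of_real (hecke_number r n (b l))) = C"
proof (cases "r = 1")
  case False
  then have r2: "Re (of_nat r) > 1" using r by simp
  show ?thesis
  proof (rule that)
    show "dirichlet_term (class_coeff r n (a l)) (of_nat r) sums dirichlet_sum (class_coeff r n (a l)) (of_nat r)" for l
      by (rule dirichlet_sum_sums(2)[OF summable_dirichlet_term[OF norm_class_coeff_le r2]])
    have "dirichlet_sum (\<lambda>m. of_int (moebius_mu m) * class_coeff r n (b l) m) (of_nat r) = of_real (hecke_number r n (b l))" for l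
      by (rule hecke_number_eqI[OF r dirichlet_sum_sums(2)[OF summable_dirichlet_term[OF norm_moebius_class_coeff_le r2]]])
    then show "(\<Sum>l\<in>half_residues n. dirichlet_sum (class_coeff r n (a l)) (of_nat r) * of_real (hecke_number r n (b l))) = C"
      using C[OF r2] by simp
  qed
next
  case True
  have "\<exists>L. L analytic_on {s. Re s > 0} \<and> (\<forall>s. Re s > 0 \<longrightarrow> dirichlet_term (class_coeff 1 n (a l)) s sums L s)"
    if l: "l \<in> half_residues n" for l
  proof -
    have "unit_function n (- 1) (\<lambda>m. complex_of_real (parity_class 1 n (a l) m))"
      using unit_function_parity_class[OF a[OF l], of 1] by simp
    then obtain L where "L holomorphic_on {s. Re s > 0}"
      "\<And>s. Re s > 0 \<Longrightarrow> dirichlet_term (\<lambda>m. complex_of_real (parity_class 1 n (a l) (int m))) s sums L s"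
      using odd_periodic_dirichlet_series[of n "\<lambda>m. complex_of_real (parity_class 1 n (a l) m)"] n
      by (auto simp: unit_function_def)
    then show ?thesis
      by (auto simp: class_coeff_def analytic_on_open open_halfspace_Re_gt intro!: exI[of _ L])
  qed
  then obtain L where L: "\<And>l. l \<in> half_residues n \<Longrightarrow> L l analytic_on {s. Re s > 0}"
    "\<And>l s. l \<in> half_residues n \<Longrightarrow> Re s > 0 \<Longrightarrow> dirichlet_term (class_coeff 1 n (a l)) s sums L l s"
    by metis
  have "\<exists>F. F analytic_on {s. Re s \<ge> 1} \<and>
      (\<forall>s. Re s > 1 \<longrightarrow> dirichlet_term (\<lambda>m. of_int (moebius_mu m) * class_coeff 1 n (b l) m) s sums F s)"
    if l: "l \<in> half_residues n" for l
    using moebius_odd_class_coeff_analytic[OF n b[OF l]] by blast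
  then obtain F where F: "\<And>l. l \<in> half_residues n \<Longrightarrow> F l analytic_on {s. Re s \<ge> 1}"
    "\<And>l s. l \<in> half_residues n \<Longrightarrow> Re s > 1 \<Longrightarrow>
      dirichlet_term (\<lambda>m. of_int (moebius_mu m) * class_coeff 1 n (b l) m) s sums F l s"
    by metis
  have hecke: "F l 1 = of_real (hecke_number 1 n (b l))" if l: "l \<in> half_residues n" for l
    by (rule hecke_number_eqI)
       (use newman_tauberian[OF norm_moebius_class_coeff_le F(1)[OF l] F(2)[OF l]] in auto)
  have eq: "(\<Sum>l\<in>half_residues n. L l s * F l s) = C" if s: "Re s > 1" for s
  proof -
    have "dirichlet_sum (class_coeff 1 n (a l)) s = L l s" if "l \<in> half_residues n" for l
      by (rule dirichlet_sum_eqI[OF summable_dirichlet_term[OF norm_class_coeff_le s]]) (use L(2)[OF that] s in auto)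
    moreover have "dirichlet_sum (\<lambda>m. of_int (moebius_mu m) * class_coeff 1 n (b l) m) s = F l s"
      if "l \<in> half_residues n" for l
      by (rule dirichlet_sum_eqI[OF summable_dirichlet_term[OF norm_moebius_class_coeff_le s]]) (use F(2)[OF that] s in auto)
    ultimately show ?thesis using C[OF s] True by simp
  qed
  have "((\<lambda>x. \<Sum>l\<in>half_residues n. L l (of_real x) * F l (of_real x)) \<longlongrightarrow>
      (\<Sum>l\<in>half_residues n. L l 1 * F l 1)) (at_right 1)"
    by (intro tendsto_sum tendsto_mult; rule analytic_tendsto_at_right_1, erule L(1) F(1), simp)
  moreover have "((\<lambda>x. \<Sum>l\<in>half_residues n. L l (of_real x) * F l (of_real x)) \<longlongrightarrow> C) (at_right 1)"
    by (rule tendsto_eventually, rule eventually_mono[OF eventually_at_right_1]) (simp add: eq)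
  ultimately have "(\<Sum>l\<in>half_residues n. L l 1 * F l 1) = C"
    using tendsto_unique[of "at_right (1::real)"] by simp
  then show ?thesis
    by (intro that[of "\<lambda>l. L l 1"]) (use L(2)[of _ 1] hecke True in auto)
qed

theorem proposition1:
  fixes n s t :: int and r :: nat
  assumes "n \<ge> 3" and "r \<ge> 1"
    and "s \<in> half_residues n" and "t \<in> half_residues n"
  shows "(\<Sum>l\<in>half_residues n.
            cotangent_number r n (s * modular_inverse n l) *
            inverse_cotangent_number r n (l * modular_inverse n t))
         = (if s = t then 1 else 0)"
proof -
  have cop: "coprime l n" if "l \<in> half_residues n" for l
    using that by (simp add: half_residues_def)
  define b where "b = modular_inverse n t"
  have b: "coprime b n" "[t * b = 1] (mod n)"
    using cop[OF assms(4)] by (auto simp: b_def cong_modular_inverse1)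
  have s: "coprime s n" by (rule cop[OF assms(3)])
  obtain Z where Z: "\<And>l. l \<in> half_residues n \<Longrightarrow> dirichlet_term (class_coeff r n (s * modular_inverse n l)) (of_nat r) sums Z l"
    "(\<Sum>l\<in>half_residues n. Z l * of_real (hecke_number r n (l * b))) = of_real (parity_class r n (s * b) 1)"
    using cotangent_hecke_sum_limit[OF assms(1) _ _ assms(2) half_residues_dirichlet_identity[OF assms(1) s b(1)]]
      cop s b(1) by (auto simp: coprime_modular_inverse)
  have "cotangent_number r n (s * modular_inverse n l) * inverse_cotangent_number r n (l * b) =
      Z l * of_real (hecke_number r n (l * b))" if l: "l \<in> half_residues n" for l
  proof -
    have ct: "cotangent_number r n (s * modular_inverse n l) =
        \<i> ^ r * ((- 1) ^ (r - 1) * fact (r - 1) * of_int n ^ r / of_real pi ^ r) * Z l"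
      by (rule cotangent_number_eqI[OF assms(1) _ assms(2) Z(1)[OF l]]) (use s cop[OF l] in auto)
    obtain q where q: "r = Suc q" using assms(2) by (cases r) auto
    have "\<i> ^ r * \<i> ^ r = (- 1) ^ r" by (simp flip: power_mult_distrib)
    then have sgn: "- (\<i> ^ r * \<i> ^ r * (- 1) ^ (r - 1)) = (1 :: complex)"
      by (simp add: q flip: power_mult_distrib)
    have alg: "(I * (e * f * N / P) * z) * (- (I * P) / (f * N) * h) = - (I * I * e) * (z * h)"
      if "f \<noteq> 0" "N \<noteq> 0" "P \<noteq> 0" for I e f N P z h :: complex
      using that by (simp add: field_simps)
    have nz: "(fact (r - 1) :: complex) \<noteq> 0" "(of_int n :: complex) ^ r \<noteq> 0" "complex_of_real pi ^ r \<noteq> 0"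
      using assms(1) by auto
    show ?thesis
      unfolding ct inverse_cotangent_number_def alg[OF nz] sgn by simp
  qed
  then have "(\<Sum>l\<in>half_residues n. cotangent_number r n (s * modular_inverse n l) *
      inverse_cotangent_number r n (l * modular_inverse n t)) = of_real (parity_class r n (s * b) 1)"
    using Z(2) by (simp add: b_def)
  also have "parity_class r n (s * b) 1 = parity_class r n (s * b) (t * b)"
    by (rule parity_class_cong) (use b(2) in \<open>auto simp: cong_sym\<close>)
  also have "\<dots> = parity_class r n s t"
    using parity_class_mult[OF b(1), of r s t] by (simp add: mult.commute)
  also have "\<dots> = (if s = t then 1 else 0)"
  proof (cases "s = t")
    case True
    then show ?thesis using parity_class_self[OF s assms(1)] by simp
  next
    case False
    then have "\<not> [t = s] (mod n)" "\<not> [t = - s] (mod n)"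
      using half_residues_unique[OF assms(4,3,1)] half_residues_neg[OF assms(4,3,1)] by auto
    then show ?thesis using False by (simp add: parity_class_def)
  qed
  finally show ?thesis by simp
qed

end
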